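(* Let $\sigma>0$ and $\tilde\mu\in\mathbb{R}$ be constants. Let $\tilde f \in C^1([0,1])$ satisfy $\tilde f(0) = \tilde f(1) = 0$, with exactly one interior zero $q^* \in (0,1)$, $\tilde f < 0$ on $(0, q^* )$, $\tilde f > 0$ on $(q^*, 1)$, and $\tilde f'(0) < 0$, $\tilde f'(q^* ) > 0$, $\tilde f'(1) < 0$. Let $(c,V)$ be the traveling wave described in the context. Then for every CDF initial condition $w_0$ on $\mathbb{R}$, there exist $y_0 \in \mathbb{R}$ and constants $K, \gamma > 0$ such that the unique bounded solution $w$ of $$\partial_t w = \frac{\sigma^2}{2}\,\partial^2_{yy} w - \tilde\mu\,\partial_y w + \tilde f(w),\qquad t>0,\ y\in\mathbb{R},$$ started from $w_0$ satisfies $$\sup_{y \in \mathbb{R}}\, \big| w(t, y) - V(y - ct - y_0) \big| \;\leq\; K e^{-\gamma t}, \qquad t \geq 0.$$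
   Context: A CDF on $\mathbb{R}$ is a nondecreasing right-continuous function with limits $0$ at $-\infty$ and $1$ at $+\infty$ (jumps are allowed). Traveling wave: there is a unique $c\in\mathbb{R}$, and a profile $V$ unique up to translation, with $V\in C^2(\mathbb{R})$ strictly increasing, $V(-\infty)=0$, $V(+\infty)=1$, and $$\frac{\sigma^2}{2}V'' + (c-\tilde\mu)V' + \tilde f(V)=0 .$$ Bounded solution: extend $\tilde f$ off $[0,1]$ to a bounded Lipschitz function on $\mathbb{R}$. For bounded initial data the Cauchy problem then has a unique bounded solution in the Duhamel (mild) sense, given by the Duhamel formula with the heat semigroup of $\frac{\sigma^2}{2}\partial_{yy}^2-\tilde\mu\,\partial_y$; it is classical for $t>0$. For data in $[0,1]$ it stays in $[0,1]$, so it does not depend on the choice of extension. *)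

theory Defs
  imports "HOL-Probability.Probability"
begin

definition C1_on_unit :: "(real \<Rightarrow> real) \<Rightarrow> (real \<Rightarrow> real) \<Rightarrow> bool" where
  "C1_on_unit f f' \<longleftrightarrow>
     (\<forall>x\<in>{0..1}. (f has_real_derivative f' x) (at x within {0..1})) \<and>
     continuous_on {0..1} f'"

definition is_cdf :: "(real \<Rightarrow> real) \<Rightarrow> bool" where
  "is_cdf w0 \<longleftrightarrow>
     mono w0 \<and> (\<forall>a. continuous (at_right a) w0) \<and>
     (w0 \<longlongrightarrow> 0) at_bot \<and> (w0 \<longlongrightarrow> 1) at_top"

definition traveling_wave ::
  "real \<Rightarrow> real \<Rightarrow> (real \<Rightarrow> real) \<Rightarrow> real \<Rightarrow> (real \<Rightarrow> real) \<Rightarrow> bool" where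
  "traveling_wave \<sigma> \<mu> f c V \<longleftrightarrow>
     strict_mono V \<and> (V \<longlongrightarrow> 0) at_bot \<and> (V \<longlongrightarrow> 1) at_top \<and>
     (\<exists>V' V''.
        (\<forall>x. (V has_real_derivative V' x) (at x)) \<and>
        (\<forall>x. (V' has_real_derivative V'' x) (at x)) \<and>
        continuous_on UNIV V'' \<and>
        (\<forall>x. \<sigma>\<^sup>2 / 2 * V'' x + (c - \<mu>) * V' x + f (V x) = 0))"

text \<open>The semigroup generated by \<open>\<sigma>\<^sup>2/2 \<partial>\<^sub>y\<^sub>y - \<mu> \<partial>\<^sub>y\<close>: its value at \<open>y\<close> is the
  expectation of \<open>g\<close> under the normal law with mean \<open>y - \<mu> t\<close> and standard deviation
  \<open>\<sigma> sqrt t\<close>.\<close>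

definition heat_semigroup ::
  "real \<Rightarrow> real \<Rightarrow> real \<Rightarrow> (real \<Rightarrow> real) \<Rightarrow> real \<Rightarrow> real" where
  "heat_semigroup \<sigma> \<mu> t g y =
     (if t = 0 then g y
      else (LBINT z. normal_density (y - \<mu> * t) (\<sigma> * sqrt t) z * g z))"

definition bounded_lipschitz_extension :: "(real \<Rightarrow> real) \<Rightarrow> (real \<Rightarrow> real) \<Rightarrow> bool" where
  "bounded_lipschitz_extension f F \<longleftrightarrow>
     (\<forall>x\<in>{0..1}. F x = f x) \<and> bounded (range F) \<and> (\<exists>L. L-lipschitz_on UNIV F)"

text \<open>Bounded solutions in the Duhamel sense; only the values \<open>w t y\<close> with \<open>t \<ge> 0\<close> matter.
  Joint measurability is required because the Bochner integral of a function that is not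
  integrable is \<open>0\<close> by convention. At \<open>t = 0\<close> the equation reads \<open>w 0 y = w0 y\<close>.\<close>

definition bounded_mild_solution ::
  "real \<Rightarrow> real \<Rightarrow> (real \<Rightarrow> real) \<Rightarrow> (real \<Rightarrow> real) \<Rightarrow> (real \<Rightarrow> real \<Rightarrow> real) \<Rightarrow> bool" where
  "bounded_mild_solution \<sigma> \<mu> F w0 w \<longleftrightarrow>
     (\<lambda>(t, y). w t y) \<in> borel_measurable (restrict_space borel ({0..} \<times> UNIV)) \<and>
     bounded ((\<lambda>(t, y). w t y) ` ({0..} \<times> UNIV)) \<and>
     (\<forall>t\<ge>0. \<forall>y. w t y = heat_semigroup \<sigma> \<mu> t w0 y +
        (LBINT s:{0..t}. heat_semigroup \<sigma> \<mu> (t - s) (\<lambda>z. F (w s z)) y))"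

text \<open>The reaction term is only given on \<open>[0,1]\<close>. For data in \<open>[0,1]\<close> the solution does not
  depend on the extension, so any one of them may be used.\<close>

definition bounded_solution ::
  "real \<Rightarrow> real \<Rightarrow> (real \<Rightarrow> real) \<Rightarrow> (real \<Rightarrow> real) \<Rightarrow> (real \<Rightarrow> real \<Rightarrow> real) \<Rightarrow> bool" where
  "bounded_solution \<sigma> \<mu> f w0 w \<longleftrightarrow>
     (\<exists>F. bounded_lipschitz_extension f F \<and> bounded_mild_solution \<sigma> \<mu> F w0 w)"

end

theory Submission
  imports Defs "HOL-Real_Asymp.Real_Asymp"
begin

text \<open>
  In the frame moving with the wave, the profile \<open>V\<close> is stationary and \<open>V (y + \<xi> t) + e exp (- \<nu> t)\<close>
  is a supersolution for a suitable increasing \<open>\<xi>\<close> whose total increase is proportional to \<open>e\<close>;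
  subsolutions are symmetric. So a solution caught between \<open>V (y + a) - e\<close> and \<open>V (y + b) + e\<close>
  remains caught, with exponentially decreasing \<open>e\<close>, and \<open>a\<close>, \<open>b\<close> move by at most \<open>K e\<close>.
  On a unit interval it is at a distance of order \<open>h = b - a\<close> from one of the two barriers in the
  mean. The comparison principle has the quantitative form \<open>d t \<ge> exp (- L t) S t (d 0)\<close>, which turns this
  into a pointwise gap at time 1 on a large compact set. Hence that barrier may be moved inwards
  by \<open>\<epsilon> h\<close>, at the price of enlarging \<open>e\<close> by \<open>\<theta> \<epsilon> h\<close>, where \<open>\<theta>\<close> bounds the slope of \<open>V\<close> off the compact set.
  Thus one unit of time maps \<open>(h, e)\<close> to \<open>((1 - \<epsilon>) h + 2 K e, exp (- \<nu>) e + \<theta> \<epsilon> h)\<close>, and for small \<open>\<theta>\<close>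
  some combination \<open>h + l e\<close> contracts. This is the squeezing method of X. Chen; it works
  with mild solutions throughout.
\<close>

section \<open>The drift-diffusion semigroup\<close>

text \<open>The initial datum may jump, so no derivative of \<open>w\<close> is controlled up to
  time 0. The barriers are therefore put into Duhamel form once, by differentiating under the
  Gaussian integral, and every comparison concerns the integral equation alone. The comparison bound
  also replaces the strong maximum principle: a gap in the mean is all that a datum without modulus
  of continuity offers, and the Gaussian kernel makes it pointwise. The barriers V + e and V - e
  leave [0,1], so the reaction term has to be continued with negative slope. The continuation used
  is linear and unbounded, but it agrees with every admissible extension on [0,1], where solutions
  stay. The initial shift h may be large: the only smallness required is e \<le> \<delta>, and
  \<epsilon> may depend on an upper bound for h. The order of choice matters: \<theta> is fixed from
  K and \<nu> before \<epsilon>. Since the price \<theta> \<epsilon> h carries the same factor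
  \<epsilon> as the gain \<epsilon> h, making \<epsilon> small does not spoil their ratio.\<close>

abbreviation std_gauss :: "real measure" where
  "std_gauss \<equiv> density lborel (\<lambda>x. ennreal (std_normal_density x))"

text \<open>A finite measure on all Borel sets of the line rather than a set integral, so that
  Fubini and dominated convergence apply to time integrals directly. Integrands must then be
  measurable and bounded for every real time, which is why later ones are truncated by
  \<open>max\<close> and \<open>min\<close>.\<close>

definition time_measure :: "real \<Rightarrow> real measure" where
  "time_measure t = density lborel (\<lambda>s. ennreal (indicator {0..t} s))"

lemma prob_space_std_gauss: "prob_space std_gauss"
  by (rule prob_space_normal_density) simp

lemma finite_std_gauss: "finite_measure std_gauss"
  using prob_space_std_gauss by (simp add: prob_space.finite_measure)

lemma sets_time_measure [simp, measurable_cong]: "sets (time_measure t) = sets borel"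
  and space_time_measure [simp]: "space (time_measure t) = UNIV"
  by (simp_all add: time_measure_def)

lemma finite_time_measure: "finite_measure (time_measure t)"
proof
  have "emeasure (time_measure t) (space (time_measure t)) = emeasure lborel {0..t}"
    unfolding time_measure_def
    by (subst emeasure_density) (auto simp: ennreal_indicator)
  also have "\<dots> \<noteq> \<infinity>" by (simp add: emeasure_lborel_Icc_eq)
  finally show "emeasure (time_measure t) (space (time_measure t)) \<noteq> \<infinity>" .
qed

lemma AE_time_measure: "AE s in time_measure t. 0 \<le> s \<and> s \<le> t"
  unfolding time_measure_def by (subst AE_density) (auto simp: indicator_def)

lemma integral_time_measure:
  fixes k :: "real \<Rightarrow> real"
  assumes [measurable]: "k \<in> borel_measurable borel"
  shows "(\<integral>s. k s \<partial>time_measure t) = (LBINT s:{0..t}. k s)"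
  unfolding time_measure_def set_lebesgue_integral_def
  by (subst integral_density) auto

lemma integrable_time_measure_iff:
  fixes k :: "real \<Rightarrow> real"
  assumes [measurable]: "k \<in> borel_measurable borel"
  shows "integrable (time_measure t) k \<longleftrightarrow> set_integrable lborel {0..t} k"
  unfolding time_measure_def set_integrable_def
  by (subst integrable_density) auto

lemma integral_time_measure_cong:
  fixes k l :: "real \<Rightarrow> real"
  assumes [measurable]: "k \<in> borel_measurable borel" "l \<in> borel_measurable borel"
    and "\<And>s. 0 \<le> s \<Longrightarrow> s \<le> t \<Longrightarrow> k s = l s"
  shows "(\<integral>s. k s \<partial>time_measure t) = (\<integral>s. l s \<partial>time_measure t)"
  using AE_time_measure[of t] assms(3) by (intro integral_cong_AE) auto

lemma integral_time_measure_mono: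
  fixes k l :: "real \<Rightarrow> real"
  assumes "integrable (time_measure t) k" "integrable (time_measure t) l"
    and "\<And>s. 0 \<le> s \<Longrightarrow> s \<le> t \<Longrightarrow> k s \<le> l s"
  shows "(\<integral>s. k s \<partial>time_measure t) \<le> (\<integral>s. l s \<partial>time_measure t)"
  using AE_time_measure[of t] assms(3) by (intro integral_mono_AE assms(1,2)) auto

lemma integral_time_measure_FTC:
  fixes k K :: "real \<Rightarrow> real"
  assumes "0 \<le> t" and k: "continuous_on UNIV k"
    and K: "\<And>s. (K has_real_derivative k s) (at s)"
  shows "(\<integral>s. k s \<partial>time_measure t) = K t - K 0"
proof -
  have [measurable]: "k \<in> borel_measurable borel"
    using k by (rule borel_measurable_continuous_onI)
  have "(LBINT s:{0..t}. k s) = (\<integral>s. k s * indicator {0..t} s \<partial>lborel)"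
    by (simp add: set_lebesgue_integral_def mult.commute)
  also have "\<dots> = K t - K 0"
    by (rule integral_FTC_Icc_real[OF \<open>0 \<le> t\<close>]) (use K k in \<open>auto simp: continuous_on_eq_continuous_at\<close>)
  finally show ?thesis by (simp add: integral_time_measure)
qed

section \<open>Interchange of integrals and the classes of bounded Borel functions\<close>

lemma Fubini_dominated:
  fixes f :: "'a \<Rightarrow> 'b \<Rightarrow> real"
  assumes M: "finite_measure M" and N: "finite_measure N"
    and f [measurable]: "case_prod f \<in> borel_measurable (M \<Otimes>\<^sub>M N)"
    and le: "\<And>x y. \<bar>f x y\<bar> \<le> g y" and g: "integrable N g"
  shows "(\<integral>y. (\<integral>x. f x y \<partial>M) \<partial>N) = (\<integral>x. (\<integral>y. f x y \<partial>N) \<partial>M)"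
proof -
  interpret M: finite_measure M by fact
  interpret N: finite_measure N by fact
  interpret P: pair_sigma_finite M N ..
  have int: "integrable N (\<lambda>y. f x y)" if "x \<in> space M" for x
    by (rule Bochner_Integration.integrable_bound[OF g])
       (use that le in \<open>auto intro!: AE_I2 order_trans[OF le]\<close>)
  have bd: "(\<integral>y. norm (f x y) \<partial>N) \<le> (\<integral>y. g y \<partial>N)" if "x \<in> space M" for x
    by (intro integral_mono integrable_norm int that g) (use le in auto)
  have "integrable (M \<Otimes>\<^sub>M N) (case_prod f)"
  proof (rule P.Fubini_integrable)
    show "integrable M (\<lambda>x. \<integral>y. norm (case_prod f (x, y)) \<partial>N)"
    proof (rule M.integrable_const_bound[where B="\<integral>y. g y \<partial>N"])
      show "AE x in M. norm (\<integral>y. norm (case_prod f (x, y)) \<partial>N) \<le> (\<integral>y. g y \<partial>N)"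
        using bd by (intro AE_I2) simp
    qed measurable
    show "AE x in M. integrable N (\<lambda>y. case_prod f (x, y))"
      using int by (intro AE_I2) simp
  qed measurable
  then show ?thesis by (rule P.Fubini_integral)
qed

text \<open>The case of a constant dominating function. The more general form is reserved for an
  integrand that grows linearly in the Gaussian variable, which occurs when a profile is
  differentiated along the semigroup.\<close>

lemma Fubini_bounded:
  fixes f :: "'a \<Rightarrow> 'b \<Rightarrow> real"
  assumes "finite_measure M" "finite_measure N" "case_prod f \<in> borel_measurable (M \<Otimes>\<^sub>M N)"
    and "\<And>x y. \<bar>f x y\<bar> \<le> B"
  shows "(\<integral>y. (\<integral>x. f x y \<partial>M) \<partial>N) = (\<integral>x. (\<integral>y. f x y \<partial>N) \<partial>M)"
  using assms by (rule Fubini_dominated) (rule finite_measure.integrable_const[OF assms(2)])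

lemma abs_integral_prob_le:
  fixes g :: "'a \<Rightarrow> real"
  assumes "prob_space M" "g \<in> borel_measurable M" "\<And>x. \<bar>g x\<bar> \<le> B"
  shows "\<bar>\<integral>x. g x \<partial>M\<bar> \<le> B"
proof -
  interpret prob_space M by fact
  have "\<bar>\<integral>x. g x \<partial>M\<bar> \<le> (\<integral>x. \<bar>g x\<bar> \<partial>M)" by (rule integral_abs_bound)
  also have "\<dots> \<le> (\<integral>x. B \<partial>M)"
    by (intro integral_mono integrable_abs integrable_const integrable_const_bound[where B=B]) (use assms in auto)
  finally show ?thesis by (simp add: prob_space)
qed

definition bounded_borel :: "(real \<Rightarrow> real) \<Rightarrow> bool" where
  "bounded_borel g \<longleftrightarrow> g \<in> borel_measurable borel \<and> (\<exists>B. \<forall>x. \<bar>g x\<bar> \<le> B)"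

text \<open>Time runs over the whole line, so joint measurability refers to a plain product space.
  Functions that are meaningful only for t \<ge> 0 are brought into this class by evaluating them at
  \<open>max 0 t\<close>.\<close>

definition bounded_borel2 :: "(real \<Rightarrow> real \<Rightarrow> real) \<Rightarrow> bool" where
  "bounded_borel2 u \<longleftrightarrow>
     case_prod u \<in> borel_measurable (borel \<Otimes>\<^sub>M borel) \<and> (\<exists>B. \<forall>t y. \<bar>u t y\<bar> \<le> B)"

lemma bounded_borelI:
  "g \<in> borel_measurable borel \<Longrightarrow> (\<And>x. \<bar>g x\<bar> \<le> B) \<Longrightarrow> bounded_borel g"
  by (auto simp: bounded_borel_def)

lemma bounded_borelD [measurable_dest]: "bounded_borel g \<Longrightarrow> g \<in> borel_measurable borel"
  by (simp add: bounded_borel_def)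

lemma bounded_borel2D [measurable_dest]:
  "bounded_borel2 u \<Longrightarrow> case_prod u \<in> borel_measurable (borel \<Otimes>\<^sub>M borel)"
  by (simp add: bounded_borel2_def)

lemma bounded_borel_slice:
  assumes u: "bounded_borel2 u"
  shows "bounded_borel (u t)"
proof -
  have [measurable]: "case_prod u \<in> borel_measurable (borel \<Otimes>\<^sub>M borel)"
    using u by (rule bounded_borel2D)
  have "(\<lambda>y. u t y) \<in> borel_measurable borel" by measurable
  with u show ?thesis by (auto simp: bounded_borel_def bounded_borel2_def)
qed

locale drift_heat =
  fixes \<sigma> \<mu> :: real
  assumes sigma_pos: "\<sigma> > 0"
begin

text \<open>The reference measure is a fixed standard Gaussian and \<open>t\<close>,
  \<open>y\<close> enter only through the argument of \<open>g\<close>. So t = 0 is no exception,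
  and joint measurability and time derivatives are inherited from \<open>g\<close>. As
  \<open>sqrt\<close> is total, the bounds hold for negative \<open>t\<close> too, and kernels in t
  - s need no restriction to s \<le> t.\<close>

definition S :: "real \<Rightarrow> (real \<Rightarrow> real) \<Rightarrow> real \<Rightarrow> real" where
  "S t g y = (\<integral>x. g (y - \<mu> * t + \<sigma> * sqrt t * x) \<partial>std_gauss)"

lemma S_0 [simp]: "S 0 g y = g y"
  using prob_space.prob_space[OF prob_space_std_gauss] by (simp add: S_def)

lemma S_const [simp]: "S t (\<lambda>x. k) y = k"
  using prob_space.prob_space[OF prob_space_std_gauss] by (simp add: S_def)

lemma S_eq_heat_semigroup:
  assumes [measurable]: "g \<in> borel_measurable borel" and "t \<ge> 0"
  shows "heat_semigroup \<sigma> \<mu> t g y = S t g y"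
proof (cases "t = 0")
  case False
  with \<open>t \<ge> 0\<close> have t: "t > 0" by simp
  define a where "a = \<sigma> * sqrt t"
  have a: "a > 0" using t sigma_pos by (simp add: a_def)
  have "heat_semigroup \<sigma> \<mu> t g y = (\<integral>z. normal_density (y - \<mu> * t) a z * g z \<partial>lborel)"
    using False by (simp add: heat_semigroup_def a_def)
  also have "\<dots> = \<bar>a\<bar> *\<^sub>R (\<integral>x. normal_density (y - \<mu> * t) a (y - \<mu> * t + a * x) * g (y - \<mu> * t + a * x) \<partial>lborel)"
    by (rule lborel_integral_real_affine) (use a in simp)
  also have "\<dots> = (\<integral>x. a * (normal_density (y - \<mu> * t) a (y - \<mu> * t + a * x) * g (y - \<mu> * t + a * x)) \<partial>lborel)"
    using a by simp
  also have "\<dots> = (\<integral>x. std_normal_density x * g (y - \<mu> * t + a * x) \<partial>lborel)"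
  proof (intro Bochner_Integration.integral_cong refl)
    fix x
    have "a * normal_density (y - \<mu> * t) a (y - \<mu> * t + a * x) = std_normal_density x"
      using a by (simp add: normal_density_def real_sqrt_mult power_mult_distrib)
    then show "a * (normal_density (y - \<mu> * t) a (y - \<mu> * t + a * x) * g (y - \<mu> * t + a * x)) =
      std_normal_density x * g (y - \<mu> * t + a * x)"
      by (metis mult.assoc)
  qed
  also have "\<dots> = S t g y"
    unfolding S_def by (subst integral_density) (auto simp: a_def)
  finally show ?thesis .
qed (simp add: heat_semigroup_def)

lemma integrable_S:
  assumes "bounded_borel g"
  shows "integrable std_gauss (\<lambda>x. g (a + b * x))"
proof -
  interpret finite_measure std_gauss by (rule finite_std_gauss)
  from assms obtain B where "\<And>x. \<bar>g x\<bar> \<le> B" by (auto simp: bounded_borel_def)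
  moreover have [measurable]: "g \<in> borel_measurable borel" using assms by (rule bounded_borelD)
  ultimately show ?thesis by (intro integrable_const_bound[where B=B]) auto
qed

lemma S_mono:
  assumes "bounded_borel g" "bounded_borel h" "\<And>x. g x \<le> h x"
  shows "S t g y \<le> S t h y"
  unfolding S_def by (intro integral_mono integrable_S assms)

lemma S_nonneg: "(\<And>x. 0 \<le> g x) \<Longrightarrow> 0 \<le> S t g y"
  unfolding S_def by (rule Bochner_Integration.integral_nonneg) simp

lemma S_abs_le:
  assumes "bounded_borel g" "\<And>x. \<bar>g x\<bar> \<le> B"
  shows "\<bar>S t g y\<bar> \<le> B"
  unfolding S_def
  using integrable_S[OF assms(1)]
  by (intro abs_integral_prob_le[OF prob_space_std_gauss] borel_measurable_integrable assms(2))

lemma S_add: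
  assumes "bounded_borel g" "bounded_borel h"
  shows "S t (\<lambda>x. g x + h x) y = S t g y + S t h y"
  unfolding S_def by (intro Bochner_Integration.integral_add integrable_S assms)

lemma S_diff:
  assumes "bounded_borel g" "bounded_borel h"
  shows "S t (\<lambda>x. g x - h x) y = S t g y - S t h y"
  unfolding S_def by (intro Bochner_Integration.integral_diff integrable_S assms)

lemma S_cmult: "S t (\<lambda>x. k * g x) y = k * S t g y"
  unfolding S_def by simp

text \<open>Semigroup time, function and base point may vary at once, as they do in the Duhamel
  kernel, where both t - s and the slice \<open>h s\<close> depend on s.\<close>

lemma S_measurable2:
  assumes [measurable]: "case_prod h \<in> borel_measurable (borel \<Otimes>\<^sub>M borel)"
    and [measurable]: "f \<in> borel_measurable M" "a \<in> borel_measurable M" "b \<in> borel_measurable M"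
  shows "(\<lambda>p. S (f p) (h (a p)) (b p)) \<in> borel_measurable M"
proof -
  interpret prob_space std_gauss by (rule prob_space_std_gauss)
  show ?thesis unfolding S_def by measurable
qed

lemma S_measurable:
  assumes [measurable]: "g \<in> borel_measurable borel"
    and [measurable]: "f \<in> borel_measurable M" "b \<in> borel_measurable M"
  shows "(\<lambda>p. S (f p) g (b p)) \<in> borel_measurable M"
  by (rule S_measurable2[where h="\<lambda>_. g" and a="\<lambda>_. 0"]) measurable

lemma bounded_borel_S:
  assumes g: "bounded_borel g"
  shows "bounded_borel (S t g)"
proof -
  from g obtain B where B: "\<And>x. \<bar>g x\<bar> \<le> B" by (auto simp: bounded_borel_def)
  have "\<bar>S t g y\<bar> \<le> B" for y by (rule S_abs_le[OF g B])
  moreover have "S t g \<in> borel_measurable borel"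
    by (rule S_measurable[OF bounded_borelD[OF g], of "\<lambda>_. t" borel "\<lambda>y. y"]) simp_all
  ultimately show ?thesis by (auto simp: bounded_borel_def)
qed

text \<open>Variances of independent centred normal variables add. The double integral is an
  integral against the convolution of two normal laws, whose density is known; \<open>D_int\<close>
  translates between the law of deviation \<open>r\<close> and the standard one by scaling.\<close>

lemma gauss_integral_add:
  assumes g: "bounded_borel g" and a: "a > 0" and b: "b > 0"
  shows "(\<integral>x. \<integral>x'. g (m + a * x + b * x') \<partial>std_gauss \<partial>std_gauss) =
         (\<integral>x. g (m + sqrt (a\<^sup>2 + b\<^sup>2) * x) \<partial>std_gauss)"
proof -
  note [measurable] = bounded_borelD[OF g]
  from g obtain B where B: "\<And>x. \<bar>g x\<bar> \<le> B" by (auto simp: bounded_borel_def)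
  define D where "D r = density lborel (\<lambda>x. ennreal (normal_density 0 r x))" for r
  have sets_D [measurable_cong]: "sets (D r) = sets borel" for r by (simp add: D_def)
  have D_prob: "prob_space (D r)" if "r > 0" for r
    unfolding D_def using that by (rule prob_space_normal_density)
  have D_int: "(\<integral>x. k x \<partial>D r) = (\<integral>x. k (r * x) \<partial>std_gauss)"
    if r: "r > 0" and [measurable]: "k \<in> borel_measurable borel" for r and k :: "real \<Rightarrow> real"
  proof -
    have "(\<integral>x. k x \<partial>D r) = (\<integral>z. normal_density 0 r z * k z \<partial>lborel)"
      unfolding D_def by (subst integral_density) auto
    also have "\<dots> = \<bar>r\<bar> *\<^sub>R (\<integral>x. normal_density 0 r (0 + r * x) * k (0 + r * x) \<partial>lborel)"
      by (rule lborel_integral_real_affine) (use r in simp)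
    also have "\<dots> = (\<integral>x. r * (normal_density 0 r (r * x) * k (r * x)) \<partial>lborel)"
      using r by simp
    also have "\<dots> = (\<integral>x. std_normal_density x * k (r * x) \<partial>lborel)"
    proof (intro Bochner_Integration.integral_cong refl)
      fix x
      have "r * normal_density 0 r (r * x) = std_normal_density x"
        using r by (simp add: normal_density_def real_sqrt_mult power_mult_distrib)
      then show "r * (normal_density 0 r (r * x) * k (r * x)) = std_normal_density x * k (r * x)"
        by (metis mult.assoc)
    qed
    also have "\<dots> = (\<integral>x. k (r * x) \<partial>std_gauss)"
      by (subst integral_density) auto
    finally show ?thesis .
  qed
  interpret A: prob_space "D a" using a by (rule D_prob)
  interpret B: prob_space "D b" using b by (rule D_prob)
  interpret P: pair_sigma_finite "D a" "D b" ..
  interpret Q: finite_measure "D a \<Otimes>\<^sub>M D b"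
    by (rule finite_measure_pair_measure[OF B.finite_measure_axioms A.finite_measure_axioms])
  have conv: "convolution (D a) (D b) = D (sqrt (a\<^sup>2 + b\<^sup>2))"
    using A.finite_measure_axioms B.finite_measure_axioms conv_normal_density_zero_mean[OF a b]
    unfolding D_def
    by (subst convolution_density) (simp_all add: ennreal_mult'[symmetric])
  have "(\<integral>x. \<integral>x'. g (m + a * x + b * x') \<partial>std_gauss \<partial>std_gauss) =
        (\<integral>x. \<integral>x'. g (m + a * x + x') \<partial>D b \<partial>std_gauss)"
    by (subst D_int[OF b]) simp_all
  also have "\<dots> = (\<integral>x. \<integral>x'. g (m + x + x') \<partial>D b \<partial>D a)"
    by (subst D_int[OF a]) simp_all
  also have "\<dots> = (\<integral>p. g (m + fst p + snd p) \<partial>(D a \<Otimes>\<^sub>M D b))"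
  proof -
    have "integrable (D a \<Otimes>\<^sub>M D b) (\<lambda>p. g (m + fst p + snd p))"
    proof (rule Q.integrable_const_bound[where B=B])
      show "(\<lambda>p. g (m + fst p + snd p)) \<in> borel_measurable (D a \<Otimes>\<^sub>M D b)" by measurable
    qed (use B in \<open>auto simp del: fst_add snd_add\<close>)
    from P.integral_fst'[OF this] show ?thesis by (simp only: fst_conv snd_conv)
  qed
  also have "\<dots> = (\<integral>x. g (m + x) \<partial>convolution (D a) (D b))"
    unfolding convolution_def
    by (subst integral_distr) (simp_all add: case_prod_beta add.assoc)
  also have "\<dots> = (\<integral>x. g (m + sqrt (a\<^sup>2 + b\<^sup>2) * x) \<partial>std_gauss)"
    unfolding conv by (rule D_int) (use a b in \<open>auto simp: add_pos_pos\<close>)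
  finally show ?thesis .
qed

lemma S_S:
  assumes g: "bounded_borel g" and "t \<ge> 0" "s \<ge> 0"
  shows "S t (S s g) y = S (t + s) g y"
\<comment> \<open>The convolution formula needs nondegenerate normal laws, so zero times are treated
  apart.\<close>
proof (cases "t = 0 \<or> s = 0")
  case True
  moreover have "S 0 g = g" by (rule ext) simp
  ultimately show ?thesis by auto
next
  case False
  with assms have ts: "t > 0" "s > 0" by auto
  have "(\<sigma> * sqrt t)\<^sup>2 + (\<sigma> * sqrt s)\<^sup>2 = \<sigma>\<^sup>2 * (t + s)"
    using ts by (simp add: power_mult_distrib algebra_simps)
  then have r: "sqrt ((\<sigma> * sqrt t)\<^sup>2 + (\<sigma> * sqrt s)\<^sup>2) = \<sigma> * sqrt (t + s)"
    using sigma_pos by (simp add: real_sqrt_mult)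
  have "S t (S s g) y =
    (\<integral>x. \<integral>x'. g ((y - \<mu> * (t + s)) + \<sigma> * sqrt t * x + \<sigma> * sqrt s * x') \<partial>std_gauss \<partial>std_gauss)"
    unfolding S_def by (simp add: algebra_simps)
  also have "\<dots> = S (t + s) g y"
    by (subst gauss_integral_add[OF g]) (use ts sigma_pos r in \<open>auto simp: S_def\<close>)
  finally show ?thesis .
qed

end

section \<open>Duhamel formula and comparison\<close>

lemma integral_time_measure_split:
  fixes k :: "real \<Rightarrow> real"
  assumes k: "bounded_borel k" and "0 \<le> a" "0 \<le> b"
  shows "(\<integral>s. k s \<partial>time_measure (a + b)) =
         (\<integral>s. k s \<partial>time_measure a) + (\<integral>s. k (a + s) \<partial>time_measure b)"
proof -
  have [measurable]: "k \<in> borel_measurable borel" using k by (rule bounded_borelD)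
  from k obtain B where B: "\<And>x. \<bar>k x\<bar> \<le> B" by (auto simp: bounded_borel_def)
  have int: "set_integrable lborel {0..t} (\<lambda>s. k (c + s))" for t c
  proof -
    interpret finite_measure "time_measure t" by (rule finite_time_measure)
    have "integrable (time_measure t) (\<lambda>s. k (c + s))"
      by (rule integrable_const_bound[where B=B]) (use B in auto)
    then show ?thesis by (subst (asm) integrable_time_measure_iff) auto
  qed
  have int': "integrable lborel (\<lambda>s. indicator {0..b} (s - a) * k s)"
  proof -
    have "integrable lborel (\<lambda>s. indicator {0..b} s * k (a + s))"
      using int[of b a] by (simp add: set_integrable_def)
    from lborel_integrable_real_affine[OF this, of 1 "-a"] show ?thesis
      by simp
  qed
  have "(LBINT s:{0..a+b}. k s) =
        (\<integral>s. indicator {0..a} s * k s + indicator {0..b} (s - a) * k s \<partial>lborel)"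
    unfolding set_lebesgue_integral_def
  proof (rule integral_cong_AE)
    \<comment> \<open>Both indicators equal 1 at the common endpoint, so the identity holds only off
      this null set.\<close>
    have "AE s in lborel. s \<noteq> a" by (rule AE_lborel_singleton)
    then show "AE s in lborel. indicat_real {0..a + b} s *\<^sub>R k s =
        indicat_real {0..a} s * k s + indicat_real {0..b} (s - a) * k s"
      by eventually_elim (use assms(2,3) in \<open>auto simp: indicator_def\<close>)
  qed measurable
  also have "\<dots> = (\<integral>s. indicator {0..a} s * k s \<partial>lborel) + (\<integral>s. indicator {0..b} (s - a) * k s \<partial>lborel)"
    using int[of a 0] int' by (intro Bochner_Integration.integral_add) (auto simp: set_integrable_def)
  also have "(\<integral>s. indicator {0..b} (s - a) * k s \<partial>lborel) =
        (\<integral>s. indicator {0..b} s * k (a + s) \<partial>lborel)"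
    using lborel_integral_real_affine[of 1 "\<lambda>s. indicator {0..b} (s - a) * k s" a] by simp
  finally show ?thesis
    by (simp add: integral_time_measure set_lebesgue_integral_def)
qed

text \<open>This is the integral of l exp (l s) over [r,t], in the form needed for a Fubini
  argument: for nonnegative \<open>l\<close> the truncation \<open>min s t\<close> makes the factor
  bounded on the line, and the condition r \<le> s is an indicator of s - r, hence jointly
  measurable.\<close>

lemma integral_time_measure_exp:
  assumes "0 \<le> r" "r \<le> t"
  shows "(\<integral>s. indicator {0..} (s - r) * (l * exp (l * min s t)) \<partial>time_measure t) = exp (l * t) - exp (l * r)"
proof -
  have "(\<integral>s. indicator {0..} (s - r) * (l * exp (l * min s t)) \<partial>time_measure t) =
        (LBINT s:{0..t}. indicator {0..} (s - r) * (l * exp (l * min s t)))"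
    by (rule integral_time_measure) measurable
  also have "\<dots> = (\<integral>s. (l * exp (l * s)) * indicator {r..t} s \<partial>lborel)"
    unfolding set_lebesgue_integral_def using assms
    by (intro Bochner_Integration.integral_cong) (auto simp: indicator_def)
  also have "\<dots> = exp (l * t) - exp (l * r)"
    by (rule integral_FTC_Icc_real[OF \<open>r \<le> t\<close>]) (auto intro!: derivative_eq_intros continuous_intros)
  finally show ?thesis .
qed

text \<open>Moves a variable upper limit into the integrand, so that an integral over the triangle r
  \<le> s \<le> t becomes one over a product of two equal measures.\<close>

lemma integral_time_measure_restrict:
  fixes k :: "real \<Rightarrow> real"
  assumes [measurable]: "k \<in> borel_measurable borel" and "s \<le> t"
  shows "(\<integral>r. k r \<partial>time_measure s) = (\<integral>r. indicator {0..} (s - r) * k r \<partial>time_measure t)"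
proof -
  have "(\<integral>r. indicator {0..} (s - r) * k r \<partial>time_measure t) = (\<integral>r. indicator {..s} r * k r \<partial>time_measure t)"
    by (intro Bochner_Integration.integral_cong) (auto simp: indicator_def)
  also have "\<dots> = (\<integral>r. k r \<partial>time_measure s)"
    using \<open>s \<le> t\<close>
    by (subst (1 2) integral_time_measure) 
       (auto simp: set_lebesgue_integral_def indicator_def intro!: Bochner_Integration.integral_cong)
  finally show ?thesis ..
qed

lemma bounded_borel2_add:
  assumes u: "bounded_borel2 u" and v: "bounded_borel2 v"
  shows "bounded_borel2 (\<lambda>t y. u t y + v t y)"
proof -
  note [measurable] = bounded_borel2D[OF u] bounded_borel2D[OF v]
  from u obtain B where B: "\<And>t y. \<bar>u t y\<bar> \<le> B" by (auto simp: bounded_borel2_def)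
  from v obtain C where C: "\<And>t y. \<bar>v t y\<bar> \<le> C" by (auto simp: bounded_borel2_def)
  have "\<bar>u t y + v t y\<bar> \<le> B + C" for t y using B[of t y] C[of t y] by linarith
  moreover have "case_prod (\<lambda>t y. u t y + v t y) \<in> borel_measurable (borel \<Otimes>\<^sub>M borel)" by measurable
  ultimately show ?thesis unfolding bounded_borel2_def by blast
qed

lemma bounded_borel2_cmult:
  assumes u: "bounded_borel2 u"
  shows "bounded_borel2 (\<lambda>t y. k * u t y)"
proof -
  note [measurable] = bounded_borel2D[OF u]
  from u obtain B where B: "\<And>t y. \<bar>u t y\<bar> \<le> B" by (auto simp: bounded_borel2_def)
  have "\<bar>k * u t y\<bar> \<le> \<bar>k\<bar> * B" for t y using B[of t y] by (simp add: abs_mult mult_left_mono)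
  moreover have "case_prod (\<lambda>t y. k * u t y) \<in> borel_measurable (borel \<Otimes>\<^sub>M borel)" by measurable
  ultimately show ?thesis unfolding bounded_borel2_def by blast
qed

lemma bounded_borel2_diff:
  assumes u: "bounded_borel2 u" and v: "bounded_borel2 v"
  shows "bounded_borel2 (\<lambda>t y. u t y - v t y)"
  using bounded_borel2_add[OF u bounded_borel2_cmult[OF v, of "-1"]] by simp

lemma bounded_borel2_shift:
  assumes u: "bounded_borel2 u"
  shows "bounded_borel2 (\<lambda>t. u (c + t))"
proof -
  note [measurable] = bounded_borel2D[OF u]
  from u obtain B where B: "\<And>t y. \<bar>u t y\<bar> \<le> B" by (auto simp: bounded_borel2_def)
  have "case_prod (\<lambda>t. u (c + t)) \<in> borel_measurable (borel \<Otimes>\<^sub>M borel)" by measurable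
  with B show ?thesis unfolding bounded_borel2_def by blast
qed

lemma integrable_time_bounded:
  assumes k: "bounded_borel k"
  shows "integrable (time_measure t) k"
proof -
  interpret finite_measure "time_measure t" by (rule finite_time_measure)
  from k obtain B where B: "\<And>x. \<bar>k x\<bar> \<le> B" by (auto simp: bounded_borel_def)
  show ?thesis
    by (rule integrable_const_bound[where B=B]) (use B bounded_borelD[OF k] in auto)
qed

context drift_heat
begin

lemma bounded_borel_kernel:
  assumes h: "bounded_borel2 h"
  shows "bounded_borel (\<lambda>s. S (a - s) (h s) y)"
proof -
  from h obtain B where B: "\<And>t y. \<bar>h t y\<bar> \<le> B" by (auto simp: bounded_borel2_def)
  have "\<bar>S (a - s) (h s) y\<bar> \<le> B" for s
    by (rule S_abs_le[OF bounded_borel_slice[OF h] B])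
  moreover have "(\<lambda>s. S (a - s) (h s) y) \<in> borel_measurable borel"
    by (rule S_measurable2[OF bounded_borel2D[OF h]]) measurable
  ultimately show ?thesis by (auto simp: bounded_borel_def)
qed

lemmas integrable_kernel = integrable_time_bounded[OF bounded_borel_kernel]

definition duhamel_term :: "(real \<Rightarrow> real \<Rightarrow> real) \<Rightarrow> real \<Rightarrow> real \<Rightarrow> real" where
  "duhamel_term h t y = (\<integral>s. S (t - s) (h s) y \<partial>time_measure t)"

lemma duhamel_term_0:
  assumes h: "bounded_borel2 h"
  shows "duhamel_term h 0 y = 0"
  unfolding duhamel_term_def
  using integral_time_measure_split[OF bounded_borel_kernel[OF h, of 0 y], of 0 0] by simp

lemma bounded_borel_duhamel_term:
  assumes h: "bounded_borel2 h"
  shows "bounded_borel (duhamel_term h t)"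
proof -
  interpret finite_measure "time_measure t" by (rule finite_time_measure)
  from h obtain B where B: "\<And>t y. \<bar>h t y\<bar> \<le> B" by (auto simp: bounded_borel2_def)
  have bd: "\<bar>S (t - s) (h s) y\<bar> \<le> B" for s y
    by (rule S_abs_le[OF bounded_borel_slice[OF h] B])
  have "\<bar>duhamel_term h t y\<bar> \<le> (\<integral>s. B \<partial>time_measure t)" for y
  proof -
    have "\<bar>duhamel_term h t y\<bar> \<le> (\<integral>s. \<bar>S (t - s) (h s) y\<bar> \<partial>time_measure t)"
      unfolding duhamel_term_def by (rule integral_abs_bound)
    also have "\<dots> \<le> (\<integral>s. B \<partial>time_measure t)"
      by (intro integral_mono integrable_abs integrable_kernel[OF h] integrable_const bd)
    finally show ?thesis .
  qed
  moreover have "duhamel_term h t \<in> borel_measurable borel"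
  proof -
    have "case_prod (\<lambda>y s. S (t - s) (h s) y) \<in> borel_measurable (borel \<Otimes>\<^sub>M borel)"
      unfolding case_prod_beta by (rule S_measurable2[OF bounded_borel2D[OF h]]) measurable
    then have [measurable]: "case_prod (\<lambda>y s. S (t - s) (h s) y) \<in> borel_measurable (borel \<Otimes>\<^sub>M time_measure t)"
      by simp
    have "(\<lambda>y. \<integral>s. S (t - s) (h s) y \<partial>time_measure t) \<in> borel_measurable borel"
      by measurable
    then show ?thesis unfolding duhamel_term_def[abs_def] .
  qed
  ultimately show ?thesis unfolding bounded_borel_def by blast
qed

text \<open>Fubini followed by the semigroup law. The right-hand side is the part of the Duhamel
  term at time s + t that comes from sources before time \<open>t\<close>.\<close>

lemma S_duhamel_term:
  assumes h: "bounded_borel2 h" and "0 \<le> s" "0 \<le> t"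
  shows "S s (duhamel_term h t) y = (\<integral>r. S (s + t - r) (h r) y \<partial>time_measure t)"
proof -
  from h obtain B where B: "\<And>t y. \<bar>h t y\<bar> \<le> B" by (auto simp: bounded_borel2_def)
  have bd: "\<bar>S (t - r) (h r) y\<bar> \<le> B" for r y
    by (rule S_abs_le[OF bounded_borel_slice[OF h] B])
  have m: "case_prod (\<lambda>r x. S (t - r) (h r) (y - \<mu> * s + \<sigma> * sqrt s * x)) \<in> borel_measurable (borel \<Otimes>\<^sub>M borel)"
    unfolding case_prod_beta by (rule S_measurable2[OF bounded_borel2D[OF h]]) measurable
  have m': "case_prod (\<lambda>r x. S (t - r) (h r) (y - \<mu> * s + \<sigma> * sqrt s * x)) \<in> borel_measurable (time_measure t \<Otimes>\<^sub>M std_gauss)"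
    using m by (simp cong: measurable_cong_sets)
  have "S s (duhamel_term h t) y =
    (\<integral>x. \<integral>r. S (t - r) (h r) (y - \<mu> * s + \<sigma> * sqrt s * x) \<partial>time_measure t \<partial>std_gauss)"
    unfolding S_def[of s] duhamel_term_def ..
  also have "\<dots> = (\<integral>r. \<integral>x. S (t - r) (h r) (y - \<mu> * s + \<sigma> * sqrt s * x) \<partial>std_gauss \<partial>time_measure t)"
    by (rule Fubini_bounded[OF finite_time_measure finite_std_gauss m' bd])
  also have "\<dots> = (\<integral>r. S s (S (t - r) (h r)) y \<partial>time_measure t)"
    unfolding S_def[of s] ..
  also have "\<dots> = (\<integral>r. S (s + t - r) (h r) y \<partial>time_measure t)"
  proof (rule integral_time_measure_cong)
    fix r assume r: "0 \<le> r" "r \<le> t"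
    have "S s (S (t - r) (h r)) y = S (s + (t - r)) (h r) y"
      by (rule S_S[OF bounded_borel_slice[OF h]]) (use r \<open>0 \<le> s\<close> in auto)
    then show "S s (S (t - r) (h r)) y = S (s + t - r) (h r) y" by (simp add: algebra_simps)
  next
    show "(\<lambda>r. S (s + t - r) (h r) y) \<in> borel_measurable borel"
      by (rule S_measurable2[OF bounded_borel2D[OF h]]) measurable
    have "prob_space std_gauss" by (rule prob_space_std_gauss)
    then interpret prob_space std_gauss .
    note [measurable] = m
    show "(\<lambda>r. S s (S (t - r) (h r)) y) \<in> borel_measurable borel"
      unfolding S_def[of s] by measurable
  qed
  finally show ?thesis .
qed

text \<open>The source \<open>h\<close> is independent of \<open>u\<close>, which makes the relation
  linear in the pair. Solutions, barriers and their differences thus fall under one comparison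
  result.\<close>

definition duhamel :: "(real \<Rightarrow> real \<Rightarrow> real) \<Rightarrow> (real \<Rightarrow> real \<Rightarrow> real) \<Rightarrow> bool" where
  "duhamel u h \<longleftrightarrow> bounded_borel2 u \<and> bounded_borel2 h \<and>
     (\<forall>t\<ge>0. \<forall>y. u t y = S t (u 0) y + duhamel_term h t y)"

lemma duhamelD:
  assumes "duhamel u h"
  shows "bounded_borel2 u" "bounded_borel2 h"
    "0 \<le> t \<Longrightarrow> u t y = S t (u 0) y + duhamel_term h t y"
  using assms by (auto simp: duhamel_def)

lemma duhamel_const: "duhamel (\<lambda>t y. k) (\<lambda>t y. 0)"
  by (auto simp: duhamel_def bounded_borel2_def duhamel_term_def)

lemma duhamel_diff:
  assumes u: "duhamel u h" and v: "duhamel v k"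
  shows "duhamel (\<lambda>t y. u t y - v t y) (\<lambda>t y. h t y - k t y)"
  unfolding duhamel_def
proof (intro conjI allI impI)
  note bu = duhamelD(1)[OF u] and bv = duhamelD(1)[OF v]
  note bh = duhamelD(2)[OF u] and bk = duhamelD(2)[OF v]
  show "bounded_borel2 (\<lambda>t y. u t y - v t y)" using bu bv by (rule bounded_borel2_diff)
  show "bounded_borel2 (\<lambda>t y. h t y - k t y)" using bh bk by (rule bounded_borel2_diff)
  fix t y :: real assume t: "0 \<le> t"
  have "duhamel_term (\<lambda>t y. h t y - k t y) t y = duhamel_term h t y - duhamel_term k t y"
    unfolding duhamel_term_def
    by (simp add: S_diff bounded_borel_slice bh bk integrable_kernel Bochner_Integration.integral_diff)
  then show "u t y - v t y = S t (\<lambda>y. u 0 y - v 0 y) y + duhamel_term (\<lambda>t y. h t y - k t y) t y"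
    using duhamelD(3)[OF u t, of y] duhamelD(3)[OF v t, of y]
    by (simp add: S_diff bounded_borel_slice bu bv)
qed

text \<open>Apply \<open>S t\<close> to the formula at time \<open>t0\<close>: by the semigroup law
  this yields the initial term and the sources before \<open>t0\<close>. The sources after
  \<open>t0\<close> form the new Duhamel term.\<close>

lemma duhamel_shift:
  assumes u: "duhamel u h" and t0: "0 \<le> t0"
  shows "duhamel (\<lambda>t. u (t0 + t)) (\<lambda>t. h (t0 + t))"
  unfolding duhamel_def
proof (intro conjI allI impI)
  note bu = duhamelD(1)[OF u] and bh = duhamelD(2)[OF u]
  show "bounded_borel2 (\<lambda>t. u (t0 + t))" "bounded_borel2 (\<lambda>t. h (t0 + t))"
    using bu bh by (auto intro: bounded_borel2_shift)
  fix t y :: real assume t: "0 \<le> t"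
  have eq: "u t0 = (\<lambda>y. S t0 (u 0) y + duhamel_term h t0 y)"
    using duhamelD(3)[OF u t0] by auto
  have "S t (u t0) y = S t (S t0 (u 0)) y + S t (duhamel_term h t0) y"
    unfolding eq
    by (rule S_add[OF bounded_borel_S[OF bounded_borel_slice[OF bu]] bounded_borel_duhamel_term[OF bh]])
  also have "S t (S t0 (u 0)) y = S (t0 + t) (u 0) y"
    using S_S[OF bounded_borel_slice[OF bu] t t0] by (simp add: add.commute)
  also have "S t (duhamel_term h t0) y = (\<integral>r. S (t0 + t - r) (h r) y \<partial>time_measure t0)"
    using S_duhamel_term[OF bh t t0] by (simp add: add.commute)
  finally have 1: "S t (u t0) y = S (t0 + t) (u 0) y + (\<integral>r. S (t0 + t - r) (h r) y \<partial>time_measure t0)" .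
  have "duhamel_term h (t0 + t) y = (\<integral>r. S (t0 + t - r) (h r) y \<partial>time_measure t0) +
      (\<integral>r. S (t0 + t - (t0 + r)) (h (t0 + r)) y \<partial>time_measure t)"
    unfolding duhamel_term_def
    by (rule integral_time_measure_split[OF bounded_borel_kernel[OF bh] t0 t])
  then show "u (t0 + t) y = S t (u (t0 + 0)) y + duhamel_term (\<lambda>t. h (t0 + t)) t y"
    using 1 duhamelD(3)[OF u, of "t0 + t" y] t t0 by (simp add: duhamel_term_def)
qed

text \<open>Mild counterpart of the product rule for exp (l t) u. With no time derivative available,
  the Duhamel formula is substituted for \<open>u s\<close> in the term l u, and the order of the
  two time integrals is exchanged; the integral of l exp (l s) from r to t then produces exp (l t) -
  exp (l r), and the part with exp (l r) cancels against the original source.\<close>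

lemma duhamel_exp_shift:
  assumes u: "duhamel u h" and t: "0 \<le> t" and l: "0 \<le> l"
  shows "exp (l * t) * u t y =
    S t (u 0) y + (\<integral>s. exp (l * s) * S (t - s) (\<lambda>z. h s z + l * u s z) y \<partial>time_measure t)"
proof -
  note bu = duhamelD(1)[OF u] and bh = duhamelD(2)[OF u]
  define k where "k r = S (t - r) (h r) y" for r
  have bk: "bounded_borel k" unfolding k_def by (rule bounded_borel_kernel[OF bh])
  note [measurable] = bounded_borelD[OF bk]
  from bk obtain B where B: "\<And>x. \<bar>k x\<bar> \<le> B" by (auto simp: bounded_borel_def)
  define c where "c = S t (u 0) y"
  interpret T: finite_measure "time_measure t" by (rule finite_time_measure)
  have emin: "exp (l * min s t) \<le> exp (l * t)" for s using l by (simp add: mult_left_mono)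
  have eB: "exp (l * min s t) * \<bar>k r\<bar> \<le> exp (l * t) * B" for s r
    by (rule mult_mono[OF emin B]) auto
  have leB: "\<bar>l * exp (l * min s t) * (indicator {0..} (s - r) * k r)\<bar> \<le> l * exp (l * t) * B" for s r
  proof -
    have "\<bar>l * exp (l * min s t) * (indicator {0..} (s - r) * k r)\<bar> \<le> l * (exp (l * min s t) * \<bar>k r\<bar>)"
      using l by (simp add: abs_mult indicator_def)
    also have "\<dots> \<le> l * (exp (l * t) * B)" using eB l by (rule mult_left_mono)
    finally show ?thesis by simp
  qed
  have Ik: "(\<integral>r. k r \<partial>time_measure s) = (\<integral>r. indicator {0..} (s - r) * k r \<partial>time_measure t)" if "s \<le> t" for s
    by (rule integral_time_measure_restrict) (use that in measurable)
  have "(\<integral>s. exp (l * s) * S (t - s) (\<lambda>z. h s z + l * u s z) y \<partial>time_measure t) =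
    (\<integral>s. exp (l * min s t) * k s + (c * (indicator {0..} s * (l * exp (l * min s t))) +
        (\<integral>r. l * exp (l * min s t) * (indicator {0..} (s - r) * k r) \<partial>time_measure t)) \<partial>time_measure t)"
  proof (rule integral_time_measure_cong)
    fix s assume s: "0 \<le> s" "s \<le> t"
    \<comment> \<open>Transporting the formula at time \<open>s\<close> to the end time
      \<open>t\<close> turns its initial part into the constant \<open>c\<close> and its source part
      into the integral of \<open>k\<close> up to \<open>s\<close>, with a kernel \<open>k\<close>
      that does not depend on \<open>s\<close>.\<close>
    have "u s = (\<lambda>y. S s (u 0) y + duhamel_term h s y)"
      using duhamelD(3)[OF u s(1)] by auto
    then have "S (t - s) (u s) y = S (t - s) (\<lambda>y. S s (u 0) y + duhamel_term h s y) y"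
      by (rule arg_cong)
    also have "\<dots> = S (t - s) (S s (u 0)) y + S (t - s) (duhamel_term h s) y"
      by (rule S_add[OF bounded_borel_S[OF bounded_borel_slice[OF bu]] bounded_borel_duhamel_term[OF bh]])
    also have "S (t - s) (S s (u 0)) y = c"
      using S_S[OF bounded_borel_slice[OF bu], of "t - s" s] s by (simp add: c_def)
    also have "S (t - s) (duhamel_term h s) y = (\<integral>r. k r \<partial>time_measure s)"
      using S_duhamel_term[OF bh, of "t - s" s y] s by (simp add: k_def)
    finally have "S (t - s) (u s) y = c + (\<integral>r. indicator {0..} (s - r) * k r \<partial>time_measure t)"
      using Ik[OF s(2)] by simp
    moreover have "S (t - s) (\<lambda>z. h s z + l * u s z) y = k s + l * S (t - s) (u s) y"
      using S_add[OF bounded_borel_slice[OF bh] bounded_borel_slice[OF bounded_borel2_cmult[OF bu]]]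
      by (simp add: S_cmult k_def)
    moreover have "(\<integral>r. l * exp (l * min s t) * (indicator {0..} (s - r) * k r) \<partial>time_measure t) =
        l * exp (l * min s t) * (\<integral>r. indicator {0..} (s - r) * k r \<partial>time_measure t)"
      by (rule integral_mult_right_zero)
    ultimately show "exp (l * s) * S (t - s) (\<lambda>z. h s z + l * u s z) y =
      exp (l * min s t) * k s + (c * (indicator {0..} s * (l * exp (l * min s t))) +
        (\<integral>r. l * exp (l * min s t) * (indicator {0..} (s - r) * k r) \<partial>time_measure t))"
      using s by (simp only: distrib_left) (simp add: mult_ac)
  next
    have "(\<lambda>s. S (t - s) (\<lambda>z. h s z + l * u s z) y) \<in> borel_measurable borel"
      by (rule bounded_borelD[OF bounded_borel_kernel[OF bounded_borel2_add[OF bh bounded_borel2_cmult[OF bu]]]])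
    then show "(\<lambda>s. exp (l * s) * S (t - s) (\<lambda>z. h s z + l * u s z) y) \<in> borel_measurable borel"
      by measurable
    show "(\<lambda>s. exp (l * min s t) * k s + (c * (indicator {0..} s * (l * exp (l * min s t))) +
        (\<integral>r. l * exp (l * min s t) * (indicator {0..} (s - r) * k r) \<partial>time_measure t))) \<in> borel_measurable borel"
      by measurable
  qed
  also have "\<dots> = (\<integral>s. exp (l * min s t) * k s \<partial>time_measure t) +
      (c * (\<integral>s. indicator {0..} s * (l * exp (l * min s t)) \<partial>time_measure t) +
      (\<integral>s. \<integral>r. l * exp (l * min s t) * (indicator {0..} (s - r) * k r) \<partial>time_measure t \<partial>time_measure t))"
  proof -
    have i1: "integrable (time_measure t) (\<lambda>s. exp (l * min s t) * k s)"
    proof (rule T.integrable_const_bound[where B="exp (l * t) * B"])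
      show "AE s in time_measure t. norm (exp (l * min s t) * k s) \<le> exp (l * t) * B"
        using eB by (intro AE_I2) (simp add: abs_mult)
    qed measurable
    have i2: "integrable (time_measure t) (\<lambda>s. indicator {0..} s * (l * exp (l * min s t)))"
    proof (rule T.integrable_const_bound[where B="l * exp (l * t)"])
      show "AE s in time_measure t. norm (indicator {0..} s * (l * exp (l * min s t))) \<le> l * exp (l * t)"
        using emin l by (intro AE_I2) (auto simp: abs_mult indicator_def intro!: mult_left_mono)
    qed measurable
    have i3: "integrable (time_measure t) (\<lambda>s. \<integral>r. l * exp (l * min s t) * (indicator {0..} (s - r) * k r) \<partial>time_measure t)"
    proof (rule T.integrable_const_bound[where B="\<integral>r. l * exp (l * t) * B \<partial>time_measure t"])
      have "norm (\<integral>r. l * exp (l * min s t) * (indicator {0..} (s - r) * k r) \<partial>time_measure t) \<le>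
          (\<integral>r. l * exp (l * t) * B \<partial>time_measure t)" for s
      proof (rule Bochner_Integration.integral_norm_bound_integral)
        show "integrable (time_measure t) (\<lambda>r. l * exp (l * min s t) * (indicator {0..} (s - r) * k r))"
          by (rule T.integrable_const_bound[where B="l * exp (l * t) * B"], rule AE_I2,
              unfold real_norm_def, rule leB) measurable
      qed (simp_all only: real_norm_def leB T.integrable_const)
      then show "AE s in time_measure t. norm (\<integral>r. l * exp (l * min s t) * (indicator {0..} (s - r) * k r) \<partial>time_measure t) \<le>
          (\<integral>r. l * exp (l * t) * B \<partial>time_measure t)" by simp
    qed measurable
    show ?thesis
      using i1 i2 i3 by (simp add: Bochner_Integration.integral_add)
  qed
  also have "(\<integral>s. indicator {0..} s * (l * exp (l * min s t)) \<partial>time_measure t) = exp (l * t) - 1"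
    using integral_time_measure_exp[of 0 t l] t by simp
  also have "(\<integral>s. \<integral>r. l * exp (l * min s t) * (indicator {0..} (s - r) * k r) \<partial>time_measure t \<partial>time_measure t) =
      (\<integral>r. \<integral>s. l * exp (l * min s t) * (indicator {0..} (s - r) * k r) \<partial>time_measure t \<partial>time_measure t)"
  proof (rule Fubini_bounded[OF finite_time_measure finite_time_measure, where B="l * exp (l * t) * B"])
    show "\<bar>l * exp (l * min s t) * (indicator {0..} (s - r) * k r)\<bar> \<le> l * exp (l * t) * B" for s r
      by (rule leB)
  qed measurable
  \<comment> \<open>For fixed \<open>r\<close> the inner integral effectively runs from
    \<open>r\<close> to \<open>t\<close>.\<close>
  also have "\<dots> = (\<integral>r. k r * (exp (l * t) - exp (l * min r t)) \<partial>time_measure t)"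
  proof (rule integral_time_measure_cong)
    fix r assume r: "0 \<le> r" "r \<le> t"
    have "(\<integral>s. l * exp (l * min s t) * (indicator {0..} (s - r) * k r) \<partial>time_measure t) =
       k r * (\<integral>s. indicator {0..} (s - r) * (l * exp (l * min s t)) \<partial>time_measure t)"
      unfolding integral_mult_right_zero[symmetric] by (simp only: mult_ac)
    then show "(\<integral>s. l * exp (l * min s t) * (indicator {0..} (s - r) * k r) \<partial>time_measure t) =
       k r * (exp (l * t) - exp (l * min r t))"
      using integral_time_measure_exp[of r t l] r by simp
  qed measurable
  also have "(\<integral>r. k r * (exp (l * t) - exp (l * min r t)) \<partial>time_measure t) =
      exp (l * t) * (\<integral>r. k r \<partial>time_measure t) - (\<integral>s. exp (l * min s t) * k s \<partial>time_measure t)"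
  proof -
    have "integrable (time_measure t) (\<lambda>s. exp (l * min s t) * k s)"
    proof (rule T.integrable_const_bound[where B="exp (l * t) * B"])
      show "AE s in time_measure t. norm (exp (l * min s t) * k s) \<le> exp (l * t) * B"
        using eB by (intro AE_I2) (simp add: abs_mult)
    qed measurable
    then have "(\<integral>r. exp (l * t) * k r - exp (l * min r t) * k r \<partial>time_measure t) =
      exp (l * t) * (\<integral>r. k r \<partial>time_measure t) - (\<integral>s. exp (l * min s t) * k s \<partial>time_measure t)"
      using integrable_time_bounded[OF bk, of t] by simp
    then show ?thesis by (simp add: algebra_simps)
  qed
  finally show ?thesis
    using duhamelD(3)[OF u t, of y] by (simp add: duhamel_term_def k_def c_def algebra_simps)
qed

text \<open>After the exponential shift the zero-order term is nonnegative wherever \<open>d\<close> is, so a bound \<open>- B\<close> for \<open>d\<close>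
  improves under iteration to \<open>- B (2 l t)^n / n!\<close>.\<close>

lemma duhamel_comparison:
  assumes d: "duhamel d h" and l: "0 \<le> l"
    and h: "\<And>s y. 0 \<le> s \<Longrightarrow> h s y \<ge> - l * \<bar>d s y\<bar>"
    and d0: "\<And>y. d 0 y \<ge> 0" and t: "0 \<le> t"
  shows "d t y \<ge> exp (- l * t) * S t (d 0) y"
proof -
  note bd = duhamelD(1)[OF d] and bh = duhamelD(2)[OF d]
  from bd obtain B where B: "\<And>t y. \<bar>d t y\<bar> \<le> B" by (auto simp: bounded_borel2_def)
  have B0: "0 \<le> B" using B[of 0 0] by linarith
  have bs: "bounded_borel2 (\<lambda>s z. h s z + l * d s z)"
    by (rule bounded_borel2_add[OF bh bounded_borel2_cmult[OF bd]])
  have int: "integrable (time_measure s) (\<lambda>r. exp (l * r) * S (s - r) (\<lambda>z. h r z + l * d r z) x)" for s x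
  proof -
    interpret T: finite_measure "time_measure s" by (rule finite_time_measure)
    have bk: "bounded_borel (\<lambda>r. S (s - r) (\<lambda>z. h r z + l * d r z) x)"
      by (rule bounded_borel_kernel[OF bs])
    note [measurable] = bounded_borelD[OF bk]
    from bk obtain C where C: "\<And>r. \<bar>S (s - r) (\<lambda>z. h r z + l * d r z) x\<bar> \<le> C"
      by (auto simp: bounded_borel_def)
    show ?thesis
    proof (rule T.integrable_const_bound[where B="exp (l * s) * C"])
      show "AE r in time_measure s. norm (exp (l * r) * S (s - r) (\<lambda>z. h r z + l * d r z) x) \<le> exp (l * s) * C"
        using AE_time_measure[of s]
        by eventually_elim (use C l in \<open>auto simp: abs_mult mult_left_mono intro!: mult_mono\<close>)
    qed measurable
  qed
  \<comment> \<open>One bound for the negative part of exp (l s) d on the whole interval [0,t]; it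
    starts the iteration.\<close>
  define M where "M = B * exp (l * t)"
  have M0: "0 \<le> M" using B0 by (simp add: M_def)
  have neg: "exp (l * s) * d s x \<ge> - M * (2 * l * s) ^ n / fact n" if s: "0 \<le> s" "s \<le> t" for s x n
    using s
  proof (induction n arbitrary: s x)
    case 0
    have "- B \<le> d s x" using B[of s x] by linarith
    then have "exp (l * s) * - B \<le> exp (l * s) * d s x" by (intro mult_left_mono) auto
    moreover have "exp (l * s) * B \<le> exp (l * t) * B" using 0 l B0 by (intro mult_right_mono) (auto intro: mult_left_mono)
    ultimately show ?case by (simp add: M_def mult.commute)
  next
    case (Suc n)
    define b where "b r = M * (2 * l * r) ^ n / fact n" for r
    have "- (\<integral>r. 2 * l * b r \<partial>time_measure s) \<le>
       (\<integral>r. exp (l * r) * S (s - r) (\<lambda>z. h r z + l * d r z) x \<partial>time_measure s)"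
      unfolding integral_minus[symmetric]
    proof (rule integral_time_measure_mono[OF _ int])
      have "set_integrable lborel {0..s} (\<lambda>r. - (2 * l * b r))"
        unfolding b_def by (intro borel_integrable_atLeastAtMost' continuous_intros) auto
      moreover have "(\<lambda>r. - (2 * l * b r)) \<in> borel_measurable borel" unfolding b_def by measurable
      ultimately show "integrable (time_measure s) (\<lambda>r. - (2 * l * b r))"
        by (subst integrable_time_measure_iff)
      fix r assume r: "0 \<le> r" "r \<le> s"
      have b0: "0 \<le> b r" unfolding b_def using r l M0 by auto
      \<comment> \<open>The shifted source is at least l (d - \<bar>d\<bar>), which vanishes where d
        is nonnegative and equals 2 l d elsewhere. This is the origin of the factor 2.\<close>
      have low: "- (2 * l * (exp (- (l * r)) * b r)) \<le> h r z + l * d r z" for z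
      proof -
        have "- b r \<le> exp (l * r) * d r z"
          using Suc.IH[of r z] r Suc.prems by (simp add: b_def)
        then have "exp (- (l * r)) * - b r \<le> exp (- (l * r)) * (exp (l * r) * d r z)"
          by (intro mult_left_mono) auto
        then have *: "- (exp (- (l * r)) * b r) \<le> d r z"
          by (simp add: mult.assoc[symmetric] exp_add[symmetric])
        have "- l * \<bar>d r z\<bar> \<le> h r z" using h r by auto
        moreover have "- 2 * (exp (- (l * r)) * b r) \<le> d r z - \<bar>d r z\<bar>"
        proof -
          have "0 \<le> exp (- (l * r)) * b r" using b0 by simp
          with * show ?thesis by linarith
        qed
        then have "l * (- 2 * (exp (- (l * r)) * b r)) \<le> l * (d r z - \<bar>d r z\<bar>)"
          by (rule mult_left_mono) (rule l)
        ultimately show ?thesis by (simp add: algebra_simps)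
      qed
      have "S (s - r) (\<lambda>z. - (2 * l * (exp (- (l * r)) * b r))) x \<le> S (s - r) (\<lambda>z. h r z + l * d r z) x"
        by (rule S_mono[OF _ bounded_borel_slice[OF bs] low]) (auto simp: bounded_borel_def)
      then have "exp (l * r) * - (2 * l * (exp (- (l * r)) * b r)) \<le> exp (l * r) * S (s - r) (\<lambda>z. h r z + l * d r z) x"
        by (intro mult_left_mono) auto
      then show "- (2 * l * b r) \<le> exp (l * r) * S (s - r) (\<lambda>z. h r z + l * d r z) x"
        by (simp add: exp_minus field_simps)
    qed
    moreover have "(\<integral>r. 2 * l * b r \<partial>time_measure s) = M * (2 * l * s) ^ Suc n / fact (Suc n)"
    proof -
      have "(\<integral>r. 2 * l * b r \<partial>time_measure s) =
          M * (2 * l * s) ^ Suc n / fact (Suc n) - M * (2 * l * 0) ^ Suc n / fact (Suc n)"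
      proof (rule integral_time_measure_FTC[OF Suc.prems(1)])
        show "continuous_on UNIV (\<lambda>r. 2 * l * b r)"
          unfolding b_def by (intro continuous_intros) auto
        show "((\<lambda>r. M * (2 * l * r) ^ Suc n / fact (Suc n)) has_real_derivative 2 * l * b r) (at r)" for r
          unfolding b_def
          by (rule derivative_eq_intros refl | simp)+
      qed
      then show ?thesis by simp
    qed
    moreover have "0 \<le> S s (d 0) x" using d0 by (rule S_nonneg)
    ultimately show ?case
      using duhamel_exp_shift[OF d Suc.prems(1) l, of x] by simp
  qed
  have nonneg: "0 \<le> d s x" if s: "0 \<le> s" "s \<le> t" for s x
  proof -
    have "(\<lambda>n. (2 * l * s) ^ n / fact n) \<longlonglongrightarrow> 0"
      using summable_exp_generic[of "2 * l * s"]
      by (intro summable_LIMSEQ_zero) (simp add: field_simps)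
    then have "(\<lambda>n. - M * ((2 * l * s) ^ n / fact n)) \<longlonglongrightarrow> - M * 0"
      by (rule tendsto_mult_left)
    then have "(\<lambda>n. - M * (2 * l * s) ^ n / fact n) \<longlonglongrightarrow> 0" by simp
    then have "0 \<le> exp (l * s) * d s x"
      by (rule LIMSEQ_le_const2) (use neg[OF s] in auto)
    then show ?thesis by (simp add: zero_le_mult_iff)
  qed
  \<comment> \<open>Once d is known to be nonnegative, so is the shifted source. Dropping its
    integral, instead of the initial term, leaves the quantitative bound.\<close>
  have "0 \<le> (\<integral>r. exp (l * r) * S (t - r) (\<lambda>z. h r z + l * d r z) y \<partial>time_measure t)"
  proof -
    have "(\<integral>r. 0 \<partial>time_measure t) \<le> (\<integral>r. exp (l * r) * S (t - r) (\<lambda>z. h r z + l * d r z) y \<partial>time_measure t)"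
    proof (rule integral_time_measure_mono[OF _ int])
      fix r assume r: "0 \<le> r" "r \<le> t"
      have "0 \<le> h r z + l * d r z" for z
        using h[OF r(1), of z] nonneg[OF r, of z] by (simp add: abs_of_nonneg)
      then show "0 \<le> exp (l * r) * S (t - r) (\<lambda>z. h r z + l * d r z) y"
        using S_nonneg by (intro mult_nonneg_nonneg) auto
    qed simp
    then show ?thesis by simp
  qed
  then have "S t (d 0) y \<le> exp (l * t) * d t y"
    using duhamel_exp_shift[OF d t l, of y] by simp
  then have "exp (- l * t) * S t (d 0) y \<le> exp (- l * t) * (exp (l * t) * d t y)"
    by (intro mult_left_mono) auto
  then show ?thesis by (simp add: mult.assoc[symmetric] exp_add[symmetric])
qed

end

section \<open>Translates of a smooth profile in Duhamel form\<close>

lemma integrable_gauss_bounded: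
  assumes [measurable]: "g \<in> borel_measurable borel" and "\<And>x. \<bar>g x\<bar> \<le> B"
  shows "integrable lborel (\<lambda>x. std_normal_density x * g x)"
proof -
  interpret finite_measure std_gauss by (rule finite_std_gauss)
  have "integrable std_gauss g"
    by (rule integrable_const_bound[where B=B]) (use assms(2) in auto)
  then show ?thesis by (subst (asm) integrable_density) auto
qed

lemma integrable_gauss_bounded_moment:
  assumes [measurable]: "g \<in> borel_measurable borel" and B: "\<And>x. \<bar>g x\<bar> \<le> B"
  shows "integrable lborel (\<lambda>x. std_normal_density x * (x * g x))"
proof (rule Bochner_Integration.integrable_bound)
  show "integrable lborel (\<lambda>x. B * (std_normal_density x * \<bar>x\<bar> ^ 1))"
    by (intro integrable_mult_right integrable_std_normal_moment_abs)
  show "AE x in lborel. norm (std_normal_density x * (x * g x)) \<le> norm (B * (std_normal_density x * \<bar>x\<bar> ^ 1))"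
  proof (rule AE_I2)
    fix x
    have "std_normal_density x * \<bar>x\<bar> * \<bar>g x\<bar> \<le> std_normal_density x * \<bar>x\<bar> * B"
      using B by (intro mult_left_mono) auto
    moreover have "0 \<le> B" using B[of 0] by linarith
    ultimately show "norm (std_normal_density x * (x * g x)) \<le> norm (B * (std_normal_density x * \<bar>x\<bar> ^ 1))"
      by (simp add: abs_mult mult_ac)
  qed
qed measurable

text \<open>Stein's identity: x times the Gaussian density is minus the derivative of the density,
  and the boundary terms vanish because \<open>p\<close> is bounded. It will convert the factor x,
  created by differentiating sqrt (t - s), into a second space derivative.\<close>

lemma gauss_integration_by_parts:
  fixes p p' :: "real \<Rightarrow> real"
  assumes p: "\<And>x. (p has_real_derivative p' x) (at x)"
    and p': "continuous_on UNIV p'"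
    and B: "\<And>x. \<bar>p x\<bar> \<le> B" and C: "\<And>x. \<bar>p' x\<bar> \<le> C"
  shows "(\<integral>x. x * p x \<partial>std_gauss) = (\<integral>x. p' x \<partial>std_gauss)"
proof -
  have pc: "continuous_on UNIV p"
    using p by (intro DERIV_continuous_on) (auto intro: has_field_derivative_at_within)
  have [measurable]: "p \<in> borel_measurable borel" "p' \<in> borel_measurable borel"
    using pc p' by (auto intro: borel_measurable_continuous_onI)
  define F where "F x = - std_normal_density x * p x" for x
  define G where "G x = std_normal_density x * (x * p x) - std_normal_density x * p' x" for x
  have nd: "(std_normal_density has_real_derivative - x * std_normal_density x) (at x)" for x
    unfolding normal_density_def
    by (rule derivative_eq_intros refl | simp)+
  have F: "(F has_real_derivative G x) (at x)" for x
    unfolding F_def G_def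
    by (rule derivative_eq_intros nd p refl | simp)+
  have Gint: "integrable lborel G"
    unfolding G_def
    by (intro Bochner_Integration.integrable_diff integrable_gauss_bounded_moment[OF _ B] integrable_gauss_bounded[OF _ C]) auto
  have Gc: "continuous_on UNIV G"
    unfolding G_def normal_density_def using pc p'
    by (intro continuous_intros) auto
  have lim: "(F \<longlongrightarrow> 0) at_top" "(F \<longlongrightarrow> 0) at_bot"
  proof -
    have "(std_normal_density \<longlongrightarrow> 0) at_top" "(std_normal_density \<longlongrightarrow> 0) at_bot"
      unfolding normal_density_def by real_asymp+
    then have *: "((\<lambda>x. B * std_normal_density x) \<longlongrightarrow> 0) at_top" "((\<lambda>x. B * std_normal_density x) \<longlongrightarrow> 0) at_bot"
      by (auto intro: tendsto_mult_right_zero)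
    have "norm (F x) \<le> B * std_normal_density x" for x
      unfolding F_def using B[of x] by (simp add: abs_mult mult_right_mono mult.commute)
    then show "(F \<longlongrightarrow> 0) at_top" "(F \<longlongrightarrow> 0) at_bot"
      using * by (auto intro!: Lim_null_comparison[where g="\<lambda>x. B * std_normal_density x"])
  qed
  have "(LBINT x=-\<infinity>..\<infinity>. G x) = 0 - 0"
  proof (rule interval_integral_FTC_integrable)
    show "(F has_vector_derivative G x) (at x)" for x
      using F by (simp add: has_real_derivative_iff_has_vector_derivative)
    show "isCont G x" for x using Gc by (simp add: continuous_on_eq_continuous_at)
    show "set_integrable lborel (einterval (-\<infinity>) \<infinity>) G"
      using Gint by (simp add: set_integrable_def)
    show "((F \<circ> real_of_ereal) \<longlongrightarrow> 0) (at_right (-\<infinity>))" "((F \<circ> real_of_ereal) \<longlongrightarrow> 0) (at_left \<infinity>)"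
      using lim by (simp_all add: ereal_tendsto_simps)
  qed simp
  then have "(\<integral>x. G x \<partial>lborel) = 0"
    by (simp add: interval_lebesgue_integral_def set_lebesgue_integral_def)
  then have "(\<integral>x. std_normal_density x * (x * p x) \<partial>lborel) = (\<integral>x. std_normal_density x * p' x \<partial>lborel)"
    unfolding G_def
    by (subst (asm) Bochner_Integration.integral_diff)
       (auto intro!: integrable_gauss_bounded_moment[OF _ B] integrable_gauss_bounded[OF _ C])
  then show ?thesis
    by (subst (1 2) integral_density) auto
qed

context drift_heat
begin

text \<open>For v = V (y + \<xi>) + q the source is the time derivative of v minus the generator
  applied to v. The formula arises by integrating the derivative of s \<mapsto> S (t - s) (v s) y.
  That derivative contains 1 / sqrt (t - s), so the integration stops at a < t and a tends to t
  afterwards.\<close>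

lemma duhamel_moving_profile:
  fixes V V' V'' \<xi> \<xi>' q q' :: "real \<Rightarrow> real"
  assumes V: "\<And>x. (V has_real_derivative V' x) (at x)"
    and V': "\<And>x. (V' has_real_derivative V'' x) (at x)"
    and V'': "continuous_on UNIV V''"
    and C0: "\<And>x. \<bar>V x\<bar> \<le> C0" and C1: "\<And>x. \<bar>V' x\<bar> \<le> C1" and C2: "\<And>x. \<bar>V'' x\<bar> \<le> C2"
    and \<xi>: "\<And>s. (\<xi> has_real_derivative \<xi>' s) (at s)" and \<xi>': "continuous_on UNIV \<xi>'"
    and q: "\<And>s. (q has_real_derivative q' s) (at s)" and q': "continuous_on UNIV q'"
    and X: "\<And>s. 0 \<le> s \<Longrightarrow> \<bar>\<xi>' s\<bar> \<le> X"
    and Q: "\<And>s. 0 \<le> s \<Longrightarrow> \<bar>q s\<bar> \<le> Q" and Q': "\<And>s. 0 \<le> s \<Longrightarrow> \<bar>q' s\<bar> \<le> Q'"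
  shows "duhamel (\<lambda>t y. V (y + \<xi> (max 0 t)) + q (max 0 t))
    (\<lambda>t y. V' (y + \<xi> (max 0 t)) * (\<xi>' (max 0 t) + \<mu>) + q' (max 0 t) - \<sigma>\<^sup>2 / 2 * V'' (y + \<xi> (max 0 t)))"
    (is "duhamel ?v ?h")
proof -
  have cont: "continuous_on UNIV V" "continuous_on UNIV V'" "continuous_on UNIV \<xi>" "continuous_on UNIV q"
    using V V' \<xi> q by (auto intro!: DERIV_continuous_on intro: has_field_derivative_at_within)
  note [measurable] = cont[THEN borel_measurable_continuous_onI]
    V''[THEN borel_measurable_continuous_onI] \<xi>'[THEN borel_measurable_continuous_onI]
    q'[THEN borel_measurable_continuous_onI]
  have C0_nonneg: "0 \<le> C0" and C1_nonneg: "0 \<le> C1" and C2_nonneg: "0 \<le> C2"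
    using C0[of 0] C1[of 0] C2[of 0] by linarith+
  have bv: "bounded_borel2 ?v"
    unfolding bounded_borel2_def
  proof (intro conjI exI allI)
    show "\<bar>?v t y\<bar> \<le> C0 + Q" for t y
      using C0[of "y + \<xi> (max 0 t)"] Q[of "max 0 t"] by linarith
  qed measurable
  have bh: "bounded_borel2 ?h"
    unfolding bounded_borel2_def
  proof (intro conjI exI allI)
    show "\<bar>?h t y\<bar> \<le> C1 * (X + \<bar>\<mu>\<bar>) + Q' + \<sigma>\<^sup>2 / 2 * C2" for t y
    proof -
      have "\<bar>V' (y + \<xi> (max 0 t)) * (\<xi>' (max 0 t) + \<mu>)\<bar> \<le> C1 * (X + \<bar>\<mu>\<bar>)"
        unfolding abs_mult using C1 X[of "max 0 t"] C1_nonneg by (intro mult_mono) auto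
      moreover have "\<bar>\<sigma>\<^sup>2 / 2 * V'' (y + \<xi> (max 0 t))\<bar> \<le> \<sigma>\<^sup>2 / 2 * C2"
        unfolding abs_mult using C2 by (intro mult_mono) auto
      ultimately show ?thesis using Q'[of "max 0 t"] by linarith
    qed
  qed measurable
  have C1i: "integrable std_gauss (\<lambda>x. V' (m + r * x))" and C2i: "integrable std_gauss (\<lambda>x. V'' (m + r * x))" for m r
    by (rule integrable_S[OF bounded_borelI[OF _ C1]] integrable_S[OF bounded_borelI[OF _ C2]], measurable)+
  have xi: "integrable std_gauss (\<lambda>x. \<bar>x\<bar>)"
    using integrable_std_normal_moment_abs[of 1] by (subst integrable_density) auto
  have xV': "integrable std_gauss (\<lambda>x. x * V' (m + r * x))" for m r
    using integrable_gauss_bounded_moment[of "\<lambda>x. V' (m + r * x)" C1] C1 by (subst integrable_density) auto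
  have ibp: "(\<integral>x. x * V' (m + r * x) \<partial>std_gauss) = r * (\<integral>x. V'' (m + r * x) \<partial>std_gauss)" for m r
  proof -
    have "(\<integral>x. x * V' (m + r * x) \<partial>std_gauss) = (\<integral>x. V'' (m + r * x) * r \<partial>std_gauss)"
    proof (rule gauss_integration_by_parts)
      show "((\<lambda>x. V' (m + r * x)) has_real_derivative V'' (m + r * x) * r) (at x)" for x
        by (rule DERIV_chain'[OF _ V']) (auto intro!: derivative_eq_intros)
      show "continuous_on UNIV (\<lambda>x. V'' (m + r * x) * r)"
        by (intro continuous_intros continuous_on_compose2[OF V'']) auto
      show "\<bar>V'' (m + r * x) * r\<bar> \<le> C2 * \<bar>r\<bar>" for x
        unfolding abs_mult using C2 by (intro mult_right_mono) auto
    qed (rule C1)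
    then show ?thesis by (simp add: mult.commute)
  qed
  have step: "S (t - a) (?v a) y = S t (?v 0) y + (\<integral>s. S (t - s) (?h s) y \<partial>time_measure a)"
    if a: "0 \<le> a" "a < t" for a t y
  proof -
    define P where "P s x = y + \<xi> s - \<mu> * (t - s) + \<sigma> * sqrt (t - s) * x" for s x
    define D where "D s x = V' (P s x) * (\<xi>' s + \<mu> - \<sigma> * x / (2 * sqrt (t - s))) + q' s" for s x
    \<comment> \<open>Keeps the time argument in [0,a], where \<open>D\<close> has no singularity
      and the bounds on \<open>\<xi>'\<close> and \<open>q'\<close> are available. On the support of
      the time measure it is the identity.\<close>
    define c where "c s = max 0 (min s a)" for s
    have c: "0 \<le> c s" "c s \<le> a" for s using a by (auto simp: c_def)
    have cs: "c s = s" if "0 \<le> s" "s \<le> a" for s using that by (auto simp: c_def)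
    have Sv: "S (t - s) (?v s) y = (\<integral>x. V (P s x) + q s \<partial>std_gauss)" if "0 \<le> s" for s
      unfolding S_def using that by (simp add: P_def algebra_simps)
    have D: "((\<lambda>s. V (P s x) + q s) has_real_derivative D s x) (at s)" if "s < t" for s x
    proof -
      have sq: "((\<lambda>s. sqrt (t - s)) has_real_derivative - (inverse (sqrt (t - s)) / 2)) (at s)"
        by (rule DERIV_cong[OF DERIV_chain2[OF DERIV_real_sqrt]])
           (use that in \<open>auto intro!: derivative_eq_intros\<close>)
      have lin: "((\<lambda>s. y - \<mu> * (t - s)) has_real_derivative \<mu>) (at s)"
        by (auto intro!: derivative_eq_intros)
      have P': "((\<lambda>s. \<xi> s + (y - \<mu> * (t - s)) + \<sigma> * x * sqrt (t - s)) has_real_derivative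
          \<xi>' s + \<mu> + \<sigma> * x * - (inverse (sqrt (t - s)) / 2)) (at s)"
        by (intro DERIV_add \<xi> lin DERIV_cmult sq)
      have "(\<lambda>s. \<xi> s + (y - \<mu> * (t - s)) + \<sigma> * x * sqrt (t - s)) = (\<lambda>s. P s x)"
        by (simp add: P_def fun_eq_iff)
      with P' have "((\<lambda>s. P s x) has_real_derivative \<xi>' s + \<mu> - \<sigma> * x / (2 * sqrt (t - s))) (at s)"
        by (simp add: field_simps)
      from DERIV_add[OF DERIV_chain2[OF V this] q] show ?thesis by (simp add: D_def)
    qed
    have Dc: "isCont (\<lambda>s. D s x) s" if "s < t" for s x
    proof -
      have "continuous_on {..<t} (\<lambda>s. D s x)"
        unfolding D_def P_def
        by (intro continuous_intros continuous_on_compose2[OF cont(2)] continuous_on_subset[OF cont(3)]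
              continuous_on_subset[OF \<xi>'] continuous_on_subset[OF q']) auto
      then show ?thesis using that by (simp add: continuous_on_eq_continuous_at)
    qed
    have D_meas [measurable]: "case_prod (\<lambda>s x. D (c s) x) \<in> borel_measurable (borel \<Otimes>\<^sub>M borel)"
      unfolding D_def P_def c_def by measurable
    have D_meas' [measurable]: "case_prod (\<lambda>s x. D (c s) x) \<in> borel_measurable (time_measure a \<Otimes>\<^sub>M std_gauss)"
      using D_meas by (simp cong: measurable_cong_sets)
    have FTC: "(\<integral>s. D (c s) x \<partial>time_measure a) = (V (P a x) + q a) - (V (P 0 x) + q 0)" for x
    proof -
      have "(\<integral>s. D (c s) x \<partial>time_measure a) = (LBINT s:{0..a}. D (c s) x)"
        by (rule integral_time_measure) measurable
      also have "\<dots> = (\<integral>s. D s x * indicator {0..a} s \<partial>lborel)"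
        unfolding set_lebesgue_integral_def
        by (intro Bochner_Integration.integral_cong) (auto simp: cs indicator_def)
      also have "\<dots> = (V (P a x) + q a) - (V (P 0 x) + q 0)"
        by (rule integral_FTC_Icc_real[OF a(1)]) (use a in \<open>auto intro: D Dc\<close>)
      finally show ?thesis .
    qed
    \<comment> \<open>Linear growth in x comes from differentiating the Gaussian spread. It is
      integrable against the Gaussian, and uniform in \<open>s\<close> because t - s \<ge> t -
      a.\<close>
    define g where "g x = C1 * (X + \<bar>\<mu>\<bar>) + Q' + C1 * (\<sigma> / (2 * sqrt (t - a))) * \<bar>x\<bar>" for x
    have Dg: "\<bar>D (c s) x\<bar> \<le> g x" for s x
    proof -
      have le: "sqrt (t - a) \<le> sqrt (t - c s)" "0 < sqrt (t - a)" using c[of s] a by auto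
      have "\<bar>\<sigma> * x / (2 * sqrt (t - c s))\<bar> = \<sigma> * \<bar>x\<bar> / (2 * sqrt (t - c s))"
        using le sigma_pos by (simp add: abs_mult)
      also have "\<dots> \<le> \<sigma> * \<bar>x\<bar> / (2 * sqrt (t - a))"
        using le sigma_pos by (intro divide_left_mono mult_pos_pos mult_nonneg_nonneg) auto
      finally have *: "\<bar>\<sigma> * x / (2 * sqrt (t - c s))\<bar> \<le> \<sigma> / (2 * sqrt (t - a)) * \<bar>x\<bar>" by simp
      have "\<bar>\<xi>' (c s) + \<mu> - \<sigma> * x / (2 * sqrt (t - c s))\<bar> \<le> X + \<bar>\<mu>\<bar> + \<sigma> / (2 * sqrt (t - a)) * \<bar>x\<bar>"
        using * X[OF c(1)[of s]] by linarith
      then have "\<bar>V' (P (c s) x)\<bar> * \<bar>\<xi>' (c s) + \<mu> - \<sigma> * x / (2 * sqrt (t - c s))\<bar> \<le>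
          C1 * (X + \<bar>\<mu>\<bar> + \<sigma> / (2 * sqrt (t - a)) * \<bar>x\<bar>)"
        by (intro mult_mono C1 C1_nonneg) auto
      then have "\<bar>V' (P (c s) x) * (\<xi>' (c s) + \<mu> - \<sigma> * x / (2 * sqrt (t - c s)))\<bar> \<le>
          C1 * (X + \<bar>\<mu>\<bar> + \<sigma> / (2 * sqrt (t - a)) * \<bar>x\<bar>)"
        by (simp only: abs_mult)
      also have "\<dots> = g x - Q'" by (simp add: g_def algebra_simps)
      finally show ?thesis using Q'[OF c(1)[of s]] unfolding D_def by linarith
    qed
    have gi: "integrable std_gauss g"
    proof -
      interpret finite_measure std_gauss by (rule finite_std_gauss)
      show ?thesis unfolding g_def[abs_def]
        by (intro Bochner_Integration.integrable_add integrable_const integrable_mult_right xi)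
    qed
    have SD: "(\<integral>x. D s x \<partial>std_gauss) = S (t - s) (?h s) y" if s: "0 \<le> s" "s \<le> a" for s
    proof -
      interpret prob_space std_gauss by (rule prob_space_std_gauss)
      define m r where "m = y + \<xi> s - \<mu> * (t - s)" and "r = \<sigma> * sqrt (t - s)"
      have st: "0 < sqrt (t - s)" using s a by auto
      have Pm: "P s x = m + r * x" for x by (simp add: P_def m_def r_def)
      \<comment> \<open>Here Stein's identity acts: the weight x is traded for the factor
        \<open>r\<close>, and the product k r is exactly the diffusion coefficient, free of the
        singularity.\<close>
      define k where "k = \<sigma> / (2 * sqrt (t - s))"
      have kr: "k * r = \<sigma>\<^sup>2 / 2" using st by (simp add: k_def r_def power2_eq_square)
      have "(\<integral>x. D s x \<partial>std_gauss) =
        (\<integral>x. (\<xi>' s + \<mu>) * V' (m + r * x) - k * (x * V' (m + r * x)) + q' s \<partial>std_gauss)"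
        unfolding D_def Pm by (intro Bochner_Integration.integral_cong) (auto simp: k_def algebra_simps)
      also have "\<dots> = (\<xi>' s + \<mu>) * (\<integral>x. V' (m + r * x) \<partial>std_gauss) -
          k * (\<integral>x. x * V' (m + r * x) \<partial>std_gauss) + q' s"
        by (simp add: C1i xV' prob_space[simplified])
      also have "\<dots> = (\<xi>' s + \<mu>) * (\<integral>x. V' (m + r * x) \<partial>std_gauss) -
          \<sigma>\<^sup>2 / 2 * (\<integral>x. V'' (m + r * x) \<partial>std_gauss) + q' s"
        unfolding ibp kr[symmetric] by simp
      also have "\<dots> = (\<integral>x. (\<xi>' s + \<mu>) * V' (m + r * x) + q' s - \<sigma>\<^sup>2 / 2 * V'' (m + r * x) \<partial>std_gauss)"
        by (simp add: C1i C2i prob_space[simplified])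
      also have "\<dots> = S (t - s) (?h s) y"
        unfolding S_def using s
        by (intro Bochner_Integration.integral_cong) (auto simp: m_def r_def algebra_simps)
      finally show ?thesis .
    qed
    have VPi: "integrable std_gauss (\<lambda>x. V (P s x) + q s)" for s
    proof -
      interpret finite_measure std_gauss by (rule finite_std_gauss)
      have "integrable std_gauss (\<lambda>x. V ((y + \<xi> s - \<mu> * (t - s)) + (\<sigma> * sqrt (t - s)) * x))"
        by (rule integrable_S[OF bounded_borelI[OF _ C0]]) measurable
      then show ?thesis unfolding P_def by (intro Bochner_Integration.integrable_add integrable_const)
    qed
    have "S (t - a) (?v a) y - S (t - 0) (?v 0) y = (\<integral>x. (V (P a x) + q a) - (V (P 0 x) + q 0) \<partial>std_gauss)"
      unfolding Sv[OF a(1)] Sv[OF order_refl] by (simp only: Bochner_Integration.integral_diff[OF VPi VPi])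
    also have "\<dots> = (\<integral>x. \<integral>s. D (c s) x \<partial>time_measure a \<partial>std_gauss)"
      unfolding FTC ..
    also have "\<dots> = (\<integral>s. \<integral>x. D (c s) x \<partial>std_gauss \<partial>time_measure a)"
      by (rule Fubini_dominated[OF finite_time_measure finite_std_gauss D_meas' Dg gi])
    also have "\<dots> = (\<integral>s. S (t - s) (?h s) y \<partial>time_measure a)"
    proof (rule integral_time_measure_cong)
      show "(\<lambda>s. \<integral>x. D (c s) x \<partial>std_gauss) \<in> borel_measurable borel"
      proof -
        interpret prob_space std_gauss by (rule prob_space_std_gauss)
        show ?thesis by measurable
      qed
      show "(\<lambda>s. S (t - s) (?h s) y) \<in> borel_measurable borel"
        by (rule bounded_borelD[OF bounded_borel_kernel[OF bh]])
    qed (simp add: cs SD)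
    finally show ?thesis by simp
  qed
  show ?thesis
    unfolding duhamel_def
  proof (intro conjI allI impI)
    show "bounded_borel2 ?v" by (rule bv)
    show "bounded_borel2 ?h" by (rule bh)
    fix t y :: real assume "0 \<le> t"
    show "?v t y = S t (?v 0) y + duhamel_term ?h t y"
    proof (cases "t = 0")
      case True
      have "duhamel_term ?h 0 y = 0" by (rule duhamel_term_0[OF bh])
      with True show ?thesis by simp
    next
      case False
      with \<open>0 \<le> t\<close> have t: "0 < t" by simp
      define k where "k s = S (t - s) (?h s) y" for s
      have bk: "bounded_borel k" unfolding k_def by (rule bounded_borel_kernel[OF bh])
      from bk obtain B where B: "\<And>x. \<bar>k x\<bar> \<le> B" by (auto simp: bounded_borel_def)
      have seq: "S (t - a) (?v a) y = S t (?v 0) y + (\<integral>s. k s \<partial>time_measure a)" if "0 \<le> a" "a < t" for a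
        using step[OF that] by (simp add: k_def)
      have kt: "\<bar>(\<integral>s. k s \<partial>time_measure t) - (\<integral>s. k s \<partial>time_measure a)\<bar> \<le> B * (t - a)" if "0 \<le> a" "a < t" for a
      proof -
        interpret finite_measure "time_measure (t - a)" by (rule finite_time_measure)
        have bka: "bounded_borel (\<lambda>s. k (a + s))"
          by (intro bounded_borelI[OF _ B] measurable_compose[OF _ bounded_borelD[OF bk]]) measurable
        have "(\<integral>s. k s \<partial>time_measure t) - (\<integral>s. k s \<partial>time_measure a) = (\<integral>s. k (a + s) \<partial>time_measure (t - a))"
          using integral_time_measure_split[OF bk, of a "t - a"] that by simp
        moreover have "\<bar>\<integral>s. k (a + s) \<partial>time_measure (t - a)\<bar> \<le> (\<integral>s. B \<partial>time_measure (t - a))"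
          using B by (intro integral_abs_bound_integral integrable_time_bounded[OF bka] integrable_const) auto
        moreover have "(\<integral>s. B \<partial>time_measure (t - a)) = B * (t - a)"
          using that by (subst integral_time_measure) (simp_all add: set_lebesgue_integral_def)
        ultimately show ?thesis by (simp only:)
      qed
      \<comment> \<open>The Duhamel integrals converge as their kernel is bounded; the left-hand
        sides converge by dominated convergence, since v is continuous and the Gaussian spread
        shrinks to 0.\<close>
      define a where "a n = t - t / real (Suc n)" for n
      have a: "0 \<le> a n" "a n < t" for n using t by (auto simp: a_def field_simps)
      have a_lim: "a \<longlonglongrightarrow> t"
        unfolding a_def using tendsto_diff[OF tendsto_const LIMSEQ_Suc[OF lim_const_over_n[of t]], of t] by simp
      have lim1: "(\<lambda>n. \<integral>s. k s \<partial>time_measure (a n)) \<longlonglongrightarrow> (\<integral>s. k s \<partial>time_measure t)"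
      proof (rule LIM_zero_cancel, rule Lim_null_comparison)
        show "\<forall>\<^sub>F n in sequentially. norm ((\<integral>s. k s \<partial>time_measure (a n)) - (\<integral>s. k s \<partial>time_measure t)) \<le> B * (t - a n)"
          using kt[OF a] by (auto simp: abs_minus_commute)
        have "(\<lambda>n. B * (t - a n)) \<longlonglongrightarrow> B * (t - t)" by (intro tendsto_intros a_lim)
        then show "(\<lambda>n. B * (t - a n)) \<longlonglongrightarrow> 0" by simp
      qed
      have lim2: "(\<lambda>n. S (t - a n) (?v (a n)) y) \<longlonglongrightarrow> ?v t y"
      proof -
        interpret prob_space std_gauss by (rule prob_space_std_gauss)
        have "(\<lambda>n. \<integral>x. ?v (a n) (y - \<mu> * (t - a n) + \<sigma> * sqrt (t - a n) * x) \<partial>std_gauss) \<longlonglongrightarrow>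
            (\<integral>x. ?v t y \<partial>std_gauss)"
        proof (rule integral_dominated_convergence[where w="\<lambda>_. C0 + Q"])
          fix n
          show "AE x in std_gauss.
              norm (?v (a n) (y - \<mu> * (t - a n) + \<sigma> * sqrt (t - a n) * x)) \<le> C0 + Q"
          proof (rule AE_I2)
            fix x
            show "norm (?v (a n) (y - \<mu> * (t - a n) + \<sigma> * sqrt (t - a n) * x)) \<le> C0 + Q"
              using C0[of "y - \<mu> * (t - a n) + \<sigma> * sqrt (t - a n) * x + \<xi> (max 0 (a n))"] Q[of "max 0 (a n)"]
              unfolding real_norm_def by linarith
          qed
        next
          show "AE x in std_gauss. (\<lambda>n. ?v (a n) (y - \<mu> * (t - a n) + \<sigma> * sqrt (t - a n) * x)) \<longlonglongrightarrow> ?v t y"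
          proof (rule AE_I2)
            fix x
            have c: "isCont V z" "isCont \<xi> z" "isCont q z" for z
              using cont by (auto simp: continuous_on_eq_continuous_at)
            have "(\<lambda>n. ?v (a n) (y - \<mu> * (t - a n) + \<sigma> * sqrt (t - a n) * x)) \<longlonglongrightarrow>
                ?v t (y - \<mu> * (t - t) + \<sigma> * sqrt (t - t) * x)"
              by (intro tendsto_add isCont_tendsto_compose[OF c(1)] isCont_tendsto_compose[OF c(2)]
                  isCont_tendsto_compose[OF c(3)] tendsto_intros a_lim)
            then show "(\<lambda>n. ?v (a n) (y - \<mu> * (t - a n) + \<sigma> * sqrt (t - a n) * x)) \<longlonglongrightarrow> ?v t y"
              by simp
          qed
        qed auto
        then show ?thesis by (simp add: S_def prob_space[simplified])
      qed
      have "(\<lambda>n. S (t - a n) (?v (a n)) y) \<longlonglongrightarrow> S t (?v 0) y + (\<integral>s. k s \<partial>time_measure t)"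
        unfolding seq[OF a] by (intro tendsto_intros lim1)
      from LIMSEQ_unique[OF lim2 this] show ?thesis
        by (simp add: duhamel_term_def k_def)
    qed
  qed
qed

end

section \<open>Bistable waves and barriers\<close>

lemma strict_mono_between_limits:
  fixes V :: "real \<Rightarrow> real"
  assumes V: "strict_mono V" and bot: "(V \<longlongrightarrow> l) at_bot" and top: "(V \<longlongrightarrow> u) at_top"
  shows "l < V x" "V x < u"
proof -
  have "l \<le> V (x - 1)"
  proof (rule tendsto_upperbound[OF bot])
    show "\<forall>\<^sub>F y in at_bot. V y \<le> V (x - 1)"
      using eventually_le_at_bot[of "x - 1"] by eventually_elim (simp add: V strict_mono_less_eq)
  qed simp
  also have "\<dots> < V x" using V by (simp add: strict_mono_less)
  finally show "l < V x" .
  have "V x < V (x + 1)" using V by (simp add: strict_mono_less)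
  also have "V (x + 1) \<le> u"
  proof (rule tendsto_lowerbound[OF top])
    show "\<forall>\<^sub>F y in at_top. V (x + 1) \<le> V y"
      using eventually_ge_at_top[of "x + 1"] by eventually_elim (simp add: V strict_mono_less_eq)
  qed simp
  finally show "V x < u" .
qed

text \<open>The wave seen in its own frame: \<open>\<mu>\<close> is the drift there, so the speed no
  longer appears. The slope conditions extend beyond [0,1], because barriers leave that interval,
  and their width is 2 \<delta> so that a value of V within \<delta> of its limit may still be
  displaced by e \<le> \<delta>.\<close>

locale bistable_wave = drift_heat +
  fixes F V V' V'' :: "real \<Rightarrow> real" and L \<nu> \<delta> :: real
  assumes F_0: "F 0 = 0" and F_1: "F 1 = 0"
    and F_lipschitz: "\<bar>F x - F y\<bar> \<le> L * \<bar>x - y\<bar>"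
    and nu_pos: "0 < \<nu>" and delta_pos: "0 < \<delta>"
    and F_left: "x \<le> y \<Longrightarrow> y \<le> 2 * \<delta> \<Longrightarrow> F y - F x \<le> - \<nu> * (y - x)"
    and F_right: "x \<le> y \<Longrightarrow> 1 - 2 * \<delta> \<le> x \<Longrightarrow> F y - F x \<le> - \<nu> * (y - x)"
    and V_strict: "strict_mono V"
    and V_at_bot: "(V \<longlongrightarrow> 0) at_bot" and V_at_top: "(V \<longlongrightarrow> 1) at_top"
    and V_deriv: "(V has_real_derivative V' x) (at x)"
    and V'_deriv: "(V' has_real_derivative V'' x) (at x)"
    and V''_cont: "continuous_on UNIV V''"
    and V_ode: "\<sigma>\<^sup>2 / 2 * V'' x - \<mu> * V' x + F (V x) = 0"
begin

section \<open>Bounds, positivity and tails of the profile\<close>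

lemma L_nonneg: "0 \<le> L"
  using F_lipschitz[of 0 1] by (simp add: F_0 F_1)

lemma V_mono: "x \<le> y \<Longrightarrow> V x \<le> V y"
  using V_strict by (simp add: strict_mono_less_eq)

lemma V_pos: "0 < V x" and V_less_1: "V x < 1"
  using strict_mono_between_limits[OF V_strict V_at_bot V_at_top] by auto

lemma V_abs: "\<bar>V x\<bar> \<le> 1"
  using V_pos[of x] V_less_1[of x] by auto

lemma V'_nonneg: "0 \<le> V' x"
  using V_deriv
  by (rule mono_on_imp_deriv_nonneg[where A=UNIV, rotated]) (auto simp: mono_on_def V_mono)

lemma F_V_abs: "\<bar>F (V x)\<bar> \<le> L"
proof -
  have "\<bar>F (V x)\<bar> \<le> L * \<bar>V x\<bar>" using F_lipschitz[of "V x" 0] by (simp add: F_0)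
  also have "\<dots> \<le> L * 1" by (intro mult_left_mono V_abs L_nonneg)
  finally show ?thesis by simp
qed

lemma half_sigma_sq_pos: "0 < \<sigma>\<^sup>2 / 2"
  using sigma_pos by simp

text \<open>V increases by less than 1 in total, so every unit interval contains a point with slope
  below 1. From there the slope cannot grow much, because the flux \<sigma>^2/2 V' - \<mu> V has the
  bounded derivative - F (V).\<close>

lemma V'_bounded: "\<exists>C>0. \<forall>x. \<bar>V' x\<bar> \<le> C"
proof (intro exI conjI allI)
  define a where "a = \<sigma>\<^sup>2 / 2"
  have a: "0 < a" unfolding a_def by (rule half_sigma_sq_pos)
  show "0 < (a + \<bar>\<mu>\<bar> + L) / a" using a L_nonneg by (intro divide_pos_pos) auto
  fix x
  have "\<exists>z>x - 1. z < x \<and> V x - V (x - 1) = (x - (x - 1)) * V' z"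
    by (rule MVT2) (auto intro: V_deriv)
  then obtain z where z: "x - 1 < z" "z < x" and Vz: "V' z = V x - V (x - 1)" by auto
  define G where "G x = a * V' x - \<mu> * V x" for x
  have G: "(G has_real_derivative - F (V x)) (at x)" for x
  proof -
    have "a * V'' x - \<mu> * V' x = - F (V x)" using V_ode[of x] by (simp add: a_def)
    moreover have "(G has_real_derivative a * V'' x - \<mu> * V' x) (at x)"
      unfolding G_def by (intro DERIV_diff DERIV_cmult V_deriv V'_deriv)
    ultimately show ?thesis by simp
  qed
  have "\<exists>y>z. y < x \<and> G x - G z = (x - z) * - F (V y)"
    by (rule MVT2) (use z G in auto)
  then obtain y where "G x - G z = (x - z) * - F (V y)" by auto
  moreover have "(x - z) * - F (V y) \<le> 1 * L"
  proof -
    have "(x - z) * - F (V y) \<le> (x - z) * L" using F_V_abs[of y] z by (intro mult_left_mono) auto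
    also have "\<dots> \<le> 1 * L" using z L_nonneg by (intro mult_right_mono) auto
    finally show ?thesis .
  qed
  ultimately have 1: "G x \<le> G z + L" by simp
  have "V' z \<le> 1" using Vz V_pos[of "x - 1"] V_less_1[of x] by simp
  then have 2: "a * V' z \<le> a" using a by simp
  have "\<mu> * (V x - V z) \<le> \<bar>\<mu>\<bar> * \<bar>V x - V z\<bar>" by (metis abs_ge_self abs_mult)
  also have "\<dots> \<le> \<bar>\<mu>\<bar> * 1"
    using V_pos[of x] V_pos[of z] V_less_1[of x] V_less_1[of z] by (intro mult_left_mono) auto
  finally have "a * V' x \<le> a + \<bar>\<mu>\<bar> + L"
    using 1 2 by (simp add: G_def algebra_simps)
  then show "\<bar>V' x\<bar> \<le> (a + \<bar>\<mu>\<bar> + L) / a"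
    using V'_nonneg[of x] a by (simp add: field_simps)
qed

lemma V''_bounded: "\<exists>C>0. \<forall>x. \<bar>V'' x\<bar> \<le> C"
proof -
  define a where "a = \<sigma>\<^sup>2 / 2"
  have a: "0 < a" unfolding a_def by (rule half_sigma_sq_pos)
  obtain C where C: "C > 0" "\<And>x. \<bar>V' x\<bar> \<le> C" using V'_bounded by auto
  have "\<bar>V'' x\<bar> \<le> (\<bar>\<mu>\<bar> * C + L + 1) / a" for x
  proof -
    have "a * V'' x = \<mu> * V' x - F (V x)" using V_ode[of x] by (simp add: a_def)
    moreover have "\<bar>\<mu> * V' x\<bar> \<le> \<bar>\<mu>\<bar> * C" unfolding abs_mult using C by (intro mult_left_mono) auto
    ultimately have "\<bar>a * V'' x\<bar> \<le> \<bar>\<mu>\<bar> * C + L + 1" using F_V_abs[of x] by linarith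
    then show ?thesis using a by (simp add: abs_mult field_simps)
  qed
  moreover have "0 < (\<bar>\<mu>\<bar> * C + L + 1) / a"
    using a C L_nonneg by (intro divide_pos_pos add_nonneg_pos add_nonneg_nonneg) auto
  ultimately show ?thesis by blast
qed

lemma V_lipschitz:
  assumes "\<And>x. \<bar>V' x\<bar> \<le> C"
  shows "\<bar>V x - V y\<bar> \<le> C * \<bar>x - y\<bar>"
proof -
  have "norm (V x - V y) \<le> C * norm (x - y)"
    by (rule field_differentiable_bound[where S=UNIV and f'=V'])
       (use assms V_deriv in \<open>auto intro: has_field_derivative_at_within\<close>)
  then show ?thesis by simp
qed

lemma V_diff_le:
  assumes "x \<le> y" "\<And>z. x \<le> z \<Longrightarrow> z \<le> y \<Longrightarrow> V' z \<le> C"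
  shows "V y - V x \<le> C * (y - x)"
proof (cases "x = y")
  case False
  with assms have "x < y" by simp
  then have "\<exists>z>x. z < y \<and> V y - V x = (y - x) * V' z" by (rule MVT2) (auto intro: V_deriv)
  then obtain z where "x < z" "z < y" "V y - V x = (y - x) * V' z" by auto
  then show ?thesis using assms(2)[of z] \<open>x < y\<close> by (simp add: mult.commute)
qed simp

lemma V_diff_ge:
  assumes "x \<le> y" "\<And>z. x \<le> z \<Longrightarrow> z \<le> y \<Longrightarrow> C \<le> V' z"
  shows "C * (y - x) \<le> V y - V x"
proof (cases "x = y")
  case False
  with assms have "x < y" by simp
  then have "\<exists>z>x. z < y \<and> V y - V x = (y - x) * V' z" by (rule MVT2) (auto intro: V_deriv)
  then obtain z where "x < z" "z < y" "V y - V x = (y - x) * V' z" by auto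
  then show ?thesis using assms(2)[of z] \<open>x < y\<close> by (simp add: mult.commute)
qed simp

text \<open>A zero of V' is a minimum of V', so V'' and hence F (V) vanish there as well. The
  constant V x then solves the same second-order equation with the same data, and uniqueness would
  make V constant to the right of x.\<close>

lemma V'_pos: "0 < V' x"
proof (rule ccontr)
  assume "\<not> 0 < V' x"
  then have V'0: "V' x = 0" using V'_nonneg[of x] by simp
  have "V'' x = 0"
    by (rule DERIV_local_min[OF V'_deriv, of 1]) (auto simp: V'0 V'_nonneg)
  then have Fp: "F (V x) = 0" using V_ode[of x] V'0 by simp
  define a where "a = \<sigma>\<^sup>2 / 2"
  have a: "0 < a" unfolding a_def by (rule half_sigma_sq_pos)
  define p where "p = V x"
  \<comment> \<open>Uniqueness by Gronwall: squared phase-space distance to the equilibrium (p, 0),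
    which vanishes at x and satisfies E' \<le> C E.\<close>
  define E where "E y = (V y - p)\<^sup>2 + (V' y)\<^sup>2" for y
  define E' where "E' y = 2 * (V y - p) * V' y + 2 * V' y * V'' y" for y
  define C where "C = 1 + 2 * \<bar>\<mu>\<bar> / a + L / a"
  have E: "(E has_real_derivative E' y) (at y)" for y
    unfolding E_def E'_def
    by (rule derivative_eq_intros V_deriv V'_deriv refl | simp)+
  have E'_le: "E' y \<le> C * E y" for y
  proof -
    have 1: "2 * (u * v) \<le> u\<^sup>2 + v\<^sup>2" for u v :: real using sum_squares_bound[of u v] by simp
    have V''_eq: "V'' y = (\<mu> / a) * V' y - F (V y) / a" using V_ode[of y] a by (simp add: a_def[symmetric] field_simps)
    have "2 * V' y * V'' y = 2 * (\<mu> / a) * (V' y)\<^sup>2 + 2 * V' y * (- F (V y) / a)"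
      by (subst V''_eq) (simp add: power2_eq_square algebra_simps)
    also have "2 * (\<mu> / a) * (V' y)\<^sup>2 \<le> 2 * (\<bar>\<mu>\<bar> / a) * (V' y)\<^sup>2"
      using a by (intro mult_right_mono mult_left_mono divide_right_mono) auto
    also have "2 * V' y * (- F (V y) / a) \<le> L / a * E y"
    proof -
      have "- F (V y) \<le> L * \<bar>V y - p\<bar>" using F_lipschitz[of "V y" p] Fp by (simp add: p_def)
      then have "V' y * - F (V y) \<le> V' y * (L * \<bar>V y - p\<bar>)" by (intro mult_left_mono V'_nonneg)
      then have "2 * V' y * - F (V y) \<le> L * (2 * (V' y * \<bar>V y - p\<bar>))" by (simp add: mult_ac)
      also have "\<dots> \<le> L * ((V' y)\<^sup>2 + \<bar>V y - p\<bar>\<^sup>2)" by (intro mult_left_mono 1 L_nonneg)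
      also have "\<dots> = L * E y" by (simp add: E_def)
      finally have "2 * V' y * - F (V y) / a \<le> L * E y / a" using a by (intro divide_right_mono) auto
      then show ?thesis by simp
    qed
    finally have "2 * V' y * V'' y \<le> 2 * \<bar>\<mu>\<bar> / a * (V' y)\<^sup>2 + L / a * E y" by simp
    moreover have "2 * \<bar>\<mu>\<bar> / a * (V' y)\<^sup>2 \<le> 2 * \<bar>\<mu>\<bar> / a * E y"
      using a by (intro mult_left_mono) (auto simp: E_def)
    moreover have "2 * (V y - p) * V' y \<le> E y" using 1[of "V y - p" "V' y"] by (simp only: E_def mult.assoc)
    ultimately show ?thesis unfolding E'_def C_def by (simp only: distrib_right)
  qed
  have "exp (- C * (x + 1)) * E (x + 1) \<le> exp (- C * x) * E x"
  proof (rule DERIV_nonpos_imp_nonincreasing[where f="\<lambda>y. exp (- C * y) * E y" and a=x and b="x + 1"])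
    fix y
    have "((\<lambda>y. exp (- C * y) * E y) has_real_derivative exp (- C * y) * (E' y - C * E y)) (at y)"
      by (rule derivative_eq_intros E refl | simp)+ (simp add: algebra_simps)
    moreover have "exp (- C * y) * (E' y - C * E y) \<le> 0"
      using E'_le[of y] by (intro mult_nonneg_nonpos) auto
    ultimately show "\<exists>D. ((\<lambda>y. exp (- C * y) * E y) has_real_derivative D) (at y) \<and> D \<le> 0" by blast
  qed simp
  also have "E x = 0" by (simp add: E_def p_def V'0)
  finally have "E (x + 1) \<le> 0" by (simp add: mult_le_0_iff)
  then have "(V (x + 1) - p)\<^sup>2 = 0"
    unfolding E_def using zero_le_power2[of "V (x + 1) - p"] zero_le_power2[of "V' (x + 1)"] by linarith
  moreover have "V x < V (x + 1)" using V_strict by (simp add: strict_mono_less)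
  ultimately show False by (simp add: p_def)
qed

lemma V'_cont: "continuous_on A V'"
  using V'_deriv by (intro DERIV_continuous_on) (auto intro: has_field_derivative_at_within)

lemma V'_lower_bound: "\<exists>p>0. \<forall>x\<in>{a..b}. p \<le> V' x"
proof (cases "a \<le> b")
  case True
  then obtain x where "\<forall>y\<in>{a..b}. V' x \<le> V' y"
    using continuous_attains_inf[OF compact_Icc _ V'_cont, of a b] by auto
  then show ?thesis using V'_pos[of x] by blast
qed (auto intro: exI[of _ 1])

lemma V_tails:
  assumes "0 < \<theta>"
  shows "\<exists>R>0. (\<forall>x\<le>-R. V x < \<theta>) \<and> (\<forall>x\<ge>R. 1 - \<theta> < V x)"
proof -
  have "\<forall>\<^sub>F x in at_bot. V x < \<theta>" using order_tendstoD(2)[OF V_at_bot assms] .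
  then obtain A where A: "\<And>x. x \<le> A \<Longrightarrow> V x < \<theta>" by (auto simp: eventually_at_bot_linorder)
  have "\<forall>\<^sub>F x in at_top. 1 - \<theta> < V x" using order_tendstoD(1)[OF V_at_top, of "1 - \<theta>"] assms by simp
  then obtain B where B: "\<And>x. x \<ge> B \<Longrightarrow> 1 - \<theta> < V x" by (auto simp: eventually_at_top_linorder)
  show ?thesis by (rule exI[of _ "1 + \<bar>A\<bar> + \<bar>B\<bar>"]) (auto intro!: A B)
qed

text \<open>Far out, V increases very little over an interval of length \<open>r\<close>, so its
  slope is at most \<theta>/2 at some point. Since V'' is bounded by \<open>C\<close>, the slope
  varies by at most C r = \<theta>/2 over that interval.\<close>

lemma V'_tails:
  assumes "0 < \<theta>"
  shows "\<exists>R>0. \<forall>x. R \<le> \<bar>x\<bar> \<longrightarrow> V' x \<le> \<theta>"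
proof -
  obtain C where C: "C > 0" "\<And>x. \<bar>V'' x\<bar> \<le> C" using V''_bounded by auto
  define r where "r = \<theta> / (2 * C)"
  have r: "0 < r" using assms C by (simp add: r_def)
  have rC: "C * r = \<theta> / 2" using C by (simp add: r_def)
  obtain R where R: "R > 0" "\<And>x. x \<le> - R \<Longrightarrow> V x < r * \<theta> / 2" "\<And>x. x \<ge> R \<Longrightarrow> 1 - r * \<theta> / 2 < V x"
    using V_tails[of "r * \<theta> / 2"] r assms by auto
  have near: "V' x \<le> V' z + \<theta> / 2" if "\<bar>x - z\<bar> \<le> r" for x z
  proof -
    have "norm (V' x - V' z) \<le> C * norm (x - z)"
      by (rule field_differentiable_bound[where S=UNIV and f'=V''])
         (use C V'_deriv in \<open>auto intro: has_field_derivative_at_within\<close>)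
    also have "\<dots> \<le> C * r" using that C by (intro mult_left_mono) auto
    finally show ?thesis using rC unfolding real_norm_def by linarith
  qed
  have bound: "V' x \<le> \<theta>" if x: "y \<le> x" "x \<le> y + r" and d: "V (y + r) - V y \<le> r * \<theta> / 2" for x y
  proof -
    have "\<exists>z>y. z < y + r \<and> V (y + r) - V y = (y + r - y) * V' z"
      by (rule MVT2) (use r V_deriv in auto)
    then obtain z where z: "y < z" "z < y + r" and "V (y + r) - V y = r * V' z" by auto
    with d have "r * V' z \<le> r * (\<theta> / 2)" by simp
    then have "V' z \<le> \<theta> / 2" using r by (simp only: mult_le_cancel_left_pos)
    moreover have "\<bar>x - z\<bar> \<le> r" using x z by auto
    ultimately show ?thesis using near by fastforce
  qed
  show ?thesis
  proof (intro exI conjI allI impI)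
    show "0 < R" by (rule R(1))
    fix x assume "R \<le> \<bar>x\<bar>"
    then consider "R \<le> x" | "x \<le> - R" by linarith
    then show "V' x \<le> \<theta>"
    proof cases
      case 1
      then show ?thesis using bound[of x x] r R(3)[of x] V_less_1[of "x + r"] by simp
    next
      case 2
      then show ?thesis using bound[of "x - r" x] r R(2)[of x] V_pos[of "x - r"] by simp
    qed
  qed
qed

text \<open>These are the conditions for a super- and a subsolution once the wave equation has been
  subtracted. In the tails F decreases with rate \<nu>, which suffices by itself. On the compact
  rest F may increase, but there V' is at least p > 0, and moving the profile with velocity K \<nu>
  e compensates.\<close>

lemma barrier_residual:
  "\<exists>K>0. \<forall>x e. 0 \<le> e \<longrightarrow> e \<le> \<delta> \<longrightarrow>
     F (V x + e) - F (V x) \<le> V' x * (K * \<nu> * e) - \<nu> * e \<and>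
     F (V x) - F (V x - e) \<le> V' x * (K * \<nu> * e) - \<nu> * e"
proof -
  obtain R where R: "R > 0" "\<And>x. x \<le> - R \<Longrightarrow> V x < \<delta>" "\<And>x. x \<ge> R \<Longrightarrow> 1 - \<delta> < V x"
    using V_tails[OF delta_pos] by auto
  obtain p where p: "p > 0" "\<And>x. x \<in> {-R..R} \<Longrightarrow> p \<le> V' x" using V'_lower_bound[of "-R" R] by auto
  \<comment> \<open>Makes p K \<nu> = L + \<nu>: the motion pays for the largest increase L e of F
    and for the decay \<nu> e.\<close>
  define K where "K = (L + \<nu>) / (p * \<nu>)"
  have K: "K > 0" using p nu_pos L_nonneg by (simp add: K_def add_nonneg_pos)
  have pK: "p * (K * \<nu>) = L + \<nu>" using p nu_pos by (simp add: K_def)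
  show ?thesis
  proof (intro exI[of _ K] conjI allI impI K)
    fix x e assume e: "0 \<le> e" "e \<le> \<delta>"
    have nn: "0 \<le> V' x * (K * \<nu> * e)" using V'_nonneg K nu_pos e by simp
    have mid: "L * e \<le> V' x * (K * \<nu> * e) - \<nu> * e" if "x \<in> {-R..R}"
    proof -
      have "p * (K * \<nu> * e) \<le> V' x * (K * \<nu> * e)"
        using p(2)[OF that] K nu_pos e by (intro mult_right_mono) auto
      moreover have "p * (K * \<nu> * e) = (L + \<nu>) * e" using pK by (metis mult.assoc)
      ultimately show ?thesis by (simp add: algebra_simps)
    qed
    consider "x \<in> {-R..R}" | "x \<le> - R" | "R \<le> x" by fastforce
    note cases = this
    show "F (V x + e) - F (V x) \<le> V' x * (K * \<nu> * e) - \<nu> * e"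
      using cases
    proof cases
      case 1 with mid F_lipschitz[of "V x + e" "V x"] e show ?thesis by simp
    next
      case 2 with F_left[of "V x" "V x + e"] R(2)[of x] e nn show ?thesis by simp
    next
      case 3 with F_right[of "V x" "V x + e"] R(3)[of x] e nn delta_pos show ?thesis by simp
    qed
    show "F (V x) - F (V x - e) \<le> V' x * (K * \<nu> * e) - \<nu> * e"
      using cases
    proof cases
      case 1 with mid F_lipschitz[of "V x" "V x - e"] e show ?thesis by simp
    next
      case 2 with F_left[of "V x - e" "V x"] R(2)[of x] e nn delta_pos show ?thesis by simp
    next
      case 3 with F_right[of "V x - e" "V x"] R(3)[of x] e nn show ?thesis by simp
    qed
  qed
qed

abbreviation solution :: "(real \<Rightarrow> real \<Rightarrow> real) \<Rightarrow> bool" where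
  "solution w \<equiv> duhamel w (\<lambda>t y. F (w t y))"

text \<open>The wave equation eliminates V'' from the source of a moving profile. \<open>A\<close>
  and \<open>e\<close> may have either sign, so one formula yields the supersolutions and, with both
  negated, the subsolutions.\<close>

lemma duhamel_wave_profile:
  "duhamel (\<lambda>t y. V (y + (b + A * (1 - exp (- \<nu> * max 0 t)))) + e * exp (- \<nu> * max 0 t))
     (\<lambda>t y. V' (y + (b + A * (1 - exp (- \<nu> * max 0 t)))) * (A * \<nu> * exp (- \<nu> * max 0 t))
        - \<nu> * (e * exp (- \<nu> * max 0 t)) + F (V (y + (b + A * (1 - exp (- \<nu> * max 0 t))))))"
    (is "duhamel ?v ?h")
proof -
  obtain C where C: "\<And>x. \<bar>V' x\<bar> \<le> C" using V'_bounded by auto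
  obtain C2 where C2: "\<And>x. \<bar>V'' x\<bar> \<le> C2" using V''_bounded by auto
  have le1: "exp (- \<nu> * s) \<le> 1" if "0 \<le> s" for s using that nu_pos by simp
  have "duhamel ?v (\<lambda>t y. V' (y + (b + A * (1 - exp (- \<nu> * max 0 t)))) * (A * \<nu> * exp (- \<nu> * max 0 t) + \<mu>)
      + (- \<nu> * (e * exp (- \<nu> * max 0 t))) - \<sigma>\<^sup>2 / 2 * V'' (y + (b + A * (1 - exp (- \<nu> * max 0 t)))))"
  proof (rule duhamel_moving_profile[where \<xi>="\<lambda>s. b + A * (1 - exp (- \<nu> * s))" and q="\<lambda>s. e * exp (- \<nu> * s)" and
       X="\<bar>A\<bar> * \<nu>" and Q="\<bar>e\<bar>" and Q'="\<nu> * \<bar>e\<bar>"])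
    show "((\<lambda>s. b + A * (1 - exp (- \<nu> * s))) has_real_derivative A * \<nu> * exp (- \<nu> * s)) (at s)" for s
      by (rule derivative_eq_intros refl | simp)+
    show "((\<lambda>s. e * exp (- \<nu> * s)) has_real_derivative - \<nu> * (e * exp (- \<nu> * s))) (at s)" for s
      by (rule derivative_eq_intros refl | simp)+
    show "\<bar>A * \<nu> * exp (- \<nu> * s)\<bar> \<le> \<bar>A\<bar> * \<nu>" if "0 \<le> s" for s
      using mult_left_mono[OF le1[OF that], of "\<bar>A\<bar> * \<nu>"] nu_pos by (simp add: abs_mult)
    show "\<bar>e * exp (- \<nu> * s)\<bar> \<le> \<bar>e\<bar>" if "0 \<le> s" for s
      using mult_left_mono[OF le1[OF that], of "\<bar>e\<bar>"] by (simp add: abs_mult)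
    show "\<bar>- \<nu> * (e * exp (- \<nu> * s))\<bar> \<le> \<nu> * \<bar>e\<bar>" if "0 \<le> s" for s
      using mult_left_mono[OF le1[OF that], of "\<nu> * \<bar>e\<bar>"] nu_pos by (simp add: abs_mult)
  qed (auto intro!: continuous_intros V_deriv V'_deriv V''_cont V_abs C C2)
  moreover have "V' z * (x + \<mu>) + (- u) - \<sigma>\<^sup>2 / 2 * V'' z = V' z * x - u + F (V z)" for x u z
    using V_ode[of z] by (simp add: algebra_simps)
  ultimately show ?thesis by (simp only: mult_minus_left)
qed

text \<open>A single \<open>K\<close> serves all solutions, shifts and heights up to
  \<open>\<delta>\<close>. The term with \<open>S t\<close> keeps the quantitative gap of the
  comparison principle; without it the barriers could never be moved inwards.\<close>

definition barrier_const :: "real \<Rightarrow> bool" where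
  "barrier_const K \<longleftrightarrow> K > 0 \<and> (\<forall>w b e t z. solution w \<longrightarrow> 0 \<le> e \<longrightarrow> e \<le> \<delta> \<longrightarrow> 0 \<le> t \<longrightarrow>
    ((\<forall>y. w 0 y \<le> V (y + b) + e) \<longrightarrow>
      w t z + exp (- L * t) * S t (\<lambda>y. V (y + b) + e - w 0 y) z
        \<le> V (z + (b + K * e * (1 - exp (- \<nu> * t)))) + e * exp (- \<nu> * t)) \<and>
    ((\<forall>y. V (y + b) - e \<le> w 0 y) \<longrightarrow>
      V (z + (b - K * e * (1 - exp (- \<nu> * t)))) - e * exp (- \<nu> * t)
        + exp (- L * t) * S t (\<lambda>y. w 0 y - (V (y + b) - e)) z \<le> w t z))"

text \<open>By the residual estimate, taken at the current height e exp (- \<nu> s), the source of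
  the upper barrier dominates F at the barrier. What is left in the difference is F (barrier) - F
  (w), which the Lipschitz constant bounds as the comparison requires. The lower barrier is
  symmetric.\<close>

lemma ex_barrier_const: "\<exists>K. barrier_const K"
proof -
  obtain K where K: "K > 0" and
    res: "\<And>x e. 0 \<le> e \<Longrightarrow> e \<le> \<delta> \<Longrightarrow> F (V x + e) - F (V x) \<le> V' x * (K * \<nu> * e) - \<nu> * e"
      "\<And>x e. 0 \<le> e \<Longrightarrow> e \<le> \<delta> \<Longrightarrow> F (V x) - F (V x - e) \<le> V' x * (K * \<nu> * e) - \<nu> * e"
    using barrier_residual by blast
  have lip: "F x - F y \<le> L * \<bar>x - y\<bar>" for x y
    using F_lipschitz[of x y] by simp
  show ?thesis
    unfolding barrier_const_def
  proof (intro exI[of _ K] conjI[OF K] allI impI conjI)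
    fix w b e t z
    assume w: "solution w" and e: "0 \<le> e" "e \<le> \<delta>" and t: "(0::real) \<le> t"
    define r where "r s = exp (- \<nu> * max 0 s)" for s
    have r: "0 \<le> e * r s" "e * r s \<le> \<delta>" for s
    proof -
      show "0 \<le> e * r s" using e by (simp add: r_def)
      have "e * r s \<le> e * 1" using e nu_pos by (intro mult_left_mono) (auto simp: r_def)
      then show "e * r s \<le> \<delta>" using e by simp
    qed
    have rt: "r t = exp (- \<nu> * t)" and r0: "r 0 = 1" using t by (simp_all add: r_def)
    {
      assume le: "\<forall>y. w 0 y \<le> V (y + b) + e"
      define x where "x s y = y + (b + K * e * (1 - r s))" for s y
      have v: "duhamel (\<lambda>s y. V (x s y) + e * r s)
         (\<lambda>s y. V' (x s y) * (K * e * \<nu> * r s) - \<nu> * (e * r s) + F (V (x s y)))"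
        using duhamel_wave_profile[of b "K * e" e] by (simp only: x_def r_def)
      have "exp (- L * t) * S t (\<lambda>y. V (x 0 y) + e * r 0 - w 0 y) z \<le> V (x t z) + e * r t - w t z"
      proof (rule duhamel_comparison[OF duhamel_diff[OF v w] L_nonneg _ _ t])
        fix s y :: real
        have "F (V (x s y) + e * r s) - F (V (x s y)) \<le> V' (x s y) * (K * e * \<nu> * r s) - \<nu> * (e * r s)"
          using res(1)[OF r[of s], of "x s y"] by (simp add: mult_ac)
        then show "- L * \<bar>V (x s y) + e * r s - w s y\<bar> \<le>
            V' (x s y) * (K * e * \<nu> * r s) - \<nu> * (e * r s) + F (V (x s y)) - F (w s y)"
          using lip[of "w s y" "V (x s y) + e * r s"] by (simp add: abs_minus_commute)
      next
        show "0 \<le> V (x 0 y) + e * r 0 - w 0 y" for y using le by (simp add: x_def r0)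
      qed
      then show "w t z + exp (- L * t) * S t (\<lambda>y. V (y + b) + e - w 0 y) z
        \<le> V (z + (b + K * e * (1 - exp (- \<nu> * t)))) + e * exp (- \<nu> * t)"
        by (simp add: x_def r0 rt)
    }
    {
      assume le: "\<forall>y. V (y + b) - e \<le> w 0 y"
      define x where "x s y = y + (b + (- (K * e)) * (1 - r s))" for s y
      have v: "duhamel (\<lambda>s y. V (x s y) + (- e) * r s)
         (\<lambda>s y. V' (x s y) * ((- (K * e)) * \<nu> * r s) - \<nu> * ((- e) * r s) + F (V (x s y)))"
        using duhamel_wave_profile[of b "- (K * e)" "- e"] by (simp only: x_def r_def)
      have "exp (- L * t) * S t (\<lambda>y. w 0 y - (V (x 0 y) + (- e) * r 0)) z \<le> w t z - (V (x t z) + (- e) * r t)"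
      proof (rule duhamel_comparison[OF duhamel_diff[OF w v] L_nonneg _ _ t])
        fix s y :: real
        have "F (V (x s y)) - F (V (x s y) - e * r s) \<le> V' (x s y) * (K * e * \<nu> * r s) - \<nu> * (e * r s)"
          using res(2)[OF r[of s], of "x s y"] by (simp add: mult_ac)
        moreover have "F (V (x s y) - e * r s) - F (w s y) \<le> L * \<bar>w s y - (V (x s y) + (- e) * r s)\<bar>"
          using lip[of "V (x s y) - e * r s" "w s y"] by (simp add: abs_minus_commute)
        ultimately show "- L * \<bar>w s y - (V (x s y) + (- e) * r s)\<bar> \<le>
            F (w s y) - (V' (x s y) * ((- (K * e)) * \<nu> * r s) - \<nu> * ((- e) * r s) + F (V (x s y)))"
          by simp
      next
        show "0 \<le> w 0 y - (V (x 0 y) + (- e) * r 0)" for y using le by (simp add: x_def r0)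
      qed
      then show "V (z + (b - K * e * (1 - exp (- \<nu> * t)))) - e * exp (- \<nu> * t)
        + exp (- L * t) * S t (\<lambda>y. w 0 y - (V (y + b) - e)) z \<le> w t z"
        by (simp add: x_def r0 rt)
    }
  qed
qed

end

section \<open>Squeezing\<close>

text \<open>With D = C / (1 - \<rho>) one has D = C + D \<rho>, so adding or subtracting D \<rho>^n
  makes the sequence decreasing or increasing, and the two meet in the limit.\<close>

lemma geometric_limit_bound:
  fixes x :: "nat \<Rightarrow> real"
  assumes step: "\<And>n. \<bar>x (Suc n) - x n\<bar> \<le> C * \<rho> ^ n" and \<rho>: "0 < \<rho>" "\<rho> < 1"
  shows "\<exists>l. \<forall>n. \<bar>x n - l\<bar> \<le> C / (1 - \<rho>) * \<rho> ^ n"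
proof -
  define D where "D = C / (1 - \<rho>)"
  have D: "D * \<rho> ^ n = C * \<rho> ^ n + D * \<rho> ^ Suc n" for n
    using \<rho> by (simp add: D_def field_simps)
  have C: "0 \<le> C" using step[of 0] by simp
  have D0: "0 \<le> D" using C \<rho> by (simp add: D_def)
  have "\<exists>l. ((\<forall>n. x n - D * \<rho> ^ n \<le> l) \<and> (\<lambda>n. x n - D * \<rho> ^ n) \<longlonglongrightarrow> l) \<and>
      ((\<forall>n. l \<le> x n + D * \<rho> ^ n) \<and> (\<lambda>n. x n + D * \<rho> ^ n) \<longlonglongrightarrow> l)"
  proof (rule nested_sequence_unique)
    show "\<forall>n. x n - D * \<rho> ^ n \<le> x (Suc n) - D * \<rho> ^ Suc n"
      using step D by (smt (verit))
    show "\<forall>n. x (Suc n) + D * \<rho> ^ Suc n \<le> x n + D * \<rho> ^ n"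
      using step D by (smt (verit))
    show "\<forall>n. x n - D * \<rho> ^ n \<le> x n + D * \<rho> ^ n" using D0 \<rho> by simp
    have "(\<lambda>n. - 2 * D * \<rho> ^ n) \<longlonglongrightarrow> 0"
      using \<rho> by (intro tendsto_mult_right_zero LIMSEQ_power_zero) auto
    then show "(\<lambda>n. x n - D * \<rho> ^ n - (x n + D * \<rho> ^ n)) \<longlonglongrightarrow> 0" by (simp add: mult_ac)
  qed
  then obtain l where "\<And>n. x n - D * \<rho> ^ n \<le> l" "\<And>n. l \<le> x n + D * \<rho> ^ n" by blast
  then have "\<bar>x n - l\<bar> \<le> D * \<rho> ^ n" for n by (smt (verit))
  then show ?thesis unfolding D_def by blast
qed

context drift_heat
begin

text \<open>Within distance \<open>R\<close> of its centre the Gaussian kernel at time 1 is at least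
  its value at that distance. Only the integral of \<open>g\<close> enters, so information in the
  mean becomes pointwise, whatever the regularity of \<open>g\<close>.\<close>

lemma S_1_lower_bound:
  assumes g: "bounded_borel g" and g0: "\<And>x. 0 \<le> g x"
    and R: "\<And>z. z \<in> {a..b} \<Longrightarrow> \<bar>z - (y - \<mu>)\<bar> \<le> R"
  shows "normal_density 0 \<sigma> R * (LBINT z:{a..b}. g z) \<le> S 1 g y"
proof -
  note [measurable] = bounded_borelD[OF g]
  from g obtain B where B: "\<And>x. \<bar>g x\<bar> \<le> B" by (auto simp: bounded_borel_def)
  have i1: "integrable lborel (\<lambda>z. normal_density (y - \<mu>) \<sigma> z * g z)"
  proof (rule Bochner_Integration.integrable_bound)
    show "integrable lborel (\<lambda>z. B * normal_density (y - \<mu>) \<sigma> z)"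
      using sigma_pos by (intro integrable_mult_right integrable_normal_density)
    show "AE z in lborel. norm (normal_density (y - \<mu>) \<sigma> z * g z) \<le> norm (B * normal_density (y - \<mu>) \<sigma> z)"
    proof (rule AE_I2)
      fix z
      have "normal_density (y - \<mu>) \<sigma> z * \<bar>g z\<bar> \<le> normal_density (y - \<mu>) \<sigma> z * \<bar>B\<bar>"
        using B[of z] by (intro mult_left_mono) auto
      then show "norm (normal_density (y - \<mu>) \<sigma> z * g z) \<le> norm (B * normal_density (y - \<mu>) \<sigma> z)"
        by (simp add: abs_mult mult.commute)
    qed
  qed measurable
  have i2: "set_integrable lborel {a..b} g"
    by (subst set_integrable_def, rule integrableI_bounded_set_indicator[where B=B]) (use B in \<open>auto simp: emeasure_lborel_Icc_eq\<close>)
  have "normal_density 0 \<sigma> R * (LBINT z:{a..b}. g z) =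
      (\<integral>z. normal_density 0 \<sigma> R * (indicator {a..b} z * g z) \<partial>lborel)"
    by (simp add: set_lebesgue_integral_def)
  also have "\<dots> \<le> (\<integral>z. normal_density (y - \<mu>) \<sigma> z * g z \<partial>lborel)"
  proof (rule integral_mono[OF _ i1])
    show "integrable lborel (\<lambda>z. normal_density 0 \<sigma> R * (indicator {a..b} z * g z))"
      using i2 by (simp add: set_integrable_def)
    fix z
    show "normal_density 0 \<sigma> R * (indicator {a..b} z * g z) \<le> normal_density (y - \<mu>) \<sigma> z * g z"
    proof (cases "z \<in> {a..b}")
      case True
      have "(z - (y - \<mu>))\<^sup>2 \<le> R\<^sup>2" using R[OF True] by (rule sqrt_le_D[OF order_trans[OF eq_refl[OF real_sqrt_abs]]])
      then have "normal_density 0 \<sigma> R \<le> normal_density (y - \<mu>) \<sigma> z"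
        unfolding normal_density_def using sigma_pos
        by (intro mult_left_mono) (auto simp: divide_right_mono)
      with True show ?thesis using g0 by (simp add: mult_right_mono)
    qed (simp add: g0)
  qed
  also have "\<dots> = S 1 g y"
    using S_eq_heat_semigroup[of g 1 y] by (simp add: heat_semigroup_def)
  finally show ?thesis .
qed

end

context bistable_wave
begin

text \<open>The bound e \<le> \<delta> belongs to the notion because barriers exist only up to that
  height, so each iteration step has to restore it; a \<le> b makes b - a usable as a nonnegative
  measure of progress.\<close>

definition trapped :: "(real \<Rightarrow> real) \<Rightarrow> real \<Rightarrow> real \<Rightarrow> real \<Rightarrow> bool" where
  "trapped g a b e \<longleftrightarrow> a \<le> b \<and> 0 \<le> e \<and> e \<le> \<delta> \<and> (\<forall>z. V (z + a) - e \<le> g z \<and> g z \<le> V (z + b) + e)"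

lemma barrier_evolution:
  assumes K: "barrier_const K" and w: "solution w" and tr: "trapped (w 0) a b e" and t: "0 \<le> t"
  shows "w t z + exp (- L * t) * S t (\<lambda>y. V (y + b) + e - w 0 y) z \<le> V (z + b + K * e) + e * exp (- \<nu> * t)"
    and "V (z + a - K * e) - e * exp (- \<nu> * t) + exp (- L * t) * S t (\<lambda>y. w 0 y - (V (y + a) - e)) z \<le> w t z"
proof -
  have K0: "0 < K" using K by (simp add: barrier_const_def)
  have e: "0 \<le> e" "e \<le> \<delta>" using tr by (auto simp: trapped_def)
  have "K * e * (1 - exp (- \<nu> * t)) \<le> K * e * 1" using K0 e by (intro mult_left_mono) auto
  then have le: "V (z + (b + K * e * (1 - exp (- \<nu> * t)))) \<le> V (z + b + K * e)"
      "V (z + a - K * e) \<le> V (z + (a - K * e * (1 - exp (- \<nu> * t))))"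
    by (auto intro!: V_mono)
  have "w t z + exp (- L * t) * S t (\<lambda>y. V (y + b) + e - w 0 y) z
        \<le> V (z + (b + K * e * (1 - exp (- \<nu> * t)))) + e * exp (- \<nu> * t)"
    using K w e t tr unfolding barrier_const_def trapped_def by blast
  with le(1) show "w t z + exp (- L * t) * S t (\<lambda>y. V (y + b) + e - w 0 y) z \<le> V (z + b + K * e) + e * exp (- \<nu> * t)"
    by linarith
  have "V (z + (a - K * e * (1 - exp (- \<nu> * t)))) - e * exp (- \<nu> * t)
        + exp (- L * t) * S t (\<lambda>y. w 0 y - (V (y + a) - e)) z \<le> w t z"
    using K w e t tr unfolding barrier_const_def trapped_def by blast
  with le(2) show "V (z + a - K * e) - e * exp (- \<nu> * t) + exp (- L * t) * S t (\<lambda>y. w 0 y - (V (y + a) - e)) z \<le> w t z"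
    by linarith
qed

lemma barrier_evolution_weak:
  assumes K: "barrier_const K" and w: "solution w" and tr: "trapped (w 0) a b e" and t: "0 \<le> t"
  shows "w t z \<le> V (z + b + K * e) + e * exp (- \<nu> * t)"
    and "V (z + a - K * e) - e * exp (- \<nu> * t) \<le> w t z"
proof -
  have "0 \<le> exp (- L * t) * S t (\<lambda>y. V (y + b) + e - w 0 y) z"
    "0 \<le> exp (- L * t) * S t (\<lambda>y. w 0 y - (V (y + a) - e)) z"
    using tr by (auto simp: trapped_def algebra_simps intro!: mult_nonneg_nonneg S_nonneg)
  with barrier_evolution[OF K w tr t, of z]
  show "w t z \<le> V (z + b + K * e) + e * exp (- \<nu> * t)"
    "V (z + a - K * e) - e * exp (- \<nu> * t) \<le> w t z" by linarith+
qed

text \<open>All estimates are made relative to the position -a of the lower barrier, so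
  \<open>\<epsilon>0\<close> depends on \<open>K\<close>, \<open>H\<close> and
  \<open>\<theta>\<close> but not on \<open>a\<close>, \<open>b\<close> or \<open>w\<close>. Every
  smaller \<open>\<epsilon>\<close> is allowed as well, since the condition that the new height stay
  below \<open>\<delta>\<close> may force a smaller one. Only one barrier gains \<epsilon> h, while
  both may lose K e.\<close>

lemma squeeze:
  assumes K: "barrier_const K" and H: "0 < H" and \<theta>: "0 < \<theta>"
  shows "\<exists>\<epsilon>0>0. \<epsilon>0 \<le> 1 \<and> (\<forall>\<epsilon> w a b e. 0 < \<epsilon> \<longrightarrow> \<epsilon> \<le> \<epsilon>0 \<longrightarrow> solution w \<longrightarrow> trapped (w 0) a b e \<longrightarrow>
    b - a \<le> H \<longrightarrow> e * exp (- \<nu>) + \<theta> * (\<epsilon> * (b - a)) \<le> \<delta> \<longrightarrow>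
    (\<exists>a' b'. trapped (w 1) a' b' (e * exp (- \<nu>) + \<theta> * (\<epsilon> * (b - a))) \<and>
       b' - a' = (1 - \<epsilon>) * (b - a) + 2 * K * e \<and> \<bar>a' - a\<bar> \<le> K * e + \<epsilon> * (b - a)))"
proof -
  have K0: "0 < K" using K by (simp add: barrier_const_def)
  obtain C where C: "C > 0" "\<And>x. \<bar>V' x\<bar> \<le> C" using V'_bounded by auto
  have C': "V' x \<le> C" for x using C(2)[of x] by linarith
  obtain M0 where M0: "\<And>x. M0 \<le> \<bar>x\<bar> \<Longrightarrow> V' x \<le> \<theta>" using V'_tails[OF \<theta>] by auto
  \<comment> \<open>For z in [-a, 1 - a] all points between z + a and z + b lie in [0, 1 + H], so
    the two profiles are at least p h apart there.\<close>
  obtain p where p: "p > 0" "\<And>x. x \<in> {0..1 + H} \<Longrightarrow> p \<le> V' x" using V'_lower_bound[of 0 "1 + H"] by auto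
  \<comment> \<open>If \<bar>z + a\<bar> > M, then every argument met while moving either barrier
    differs from z + a by at most K \<delta> + H, hence stays where V' \<le> \<theta>.\<close>
  define M where "M = M0 + K * \<delta> + H"
  \<comment> \<open>Largest distance between a point z of [-a, 1 - a] and the Gaussian centre y -
    \<mu>, for \<bar>y + a\<bar> \<le> M.\<close>
  define R where "R = M + 1 + \<bar>\<mu>\<bar>"
  define k where "k = normal_density 0 \<sigma> R"
  have k: "k > 0" unfolding k_def using sigma_pos by (rule normal_density_pos)
  \<comment> \<open>Pointwise gain per unit of h: comparison factor times kernel bound times half of
    the mean gap. Moving a barrier by \<epsilon> h costs at most C \<epsilon> h, whence the bound
    \<eta> / C on \<epsilon>.\<close>
  define \<eta> where "\<eta> = exp (- L) * (k * (p / 2))"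
  have \<eta>: "\<eta> > 0" using k p by (simp add: \<eta>_def)
  show ?thesis
  proof (rule exI[of _ "min 1 (\<eta> / C)"], intro conjI allI impI)
    show "0 < min 1 (\<eta> / C)" using \<eta> C by simp
    show "min 1 (\<eta> / C) \<le> 1" by simp
    fix \<epsilon> w a b e
    assume \<epsilon>: "0 < \<epsilon>" "\<epsilon> \<le> min 1 (\<eta> / C)" and w: "solution w" and tr: "trapped (w 0) a b e"
      and hH: "b - a \<le> H" and e': "e * exp (- \<nu>) + \<theta> * (\<epsilon> * (b - a)) \<le> \<delta>"
    define h where "h = b - a"
    have ab: "0 \<le> h" and e: "0 \<le> e" "e \<le> \<delta>" using tr by (auto simp: trapped_def h_def)
    have \<epsilon>1: "\<epsilon> \<le> 1" and \<epsilon>C: "C * \<epsilon> \<le> \<eta>" using \<epsilon> C by (auto simp: field_simps)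
    have Ke: "0 \<le> K * e" "K * e \<le> K * \<delta>" using K0 e by (auto intro: mult_left_mono)
    have \<epsilon>h: "0 \<le> \<epsilon> * h" "\<epsilon> * h \<le> h" using \<epsilon> \<epsilon>1 ab by (auto simp: mult_left_le_one_le)
    have C\<epsilon>h: "C * (\<epsilon> * h) \<le> \<eta> * h" using mult_right_mono[OF \<epsilon>C ab] by simp
    define gl where "gl y = w 0 y - (V (y + a) - e)" for y
    define gu where "gu y = V (y + b) + e - w 0 y" for y
    have V_meas [measurable]: "V \<in> borel_measurable borel"
      by (intro borel_measurable_continuous_onI DERIV_continuous_on) (rule has_field_derivative_at_within[OF V_deriv])
    have bw: "bounded_borel (w 0)" by (rule bounded_borel_slice[OF duhamelD(1)[OF w]])
    note [measurable] = bounded_borelD[OF bw]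
    from bw obtain B where B: "\<And>y. \<bar>w 0 y\<bar> \<le> B" by (auto simp: bounded_borel_def)
    have gl: "bounded_borel gl" and gu: "bounded_borel gu"
    proof -
      have "\<bar>gl y\<bar> \<le> B + 1 + e" "\<bar>gu y\<bar> \<le> B + 1 + e" for y
        using B[of y] V_abs[of "y + a"] V_abs[of "y + b"] e by (auto simp: gl_def gu_def)
      then show "bounded_borel gl" "bounded_borel gu"
        by (auto intro!: bounded_borelI[where B="B + 1 + e"] simp: gl_def[abs_def] gu_def[abs_def])
    qed
    have gl0: "0 \<le> gl y" and gu0: "0 \<le> gu y" for y
      using tr by (auto simp: gl_def gu_def trapped_def algebra_simps)
    have near: "\<bar>z - (y - \<mu>)\<bar> \<le> R" if "\<bar>y + a\<bar> \<le> M" "z \<in> {-a..1 - a}" for y z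
      using that by (auto simp: R_def)
    have int: "set_integrable lborel {-a..1 - a} g" if g: "bounded_borel g" for g
    proof -
      from g obtain B where B: "\<And>x. \<bar>g x\<bar> \<le> B" by (auto simp: bounded_borel_def)
      note [measurable] = bounded_borelD[OF g]
      show ?thesis
        by (subst set_integrable_def, rule integrableI_bounded_set_indicator[where B=B])
           (use B in \<open>auto simp: emeasure_lborel_Icc_eq\<close>)
    qed
    have "p * h = (LBINT z:{-a..1 - a}. p * h)" by (simp add: set_lebesgue_integral_def)
    also have "\<dots> \<le> (LBINT z:{-a..1 - a}. gl z + gu z)"
    proof (rule set_integral_mono)
      show "set_integrable lborel {-a..1 - a} (\<lambda>z. p * h)"
        by (rule int) (auto simp: bounded_borel_def)
      show "set_integrable lborel {-a..1 - a} (\<lambda>z. gl z + gu z)"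
        by (intro set_integral_add int gl gu)
      fix z assume z: "z \<in> {-a..1 - a}"
      have "p * ((z + b) - (z + a)) \<le> V (z + b) - V (z + a)"
        by (rule V_diff_ge) (use ab z hH in \<open>auto simp: h_def intro!: p(2)\<close>)
      then show "p * h \<le> gl z + gu z" using e by (simp add: gl_def gu_def h_def)
    qed
    also have "\<dots> = (LBINT z:{-a..1 - a}. gl z) + (LBINT z:{-a..1 - a}. gu z)"
      by (intro set_integral_add int gl gu)
    finally have sum: "p * h \<le> (LBINT z:{-a..1 - a}. gl z) + (LBINT z:{-a..1 - a}. gu z)" .
    have gain: "\<eta> * h \<le> exp (- L * 1) * S 1 g y"
      if g: "bounded_borel g" "\<And>x. 0 \<le> g x" and "p / 2 * h \<le> (LBINT z:{-a..1 - a}. g z)" "\<bar>y + a\<bar> \<le> M" for g y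
    proof -
      have "k * (p / 2 * h) \<le> k * (LBINT z:{-a..1 - a}. g z)" using that(3) k by (intro mult_left_mono) auto
      also have "\<dots> \<le> S 1 g y" unfolding k_def by (rule S_1_lower_bound[OF g near[OF that(4)]])
      finally have "exp (- L) * (k * (p / 2 * h)) \<le> exp (- L) * S 1 g y" by (intro mult_left_mono) auto
      then show ?thesis by (simp add: \<eta>_def mult_ac)
    qed
    have Snn: "0 \<le> exp (- L * 1) * S 1 gl z" "0 \<le> exp (- L * 1) * S 1 gu z" for z
      using gl0 gu0 by (auto intro!: mult_nonneg_nonneg S_nonneg)
    have up: "w 1 z + exp (- L * 1) * S 1 gu z \<le> V (z + b + K * e) + e * exp (- \<nu>)" for z
      using barrier_evolution(1)[OF K w tr zero_le_one, of z] by (simp add: gu_def[abs_def])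
    have low: "V (z + a - K * e) - e * exp (- \<nu>) + exp (- L * 1) * S 1 gl z \<le> w 1 z" for z
      using barrier_evolution(2)[OF K w tr zero_le_one, of z] by (simp add: gl_def[abs_def])
    have \<theta>h: "0 \<le> \<theta> * (\<epsilon> * h)" using \<theta> \<epsilon>h by simp
    have e'': "0 \<le> e * exp (- \<nu>) + \<theta> * (\<epsilon> * h)" "e * exp (- \<nu>) + \<theta> * (\<epsilon> * h) \<le> \<delta>"
      using e \<theta>h e' by (auto simp: h_def)
    \<comment> \<open>The gaps to the two barriers add up to at least p h in the mean, so one of
      them accounts for half; that barrier is moved inwards.\<close>
    consider "p / 2 * h \<le> (LBINT z:{-a..1 - a}. gl z)" | "p / 2 * h \<le> (LBINT z:{-a..1 - a}. gu z)"
      using sum by fastforce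
    then show "\<exists>a' b'. trapped (w 1) a' b' (e * exp (- \<nu>) + \<theta> * (\<epsilon> * (b - a))) \<and>
       b' - a' = (1 - \<epsilon>) * (b - a) + 2 * K * e \<and> \<bar>a' - a\<bar> \<le> K * e + \<epsilon> * (b - a)"
      unfolding h_def[symmetric]
    proof cases
      case 1
      define a' b' where "a' = a - K * e + \<epsilon> * h" and "b' = b + K * e"
      have "V (z + a') - V (z + a - K * e) \<le> exp (- L * 1) * S 1 gl z + \<theta> * (\<epsilon> * h)" for z
      proof (cases "\<bar>z + a\<bar> \<le> M")
        case True
        have "V (z + a') - V (z + a - K * e) \<le> C * ((z + a') - (z + a - K * e))"
          by (rule V_diff_le) (use \<epsilon>h C' in \<open>auto simp: a'_def\<close>)
        also have "\<dots> = C * (\<epsilon> * h)" by (simp add: a'_def)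
        finally show ?thesis using gain[OF gl gl0 1 True] C\<epsilon>h \<theta>h by linarith
      next
        case False
        have "V (z + a') - V (z + a - K * e) \<le> \<theta> * ((z + a') - (z + a - K * e))"
        proof (rule V_diff_le)
          show "z + a - K * e \<le> z + a'" using \<epsilon>h by (simp add: a'_def)
          fix x assume "z + a - K * e \<le> x" "x \<le> z + a'"
          then have "M0 \<le> \<bar>x\<bar>"
            using False Ke \<epsilon>h hH H unfolding M_def a'_def h_def by (smt (verit))
          then show "V' x \<le> \<theta>" by (rule M0)
        qed
        then show ?thesis using Snn(1)[of z] by (simp add: a'_def)
      qed
      then have "V (z + a') - (e * exp (- \<nu>) + \<theta> * (\<epsilon> * h)) \<le> w 1 z" for z
        using low[of z] by (smt (verit))
      moreover have "w 1 z \<le> V (z + b') + (e * exp (- \<nu>) + \<theta> * (\<epsilon> * h))" for z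
        using up[of z] Snn(2)[of z] \<theta>h by (simp add: b'_def add.assoc)
      moreover have "a' \<le> b'" using \<epsilon>h Ke unfolding a'_def b'_def h_def by linarith
      ultimately have "trapped (w 1) a' b' (e * exp (- \<nu>) + \<theta> * (\<epsilon> * h))"
        using e'' by (simp add: trapped_def)
      moreover have "b' - a' = (1 - \<epsilon>) * h + 2 * K * e" by (simp add: a'_def b'_def h_def algebra_simps)
      moreover have "\<bar>a' - a\<bar> \<le> K * e + \<epsilon> * h" unfolding a'_def using Ke \<epsilon>h by linarith
      ultimately show "\<exists>a' b'. trapped (w 1) a' b' (e * exp (- \<nu>) + \<theta> * (\<epsilon> * h)) \<and>
         b' - a' = (1 - \<epsilon>) * h + 2 * K * e \<and> \<bar>a' - a\<bar> \<le> K * e + \<epsilon> * h" by blast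
    next
      case 2
      define a' b' where "a' = a - K * e" and "b' = b + K * e - \<epsilon> * h"
      have "V (z + b + K * e) - V (z + b') \<le> exp (- L * 1) * S 1 gu z + \<theta> * (\<epsilon> * h)" for z
      proof (cases "\<bar>z + a\<bar> \<le> M")
        case True
        have "V (z + b + K * e) - V (z + b') \<le> C * ((z + b + K * e) - (z + b'))"
          by (rule V_diff_le) (use \<epsilon>h C' in \<open>auto simp: b'_def\<close>)
        also have "\<dots> = C * (\<epsilon> * h)" by (simp add: b'_def)
        finally show ?thesis using gain[OF gu gu0 2 True] C\<epsilon>h \<theta>h by linarith
      next
        case False
        have "V (z + b + K * e) - V (z + b') \<le> \<theta> * ((z + b + K * e) - (z + b'))"
        proof (rule V_diff_le)
          show "z + b' \<le> z + b + K * e" using \<epsilon>h by (simp add: b'_def)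
          fix x assume "z + b' \<le> x" "x \<le> z + b + K * e"
          then have "M0 \<le> \<bar>x\<bar>"
            using False Ke \<epsilon>h hH H unfolding M_def b'_def h_def by (smt (verit))
          then show "V' x \<le> \<theta>" by (rule M0)
        qed
        then show ?thesis using Snn(2)[of z] by (simp add: b'_def)
      qed
      then have "w 1 z \<le> V (z + b') + (e * exp (- \<nu>) + \<theta> * (\<epsilon> * h))" for z
        using up[of z] by (smt (verit))
      moreover have "V (z + a') - (e * exp (- \<nu>) + \<theta> * (\<epsilon> * h)) \<le> w 1 z" for z
        using low[of z] Snn(1)[of z] \<theta>h by (simp add: a'_def add_diff_eq)
      moreover have "a' \<le> b'" using \<epsilon>h Ke unfolding a'_def b'_def h_def by linarith
      ultimately have "trapped (w 1) a' b' (e * exp (- \<nu>) + \<theta> * (\<epsilon> * h))"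
        using e'' by (simp add: trapped_def)
      moreover have "b' - a' = (1 - \<epsilon>) * h + 2 * K * e" by (simp add: a'_def b'_def h_def algebra_simps)
      moreover have "\<bar>a' - a\<bar> \<le> K * e + \<epsilon> * h" unfolding a'_def using Ke \<epsilon>h by linarith
      ultimately show "\<exists>a' b'. trapped (w 1) a' b' (e * exp (- \<nu>) + \<theta> * (\<epsilon> * h)) \<and>
         b' - a' = (1 - \<epsilon>) * h + 2 * K * e \<and> \<bar>a' - a\<bar> \<le> K * e + \<epsilon> * h" by blast
    qed
  qed
qed

end

section \<open>Iteration of the squeezing step\<close>

context bistable_wave
begin

text \<open>The weighted quantity (b - a) + l e decays geometrically along integer times. Since
  \<open>a\<close> moves by a comparable amount in each step, it converges geometrically, and its
  limit is the asymptotic shift.\<close>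

lemma trapped_converges:
  assumes w: "solution w" and tr: "trapped (w 0) a0 b0 e0"
  shows "\<exists>A C \<gamma>. C > 0 \<and> \<gamma> > 0 \<and> (\<forall>t\<ge>0. \<forall>z. \<bar>w t z - V (z + A)\<bar> \<le> C * exp (- \<gamma> * t))"
proof -
  obtain K where K: "barrier_const K" using ex_barrier_const by blast
  then have K0: "0 < K" by (simp add: barrier_const_def)
  define r where "r = exp (- \<nu>)"
  have r: "0 < r" "r < 1" using nu_pos by (auto simp: r_def)
  \<comment> \<open>The widening 2 K e uses up exactly half of the decay (1 - r) l e of the weighted
    height.\<close>
  define l where "l = 4 * K / (1 - r)"
  have l: "0 < l" using K0 r by (simp add: l_def)
  have lK: "2 * K = l * (1 - r) / 2" using r by (simp add: l_def)
  \<comment> \<open>The increase l \<theta> \<epsilon> (b - a) of the weighted height is half of the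
    gain \<epsilon> (b - a).\<close>
  define \<theta> where "\<theta> = 1 / (2 * l)"
  have \<theta>: "0 < \<theta>" and l\<theta>: "l * \<theta> = 1 / 2" using l by (auto simp: \<theta>_def)
  define X where "X = (b0 - a0) + l * e0"
  have X: "0 \<le> X" using tr l by (auto simp: X_def trapped_def)
  \<comment> \<open>Bounds b - a at every step, because the weighted quantity never exceeds
    \<open>X\<close>. The summand 1 keeps it positive if \<open>X\<close> is 0.\<close>
  define H where "H = X + 1"
  have H: "0 < H" "X \<le> H" using X by (auto simp: H_def)
  obtain \<epsilon>0 where \<epsilon>0: "\<epsilon>0 > 0" "\<epsilon>0 \<le> 1" and sq: "\<And>\<epsilon> w a b e. 0 < \<epsilon> \<Longrightarrow> \<epsilon> \<le> \<epsilon>0 \<Longrightarrow> solution w \<Longrightarrow> trapped (w 0) a b e \<Longrightarrow>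
    b - a \<le> H \<Longrightarrow> e * r + \<theta> * (\<epsilon> * (b - a)) \<le> \<delta> \<Longrightarrow>
    \<exists>a' b'. trapped (w 1) a' b' (e * r + \<theta> * (\<epsilon> * (b - a))) \<and>
       b' - a' = (1 - \<epsilon>) * (b - a) + 2 * K * e \<and> \<bar>a' - a\<bar> \<le> K * e + \<epsilon> * (b - a)"
    using squeeze[OF K H(1) \<theta>] unfolding r_def[symmetric] by blast
  \<comment> \<open>The second bound makes the added height at most \<delta> (1 - r), just what the
    decay from \<delta> to \<delta> r frees, so the height never exceeds \<delta>.\<close>
  define \<epsilon> where "\<epsilon> = min \<epsilon>0 (\<delta> * (1 - r) / (\<theta> * H))"
  have \<epsilon>: "0 < \<epsilon>" "\<epsilon> \<le> \<epsilon>0" "\<epsilon> \<le> 1"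
    using \<epsilon>0 delta_pos r \<theta> H by (auto simp: \<epsilon>_def)
  have \<epsilon>\<delta>: "\<theta> * (\<epsilon> * H) \<le> \<delta> * (1 - r)"
  proof -
    have "\<epsilon> \<le> \<delta> * (1 - r) / (\<theta> * H)" by (simp add: \<epsilon>_def)
    then show ?thesis using \<theta> H by (simp add: pos_le_divide_eq mult_ac)
  qed
  \<comment> \<open>The factors 1 - \<epsilon> + \<epsilon>/2 for the width and r + (1 - r)/2 for
    the weighted height.\<close>
  define \<rho> where "\<rho> = max (1 - \<epsilon> / 2) ((1 + r) / 2)"
  have \<rho>: "0 < \<rho>" "\<rho> < 1" using r \<epsilon> by (auto simp: \<rho>_def)
  define P where "P n s \<longleftrightarrow> trapped (w (real n)) (fst s) (fst (snd s)) (snd (snd s)) \<and>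
    (fst (snd s) - fst s) + l * snd (snd s) \<le> \<rho> ^ n * X" for n :: nat and s :: "real \<times> real \<times> real"
  \<comment> \<open>From e \<le> \<rho>^n X / l and b - a \<le> \<rho>^n X, the displacement K e +
    \<epsilon> (b - a) of the lower shift is at most D \<rho>^n.\<close>
  define D where "D = (K / l + 1) * X"
  have "\<exists>f. \<forall>n. P n (f n) \<and> \<bar>fst (f (Suc n)) - fst (f n)\<bar> \<le> D * \<rho> ^ n"
  proof (rule dependent_nat_choice)
    show "\<exists>s. P 0 s" using tr by (intro exI[of _ "(a0, b0, e0)"]) (simp add: P_def X_def)
    fix s n assume Ps: "P n s"
    obtain a b e where s: "s = (a, b, e)" by (cases s)
    have trn: "trapped (w (real n)) a b e" and Xn: "(b - a) + l * e \<le> \<rho> ^ n * X"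
      using Ps by (auto simp: P_def s)
    have ab: "0 \<le> b - a" and e: "0 \<le> e" "e \<le> \<delta>" using trn by (auto simp: trapped_def)
    have le: "0 \<le> l * e" using l e by simp
    have "\<rho> ^ n * X \<le> 1 * X" using \<rho> X by (intro mult_right_mono power_le_one) auto
    then have hH: "b - a \<le> H" using Xn le H by linarith
    have "\<theta> * (\<epsilon> * (b - a)) \<le> \<theta> * (\<epsilon> * H)" using hH \<theta> \<epsilon> by (intro mult_left_mono) auto
    moreover have "e * r \<le> \<delta> * r" using e r by (intro mult_right_mono) auto
    ultimately have e': "e * r + \<theta> * (\<epsilon> * (b - a)) \<le> \<delta>" using \<epsilon>\<delta> by (simp add: algebra_simps)
    have wn: "solution (\<lambda>t. w (real n + t))" using duhamel_shift[OF w, of "real n"] by simp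
    obtain a' b' where tr': "trapped (w (real n + 1)) a' b' (e * r + \<theta> * (\<epsilon> * (b - a)))"
      and h': "b' - a' = (1 - \<epsilon>) * (b - a) + 2 * K * e" and a': "\<bar>a' - a\<bar> \<le> K * e + \<epsilon> * (b - a)"
      using sq[OF \<epsilon>(1,2) wn, of a b e] trn hH e' by auto
    have "(b' - a') + l * (e * r + \<theta> * (\<epsilon> * (b - a))) =
        (1 - \<epsilon>) * (b - a) + l * (1 - r) / 2 * e + l * e * r + (l * \<theta>) * (\<epsilon> * (b - a))"
      unfolding h' lK by (simp only: distrib_left mult.assoc add.assoc)
    also have "\<dots> = (1 - \<epsilon> / 2) * (b - a) + (1 + r) / 2 * (l * e)"
      unfolding l\<theta> by (simp add: field_simps)
    also have "\<dots> \<le> \<rho> * (b - a) + \<rho> * (l * e)"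
      using ab le by (intro add_mono mult_right_mono) (auto simp: \<rho>_def)
    also have "\<dots> = \<rho> * ((b - a) + l * e)" by (simp only: distrib_left)
    also have "\<dots> \<le> \<rho> * (\<rho> ^ n * X)" using Xn \<rho> by (intro mult_left_mono) auto
    finally have Xn': "(b' - a') + l * (e * r + \<theta> * (\<epsilon> * (b - a))) \<le> \<rho> ^ Suc n * X" by simp
    have "K * e + \<epsilon> * (b - a) \<le> K / l * (l * e) + 1 * (b - a)"
      using l \<epsilon> ab by (intro add_mono mult_right_mono) auto
    also have "\<dots> \<le> K / l * (\<rho> ^ n * X) + 1 * (\<rho> ^ n * X)"
      using Xn ab le K0 l by (intro add_mono mult_left_mono) auto
    also have "\<dots> = D * \<rho> ^ n" by (simp add: D_def algebra_simps)
    finally have "\<bar>a' - a\<bar> \<le> D * \<rho> ^ n" using a' by linarith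
    with tr' Xn' show "\<exists>s'. P (Suc n) s' \<and> \<bar>fst s' - fst s\<bar> \<le> D * \<rho> ^ n"
      by (intro exI[of _ "(a', b', e * r + \<theta> * (\<epsilon> * (b - a)))"]) (simp add: P_def s add.commute)
  qed
  then obtain f where f: "\<And>n. P n (f n)" "\<And>n. \<bar>fst (f (Suc n)) - fst (f n)\<bar> \<le> D * \<rho> ^ n" by blast
  obtain A where A: "\<And>n. \<bar>fst (f n) - A\<bar> \<le> D / (1 - \<rho>) * \<rho> ^ n"
    using geometric_limit_bound[of "\<lambda>n. fst (f n)", OF f(2) \<rho>] by auto
  obtain C where C: "C > 0" "\<And>x. \<bar>V' x\<bar> \<le> C" using V'_bounded by auto
  define E where "E = C * (D / (1 - \<rho>) + X + K * (X / l)) + X / l"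
  have D0: "0 \<le> D" using K0 l X by (simp add: D_def)
  have E0: "0 \<le> E" unfolding E_def using C D0 \<rho> X K0 l by simp
  define \<gamma> where "\<gamma> = - ln \<rho>"
  have \<gamma>: "0 < \<gamma>" using \<rho> by (simp add: \<gamma>_def)
  have main: "\<bar>w t z - V (z + A)\<bar> \<le> (E * exp \<gamma> + 1) * exp (- \<gamma> * t)" if t: "0 \<le> t" for t z
  proof -
    define n where "n = nat \<lfloor>t\<rfloor>"
    have n: "real n \<le> t" "t \<le> real n + 1" using t by (auto simp: n_def)
    obtain a b e where fn: "f n = (a, b, e)" by (cases "f n")
    have trn: "trapped (w (real n)) a b e" and Xn: "(b - a) + l * e \<le> \<rho> ^ n * X"
      using f(1)[of n] by (auto simp: P_def fn)
    have an: "\<bar>a - A\<bar> \<le> D / (1 - \<rho>) * \<rho> ^ n" using A[of n] by (simp add: fn)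
    have ab: "0 \<le> b - a" and e: "0 \<le> e" using trn by (auto simp: trapped_def)
    have wn: "solution (\<lambda>t. w (real n + t))" using duhamel_shift[OF w, of "real n"] by simp
    have bar: "w t z \<le> V (z + b + K * e) + e * exp (- \<nu> * (t - real n))"
      "V (z + a - K * e) - e * exp (- \<nu> * (t - real n)) \<le> w t z"
      using barrier_evolution_weak[OF K wn, of a b e "t - real n" z] trn n by auto
    have ee: "e * exp (- \<nu> * (t - real n)) \<le> e * 1"
      using e nu_pos n by (intro mult_left_mono) auto
    have "l * e \<le> \<rho> ^ n * X" using Xn ab by linarith
    then have el: "e \<le> X / l * \<rho> ^ n" using l by (simp add: field_simps)
    have h: "b - a \<le> X * \<rho> ^ n" using Xn e l by (simp add: mult.commute) (smt (verit) mult_nonneg_nonneg)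
    have Kel: "K * e \<le> K * (X / l * \<rho> ^ n)" using el K0 by (intro mult_left_mono) auto
    have Ke: "0 \<le> K * e" using K0 e by simp
    define Y where "Y = D / (1 - \<rho>) * \<rho> ^ n + X * \<rho> ^ n + K * (X / l * \<rho> ^ n)"
    have lip: "\<bar>V (z + x) - V (z + A)\<bar> \<le> C * Y" if "\<bar>x - A\<bar> \<le> Y" for x
    proof -
      have "\<bar>V (z + x) - V (z + A)\<bar> \<le> C * \<bar>(z + x) - (z + A)\<bar>" by (rule V_lipschitz[OF C(2)])
      also have "\<dots> \<le> C * Y" using that C by (intro mult_left_mono) auto
      finally show ?thesis .
    qed
    have "\<bar>(b + K * e) - A\<bar> \<le> Y" "\<bar>(a - K * e) - A\<bar> \<le> Y"
      using an h Kel Ke ab unfolding Y_def by linarith+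
    from this[THEN lip] have "\<bar>w t z - V (z + A)\<bar> \<le> C * Y + e"
      using bar ee by (simp add: add.assoc[symmetric] add_diff_eq)
    also have "\<dots> \<le> C * Y + X / l * \<rho> ^ n" using el by simp
    also have "\<dots> = E * \<rho> ^ n" by (simp add: E_def Y_def algebra_simps)
    \<comment> \<open>The integer time \<open>n\<close> lags behind \<open>t\<close> by at most one,
      which costs a factor exp \<gamma>.\<close>
    also have "\<dots> \<le> E * exp (\<gamma> * (1 - t))"
    proof (rule mult_left_mono[OF _ E0])
      have "\<rho> ^ n = exp (- \<gamma> * real n)"
        using \<rho> by (simp add: \<gamma>_def exp_of_nat2_mult)
      also have "- \<gamma> * real n \<le> \<gamma> * (1 - t)" using \<gamma> n mult_left_mono[of t "real n + 1" \<gamma>] by (simp add: algebra_simps)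
      finally show "\<rho> ^ n \<le> exp (\<gamma> * (1 - t))" by simp
    qed
    also have "\<dots> = E * exp \<gamma> * exp (- \<gamma> * t)" by (simp add: algebra_simps exp_add[symmetric])
    also have "\<dots> \<le> (E * exp \<gamma> + 1) * exp (- \<gamma> * t)" by (intro mult_right_mono) auto
    finally show ?thesis .
  qed
  have "0 < E * exp \<gamma> + 1" using E0 by (simp add: add_nonneg_pos)
  with \<gamma> main show ?thesis by blast
qed

end

section \<open>Bistable nonlinearities and the moving frame\<close>

lemma C1_on_unit_mean_value:
  assumes f: "C1_on_unit f f'" and "0 \<le> x" "x \<le> y" "y \<le> 1"
  obtains z where "x \<le> z" "z \<le> y" "f y - f x = f' z * (y - x)"
proof -
  have "\<exists>z\<in>{x..y}. f y - f x = (\<lambda>h. f' z * h) (y - x)"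
  proof (rule mvt_very_simple[OF \<open>x \<le> y\<close>])
    fix z assume "x \<le> z" "z \<le> y"
    with assms have "(f has_real_derivative f' z) (at z within {0..1})"
      by (auto simp: C1_on_unit_def)
    then have "(f has_real_derivative f' z) (at z within {x..y})"
      by (rule DERIV_subset) (use assms in auto)
    then show "(f has_derivative (\<lambda>h. f' z * h)) (at z within {x..y})"
      by (simp add: has_field_derivative_def)
  qed
  then show ?thesis using that by auto
qed

text \<open>Beyond the endpoints \<open>f\<close> is continued linearly with its own negative end
  slopes, so the decrease near 0 and 1 persists outside [0,1]. The result is unbounded and hence not
  an extension in the sense of a bounded solution; the link is made through the values on
  [0,1].\<close>

lemma bistable_extension:
  assumes f: "C1_on_unit f f'" and f'0: "f' 0 < 0" and f'1: "f' 1 < 0"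
  obtains F L \<nu> \<delta> where "\<And>x. x \<in> {0..1} \<Longrightarrow> F x = f x"
    "\<And>x y. \<bar>F x - F y\<bar> \<le> L * \<bar>x - y\<bar>" "0 < \<nu>" "0 < \<delta>"
    "\<And>x y. x \<le> y \<Longrightarrow> y \<le> 2 * \<delta> \<Longrightarrow> F y - F x \<le> - \<nu> * (y - x)"
    "\<And>x y. x \<le> y \<Longrightarrow> 1 - 2 * \<delta> \<le> x \<Longrightarrow> F y - F x \<le> - \<nu> * (y - x)"
proof -
  have f'c: "continuous_on {0..1} f'" using f by (simp add: C1_on_unit_def)
  \<comment> \<open>Half of the smaller end rate; by continuity of \<open>f'\<close> the rate \<nu>
    is still available near both endpoints.\<close>
  define \<nu> where "\<nu> = min (- f' 0) (- f' 1) / 2"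
  have \<nu>: "0 < \<nu>" "f' 0 \<le> - 2 * \<nu>" "f' 1 \<le> - 2 * \<nu>" using f'0 f'1 by (auto simp: \<nu>_def min_def)
  have ex: "\<exists>d>0. \<forall>z\<in>{0..1}. \<bar>z - p\<bar> < d \<longrightarrow> f' z \<le> - \<nu>" if p: "p \<in> {0..1}" "f' p \<le> - 2 * \<nu>" for p
  proof -
    obtain d where d: "d > 0" "\<And>z. z \<in> {0..1} \<Longrightarrow> dist z p < d \<Longrightarrow> dist (f' z) (f' p) < \<nu>"
      using f'c p(1) \<nu>(1) unfolding continuous_on_iff by blast
    have "f' z \<le> - \<nu>" if "z \<in> {0..1}" "\<bar>z - p\<bar> < d" for z
      using d(2)[of z] that p(2) by (auto simp: dist_real_def)
    with d(1) show ?thesis by blast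
  qed
  obtain d0 where d0: "d0 > 0" "\<And>z. z \<in> {0..1} \<Longrightarrow> \<bar>z - 0\<bar> < d0 \<Longrightarrow> f' z \<le> - \<nu>" using ex[of 0] \<nu> by auto
  obtain d1 where d1: "d1 > 0" "\<And>z. z \<in> {0..1} \<Longrightarrow> \<bar>z - 1\<bar> < d1 \<Longrightarrow> f' z \<le> - \<nu>" using ex[of 1] \<nu> by auto
  \<comment> \<open>Besides staying in the two neighbourhoods, 2 \<delta> < 1 ensures that neither
    zone reaches the opposite endpoint, so only one linear piece is active in each.\<close>
  define \<delta> where "\<delta> = min 1 (min d0 d1) / 4"
  have \<delta>: "0 < \<delta>" "2 * \<delta> < 1" "2 * \<delta> < d0" "2 * \<delta> < d1" using d0(1) d1(1) by (auto simp: \<delta>_def min_def)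
  define cl where "cl x = max 0 (min 1 x)" for x :: real
  define F where "F x = f (cl x) + f' 0 * min x 0 + f' 1 * max (x - 1) 0" for x
  have cl: "0 \<le> cl x" "cl x \<le> 1" "x \<le> y \<Longrightarrow> cl x \<le> cl y" for x y by (auto simp: cl_def)
  obtain B where B: "\<And>z. z \<in> {0..1} \<Longrightarrow> \<bar>f' z\<bar> \<le> B"
    using compact_imp_bounded[OF compact_continuous_image[OF f'c compact_Icc]] unfolding bounded_iff by force
  have B0: "0 \<le> B" using B[of 0] by simp
  have flip: "\<bar>f x - f y\<bar> \<le> B * \<bar>x - y\<bar>" if "x \<in> {0..1}" "y \<in> {0..1}" for x y
  proof -
    have le: "\<bar>f y - f x\<bar> \<le> B * (y - x)" if xy: "0 \<le> x" "x \<le> y" "y \<le> 1" for x y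
    proof -
      obtain z where z: "x \<le> z" "z \<le> y" "f y - f x = f' z * (y - x)"
        by (rule C1_on_unit_mean_value[OF f xy])
      then show ?thesis using B[of z] xy by (simp add: abs_mult mult_right_mono)
    qed
    show ?thesis using le[of x y] le[of y x] that by (cases "x \<le> y") (auto simp: abs_minus_commute)
  qed
  show ?thesis
  proof (rule that[of F "B + \<bar>f' 0\<bar> + \<bar>f' 1\<bar>" \<nu> \<delta>])
    show "F x = f x" if "x \<in> {0..1}" for x using that by (auto simp: F_def cl_def)
    show "0 < \<nu>" "0 < \<delta>" by fact+
    fix x y :: real
    have "\<bar>f (cl x) - f (cl y)\<bar> \<le> B * \<bar>cl x - cl y\<bar>" by (rule flip) (auto simp: cl)
    also have "\<dots> \<le> B * \<bar>x - y\<bar>" by (rule mult_left_mono[OF _ B0]) (auto simp: cl_def)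
    finally have 1: "\<bar>f (cl x) - f (cl y)\<bar> \<le> B * \<bar>x - y\<bar>" .
    have 2: "\<bar>f' 0 * min x 0 - f' 0 * min y 0\<bar> \<le> \<bar>f' 0\<bar> * \<bar>x - y\<bar>"
      unfolding right_diff_distrib[symmetric] abs_mult by (rule mult_left_mono) auto
    have 3: "\<bar>f' 1 * max (x - 1) 0 - f' 1 * max (y - 1) 0\<bar> \<le> \<bar>f' 1\<bar> * \<bar>x - y\<bar>"
      unfolding right_diff_distrib[symmetric] abs_mult by (rule mult_left_mono) auto
    have "F x - F y = (f (cl x) - f (cl y)) + (f' 0 * min x 0 - f' 0 * min y 0) +
        (f' 1 * max (x - 1) 0 - f' 1 * max (y - 1) 0)" by (simp add: F_def)
    then show "\<bar>F x - F y\<bar> \<le> (B + \<bar>f' 0\<bar> + \<bar>f' 1\<bar>) * \<bar>x - y\<bar>"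
      unfolding distrib_right
      by (simp only:) (rule order_trans[OF abs_triangle_ineq add_mono[OF order_trans[OF abs_triangle_ineq add_mono[OF 1 2]] 3]])
  next
    fix x y :: real assume xy: "x \<le> y" "y \<le> 2 * \<delta>"
    obtain z where z: "cl x \<le> z" "z \<le> cl y" "f (cl y) - f (cl x) = f' z * (cl y - cl x)"
      by (rule C1_on_unit_mean_value[OF f cl(1) cl(3)[OF xy(1)] cl(2)])
    have "cl y < d0" using xy \<delta> d0(1) by (auto simp: cl_def)
    then have "f' z \<le> - \<nu>" using d0(2)[of z] z cl(1)[of x] cl(2)[of y] by auto
    then have "f (cl y) - f (cl x) \<le> - \<nu> * (cl y - cl x)"
      unfolding z(3) using cl(3)[OF xy(1)] by (intro mult_right_mono) auto
    moreover have "f' 0 * (min y 0 - min x 0) \<le> - \<nu> * (min y 0 - min x 0)"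
      using xy(1) \<nu> by (intro mult_right_mono) auto
    moreover have "F y - F x = (f (cl y) - f (cl x)) + f' 0 * (min y 0 - min x 0)"
      using xy \<delta> by (simp add: F_def algebra_simps)
    moreover have "- \<nu> * (cl y - cl x) + - \<nu> * (min y 0 - min x 0) = - \<nu> * (y - x)"
      using xy \<delta> unfolding distrib_left[symmetric] by (simp add: cl_def min_def max_def)
    ultimately show "F y - F x \<le> - \<nu> * (y - x)" by linarith
  next
    fix x y :: real assume xy: "x \<le> y" "1 - 2 * \<delta> \<le> x"
    obtain z where z: "cl x \<le> z" "z \<le> cl y" "f (cl y) - f (cl x) = f' z * (cl y - cl x)"
      by (rule C1_on_unit_mean_value[OF f cl(1) cl(3)[OF xy(1)] cl(2)])
    have "1 - d1 < cl x" using xy \<delta> d1(1) by (auto simp: cl_def)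
    then have "f' z \<le> - \<nu>" using d1(2)[of z] z cl(1)[of x] cl(2)[of y] by auto
    then have "f (cl y) - f (cl x) \<le> - \<nu> * (cl y - cl x)"
      unfolding z(3) using cl(3)[OF xy(1)] by (intro mult_right_mono) auto
    moreover have "f' 1 * (max (y - 1) 0 - max (x - 1) 0) \<le> - \<nu> * (max (y - 1) 0 - max (x - 1) 0)"
      using xy(1) \<nu> by (intro mult_right_mono) auto
    moreover have "F y - F x = (f (cl y) - f (cl x)) + f' 1 * (max (y - 1) 0 - max (x - 1) 0)"
      using xy \<delta> by (simp add: F_def algebra_simps)
    moreover have "- \<nu> * (cl y - cl x) + - \<nu> * (max (y - 1) 0 - max (x - 1) 0) = - \<nu> * (y - x)"
      using xy \<delta> unfolding distrib_left[symmetric] by (simp add: cl_def min_def max_def)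
    ultimately show "F y - F x \<le> - \<nu> * (y - x)" by linarith
  qed
qed

section \<open>Monotone dependence on the datum and change of frame\<close>

context drift_heat
begin

text \<open>Lipschitz continuity of F is exactly the source bound that the comparison asks of the
  difference. The lemma confines solutions to [0,1] and, used in both directions, gives
  uniqueness.\<close>

lemma solution_mono:
  assumes u: "duhamel u (\<lambda>t y. F (u t y))" and v: "duhamel v (\<lambda>t y. F (v t y))"
    and F: "\<And>x y. \<bar>F x - F y\<bar> \<le> L * \<bar>x - y\<bar>" and le: "\<And>y. u 0 y \<le> v 0 y" and t: "0 \<le> t"
  shows "u t y \<le> v t y"
proof -
  have L: "0 \<le> L" using F[of 0 1] by simp
  have "exp (- L * t) * S t (\<lambda>y. v 0 y - u 0 y) y \<le> v t y - u t y"
  proof (rule duhamel_comparison[OF duhamel_diff[OF v u] L _ _ t])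
    show "- L * \<bar>v s y - u s y\<bar> \<le> F (v s y) - F (u s y)" for s y
      using F[of "v s y" "u s y"] by simp
  qed (simp add: le)
  moreover have "0 \<le> exp (- L * t) * S t (\<lambda>y. v 0 y - u 0 y) y"
    by (intro mult_nonneg_nonneg S_nonneg) (auto simp: le)
  ultimately show ?thesis by linarith
qed

text \<open>Passing to the frame moving with speed \<open>c\<close> turns the drift \<open>\<mu>\<close> into \<open>\<mu> - c\<close>. The time
  argument is truncated at \<open>0\<close> because a mild solution is arbitrary at negative times.\<close>

lemma duhamel_moving_frame:
  assumes w: "bounded_mild_solution \<sigma> (\<mu> + c) F w0 w"
    and w0: "bounded_borel w0" and F: "bounded_borel F"
  shows "duhamel (\<lambda>t z. w (max 0 t) (z + c * max 0 t)) (\<lambda>t z. F (w (max 0 t) (z + c * max 0 t)))"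
    (is "duhamel ?u ?h") and "w 0 = w0"
proof -
  interpret rest: drift_heat \<sigma> "\<mu> + c" by unfold_locales (rule sigma_pos)
  have wm: "(\<lambda>(t, y). w t y) \<in> borel_measurable (restrict_space borel ({0..} \<times> UNIV))"
    using w by (simp add: bounded_mild_solution_def)
  obtain B where "\<forall>x\<in>(\<lambda>(t, y). w t y) ` ({0..} \<times> UNIV). norm x \<le> B"
    using w unfolding bounded_mild_solution_def bounded_iff by blast
  then have B: "\<bar>w t y\<bar> \<le> B" if "0 \<le> t" for t y
    using that by auto
  have "(\<lambda>(t, z). (max 0 t, z + c * max 0 t)) \<in> borel \<Otimes>\<^sub>M borel \<rightarrow>\<^sub>M restrict_space (borel \<Otimes>\<^sub>M borel) ({0..} \<times> UNIV)"
    by (rule measurable_restrict_space2) (auto simp: space_pair_measure)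
  from measurable_compose[OF this[unfolded borel_prod] wm]
  have um: "case_prod ?u \<in> borel_measurable (borel \<Otimes>\<^sub>M borel)"
    by (simp add: borel_prod case_prod_beta)
  have bu: "bounded_borel2 ?u"
    unfolding bounded_borel2_def using um B by (auto intro!: exI[of _ B])
  have bh: "bounded_borel2 ?h"
  proof -
    from F obtain C where "\<And>x. \<bar>F x\<bar> \<le> C" by (auto simp: bounded_borel_def)
    moreover have "case_prod ?h \<in> borel_measurable (borel \<Otimes>\<^sub>M borel)"
      using measurable_compose[OF um bounded_borelD[OF F]] by (simp add: case_prod_beta)
    ultimately show ?thesis unfolding bounded_borel2_def by blast
  qed
  \<comment> \<open>In time \<tau> the frame advances by c \<tau>, which cancels the extra drift;
    used with \<tau> = t - s.\<close>
  have frame: "rest.S \<tau> g (z + c * s + c * \<tau>) = S \<tau> (\<lambda>z. g (z + c * s)) z" for \<tau> g z s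
    unfolding rest.S_def S_def by (simp add: algebra_simps)
  have eq: "?u t z = S t w0 z + duhamel_term ?h t z" if t: "0 \<le> t" for t z
  proof -
    have "?u t z = heat_semigroup \<sigma> (\<mu> + c) t w0 (z + c * t) +
        (LBINT s:{0..t}. heat_semigroup \<sigma> (\<mu> + c) (t - s) (\<lambda>z. F (w s z)) (z + c * t))"
      using w t by (simp add: bounded_mild_solution_def)
    also have "heat_semigroup \<sigma> (\<mu> + c) t w0 (z + c * t) = S t w0 z"
      using rest.S_eq_heat_semigroup[OF bounded_borelD[OF w0] t] frame[of t w0 z 0] by simp
    also have "(LBINT s:{0..t}. heat_semigroup \<sigma> (\<mu> + c) (t - s) (\<lambda>z. F (w s z)) (z + c * t)) =
        (LBINT s:{0..t}. S (t - s) (?h s) z)"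
    proof (rule set_lebesgue_integral_cong)
      show "\<forall>s. s \<in> {0..t} \<longrightarrow> heat_semigroup \<sigma> (\<mu> + c) (t - s) (\<lambda>z. F (w s z)) (z + c * t) = S (t - s) (?h s) z"
      proof (intro allI impI)
        fix s assume s: "s \<in> {0..t}"
        \<comment> \<open>Undoing the shift of the frame recovers measurability of
          \<open>F (w s z)\<close> in z for a fixed s \<ge> 0.\<close>
        have "(\<lambda>z. ?h s (z - c * s)) \<in> borel_measurable borel"
          by (rule measurable_compose[OF _ bounded_borelD[OF bounded_borel_slice[OF bh]]]) measurable
        then have "(\<lambda>z. F (w s z)) \<in> borel_measurable borel" using s by simp
        then have "heat_semigroup \<sigma> (\<mu> + c) (t - s) (\<lambda>z. F (w s z)) (z + c * t) =
            rest.S (t - s) (\<lambda>z. F (w s z)) (z + c * s + c * (t - s))"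
          using s by (subst rest.S_eq_heat_semigroup) (auto simp: algebra_simps)
        also have "\<dots> = S (t - s) (?h s) z" unfolding frame using s by simp
        finally show "heat_semigroup \<sigma> (\<mu> + c) (t - s) (\<lambda>z. F (w s z)) (z + c * t) = S (t - s) (?h s) z" .
      qed
    qed simp
    also have "\<dots> = duhamel_term ?h t z"
      unfolding duhamel_term_def
      by (rule integral_time_measure[symmetric, OF bounded_borelD[OF bounded_borel_kernel[OF bh]]])
    finally show ?thesis .
  qed
  have u0: "?u 0 = w0"
    using eq[of 0] by (intro ext) (simp add: duhamel_term_0[OF bh])
  then show "w 0 = w0" by (simp add: fun_eq_iff)
  show "duhamel ?u ?h"
    unfolding duhamel_def u0 using bu bh eq by blast
qed

end

theorem theorem4p6:
  fixes \<sigma> \<mu> q c :: real and f f' V :: "real \<Rightarrow> real"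
  assumes "\<sigma> > 0"
    and "C1_on_unit f f'"
    and "f 0 = 0" and "f 1 = 0"
    and "0 < q" and "q < 1"
    and "{x \<in> {0<..<1}. f x = 0} = {q}"
    and "\<forall>x\<in>{0<..<q}. f x < 0"
    and "\<forall>x\<in>{q<..<1}. f x > 0"
    and "f' 0 < 0" and "f' q > 0" and "f' 1 < 0"
    and "traveling_wave \<sigma> \<mu> f c V"
  shows "\<forall>w0. is_cdf w0 \<longrightarrow>
    (\<exists>y0 K \<gamma>. K > 0 \<and> \<gamma> > 0 \<and>
      (\<forall>w. bounded_solution \<sigma> \<mu> f w0 w \<longrightarrow>
        (\<forall>t\<ge>0. (SUP y. \<bar>w t y - V (y - c * t - y0)\<bar>) \<le> K * exp (- \<gamma> * t))))"
proof (intro allI impI)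
  fix w0 assume cdf: "is_cdf w0"
  obtain F L \<nu> \<delta> where Ff: "\<And>x. x \<in> {0..1} \<Longrightarrow> F x = f x"
    and F_lip: "\<And>x y. \<bar>F x - F y\<bar> \<le> L * \<bar>x - y\<bar>" and \<nu>: "0 < \<nu>" and \<delta>: "0 < \<delta>"
    and F_slope: "\<And>x y. x \<le> y \<Longrightarrow> y \<le> 2 * \<delta> \<Longrightarrow> F y - F x \<le> - \<nu> * (y - x)"
      "\<And>x y. x \<le> y \<Longrightarrow> 1 - 2 * \<delta> \<le> x \<Longrightarrow> F y - F x \<le> - \<nu> * (y - x)"
    using bistable_extension[OF assms(2) assms(10) assms(12)] by metis
  obtain V' V'' where V: "strict_mono V" "(V \<longlongrightarrow> 0) at_bot" "(V \<longlongrightarrow> 1) at_top"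
    and V': "\<And>x. (V has_real_derivative V' x) (at x)" "\<And>x. (V' has_real_derivative V'' x) (at x)"
      "continuous_on UNIV V''"
    and ode: "\<And>x. \<sigma>\<^sup>2 / 2 * V'' x + (c - \<mu>) * V' x + f (V x) = 0"
    using assms(13) unfolding traveling_wave_def by blast
  have FV: "F (V x) = f (V x)" for x
    using strict_mono_between_limits[OF V, of x] by (intro Ff) auto
  \<comment> \<open>With drift \<mu> - c the travelling-wave equation becomes the stationary profile
    equation of the locale.\<close>
  interpret bistable_wave \<sigma> "\<mu> - c" F V V' V'' L \<nu> \<delta>
  proof unfold_locales
    show "\<sigma>\<^sup>2 / 2 * V'' x - (\<mu> - c) * V' x + F (V x) = 0" for x
      using ode[of x] unfolding FV by (simp add: algebra_simps)
  qed (use assms Ff F_lip \<nu> \<delta> F_slope V V' in auto)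
  have w0_mono: "mono w0" and w0_bot: "(w0 \<longlongrightarrow> 0) at_bot" and w0_top: "(w0 \<longlongrightarrow> 1) at_top"
    using cdf by (auto simp: is_cdf_def)
  have w0_01: "0 \<le> w0 y" "w0 y \<le> 1" for y
  proof -
    show "0 \<le> w0 y"
    proof (rule tendsto_upperbound[OF w0_bot])
      show "\<forall>\<^sub>F x in at_bot. w0 x \<le> w0 y"
        using eventually_le_at_bot[of y] by eventually_elim (rule monoD[OF w0_mono])
    qed simp
    show "w0 y \<le> 1"
    proof (rule tendsto_lowerbound[OF w0_top])
      show "\<forall>\<^sub>F x in at_top. w0 y \<le> w0 x"
        using eventually_ge_at_top[of y] by eventually_elim (rule monoD[OF w0_mono])
    qed simp
  qed
  have w0_b: "bounded_borel w0"
    using w0_01 by (intro bounded_borelI[where B=1] borel_measurable_mono w0_mono) auto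
  define u where "u w t z = w (max 0 t) (z + c * max 0 t)" for w :: "real \<Rightarrow> real \<Rightarrow> real" and t z
  have sol: "solution (u w)" "u w 0 = w0" if "bounded_solution \<sigma> \<mu> f w0 w" for w
  proof -
    from that obtain G where G: "bounded_lipschitz_extension f G" and w: "bounded_mild_solution \<sigma> \<mu> G w0 w"
      by (auto simp: bounded_solution_def)
    from G obtain M where M: "M-lipschitz_on UNIV G" and Gf: "\<And>x. x \<in> {0..1} \<Longrightarrow> G x = f x"
      and Gb: "bounded (range G)" by (auto simp: bounded_lipschitz_extension_def)
    have G_lip: "\<bar>G x - G y\<bar> \<le> M * \<bar>x - y\<bar>" for x y
      using lipschitz_onD[OF M, of x y] by (simp add: dist_real_def)
    have "bounded_borel G"
      using Gb borel_measurable_continuous_onI[OF lipschitz_on_continuous_on[OF M]]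
      by (auto simp: bounded_borel_def bounded_iff)
    then have uG: "duhamel (u w) (\<lambda>t z. G (u w t z))" and w_0: "w 0 = w0"
      using duhamel_moving_frame[of c G w0 w] w w0_b by (simp_all add: u_def[abs_def])
    show u0: "u w 0 = w0" by (simp add: u_def[abs_def] w_0)
    have G01: "G 0 = 0" "G 1 = 0" using Gf assms(3,4) by auto
    \<comment> \<open>The constants 0 and 1 are solutions because \<open>G\<close> vanishes at both,
      so they enclose any solution with data in [0,1].\<close>
    have c01: "duhamel (\<lambda>t y. 0) (\<lambda>t y. G 0)" "duhamel (\<lambda>t y. 1) (\<lambda>t y. G 1)"
      using duhamel_const[of 0] duhamel_const[of 1] by (simp_all add: G01)
    have "0 \<le> u w (max 0 t) z" "u w (max 0 t) z \<le> 1" for t z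
      using solution_mono[OF c01(1) uG G_lip, of "max 0 t" z]
        solution_mono[OF uG c01(2) G_lip, of "max 0 t" z] w0_01 u0 by auto
    then have "u w t z \<in> {0..1}" for t z
      by (simp add: u_def)
    \<comment> \<open>Here the unknown bounded extension \<open>G\<close> is exchanged for the
      linear one: they agree on the range of the solution.\<close>
    then have "G (u w t z) = F (u w t z)" for t z using Gf Ff by simp
    with uG show "solution (u w)" by simp
  qed
  show "\<exists>y0 K \<gamma>. K > 0 \<and> \<gamma> > 0 \<and>
      (\<forall>w. bounded_solution \<sigma> \<mu> f w0 w \<longrightarrow>
        (\<forall>t\<ge>0. (SUP y. \<bar>w t y - V (y - c * t - y0)\<bar>) \<le> K * exp (- \<gamma> * t)))"
  \<comment> \<open>The shift and the constants have to be named before \<open>w\<close>. They are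
    taken from one solution \<open>v\<close>, and uniqueness carries the estimate over to every
    other; if there is no solution, any positive constants do.\<close>
  proof (cases "\<exists>w. bounded_solution \<sigma> \<mu> f w0 w")
    case False
    then show ?thesis by (intro exI[of _ 1]) auto
  next
    case True
    then obtain v where v: "bounded_solution \<sigma> \<mu> f w0 v" by blast
    \<comment> \<open>A CDF is within \<delta> of 0 and 1 outside a compact set, so sufficiently
      distant translates of V enclose it at the full admissible height \<delta>, however far apart
      they have to be.\<close>
    have "\<exists>a b. trapped w0 a b \<delta>"
    proof -
      have "\<forall>\<^sub>F y in at_bot. w0 y < \<delta>" using order_tendstoD(2)[OF w0_bot \<delta>] .
      then obtain y1 where y1: "\<And>y. y \<le> y1 \<Longrightarrow> w0 y < \<delta>" by (auto simp: eventually_at_bot_linorder)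
      have "\<forall>\<^sub>F y in at_top. 1 - \<delta> < w0 y" using order_tendstoD(1)[OF w0_top, of "1 - \<delta>"] \<delta> by simp
      then obtain y2 where y2: "\<And>y. y \<ge> y2 \<Longrightarrow> 1 - \<delta> < w0 y" by (auto simp: eventually_at_top_linorder)
      obtain R where R: "R > 0" "\<And>x. x \<le> - R \<Longrightarrow> V x < \<delta>" "\<And>x. x \<ge> R \<Longrightarrow> 1 - \<delta> < V x"
        using V_tails[OF \<delta>] by auto
      define a b where "a = - \<bar>y2\<bar> - R" and "b = \<bar>y1\<bar> + R"
      have "V (z + a) - \<delta> \<le> w0 z" for z
      proof (cases "y2 \<le> z")
        case True then show ?thesis using y2[of z] V_less_1[of "z + a"] by simp
      next
        case False
        then have "V (z + a) < \<delta>" by (intro R(2)) (auto simp: a_def)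
        then show ?thesis using w0_01(1)[of z] by simp
      qed
      moreover have "w0 z \<le> V (z + b) + \<delta>" for z
      proof (cases "z \<le> y1")
        case True then show ?thesis using y1[of z] V_pos[of "z + b"] by simp
      next
        case False
        then have "1 - \<delta> < V (z + b)" by (intro R(3)) (auto simp: b_def)
        then show ?thesis using w0_01(2)[of z] by simp
      qed
      moreover have "a \<le> b" using R(1) by (simp add: a_def b_def)
      ultimately show ?thesis using \<delta> by (auto simp: trapped_def)
    qed
    then obtain a b where "trapped (u v 0) a b \<delta>" using sol(2)[OF v] by auto
    from trapped_converges[OF sol(1)[OF v] this]
    obtain A C \<gamma> where C: "C > 0" and \<gamma>: "\<gamma> > 0"
      and conv: "\<And>t z. 0 \<le> t \<Longrightarrow> \<bar>u v t z - V (z + A)\<bar> \<le> C * exp (- \<gamma> * t)" by blast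
    have "(SUP y. \<bar>w t y - V (y - c * t - (- A))\<bar>) \<le> C * exp (- \<gamma> * t)"
      if w: "bounded_solution \<sigma> \<mu> f w0 w" and t: "0 \<le> t" for w t
    \<comment> \<open>The pointwise bound, uniform in y, also shows that the family is bounded, so
      \<open>SUP\<close> is a genuine supremum.\<close>
    proof (rule cSUP_least)
      fix y
      have "u w t z = u v t z" for z
        using solution_mono[OF sol(1)[OF w] sol(1)[OF v] F_lip _ t, of z]
          solution_mono[OF sol(1)[OF v] sol(1)[OF w] F_lip _ t, of z] sol(2)[OF v] sol(2)[OF w] by auto
      then have "w t y = u v t (y - c * t)" using t by (simp add: u_def fun_eq_iff) (metis diff_add_cancel)
      then show "\<bar>w t y - V (y - c * t - (- A))\<bar> \<le> C * exp (- \<gamma> * t)"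
        using conv[OF t, of "y - c * t"] by simp
    qed simp
    with C \<gamma> show ?thesis by blast
  qed
qed

end
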